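(* Fix $k$, let $\mathcal L$ be a $k$-local Lindblad generator on $n$ qubits with bounded weighted interaction strength $\alpha$, and let $E$ be a collection of subsets $e\subseteq[n]$ with $|e|\le k$. Define $$\Omega_E:=\bigl\{(\mathbf P,\mathbf Q)\in\mathcal I_k:\operatorname{supp}(\mathbf P)\cup\operatorname{supp}(\mathbf Q)\subseteq e\text{ for some }e\in E\bigr\}.$$ Assume exact support on $E$, i.e. $\chi_{\mathbf P,\mathbf Q}=0$ for all $(\mathbf P,\mathbf Q)\notin\Omega_E$. If $E$ has intersection degree at most $\Delta$, $$\max_{e\in E}\bigl|\{e'\in E:e'\ne e,\ e'\cap e\ne\emptyset\}\bigr|\le\Delta ,$$ then the supplied-support algorithm run with $\Omega=\Omega_E$ (the pair $(I,I)$ being discarded) learns all entries of $G$ and $h$ to entrywise error $\mathcal O(\varepsilon_\chi)$ (with probability at least $1-\delta$) using $$\widetilde{\mathcal O}_k\Bigl(D_{k,\Delta}^2\,\varepsilon_\chi^{-2}\log\frac{|\Omega_E|}\delta\Bigr)\text{ samples},\qquad D_{k,\Delta}:=\sum_{\ell=0}^k\bigl((\Delta+1)(4^k-1)\bigr)^\ell ,$$ and $\mathcal O_k(|\Omega_E|)$ classical postprocessing time. In particular, for fixed $k$ and bounded $\Delta$, $\widetilde{\mathcal O}_{k,\Delta}\bigl(\varepsilon_\chi^{-2}\log\frac{|\Omega_E|}\delta\bigr)$ samples suffice after the support $E$ is supplied.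
   Context: Pauli notation. $\mathcal P_n=\{I,X,Y,Z\}^{\otimes n}$; $\operatorname{supp}(\mathbf P)$ is the set of qubits of nontrivial action, $\operatorname{wt}$ its size. For $S\subseteq[n]$, $\overline S=[n]\setminus S$, $\mathcal P_S$ is the set of Pauli strings on $S$, $\mathbf P_S$ the restriction of $\mathbf P$ to $S$ (also viewed as an $n$-qubit string by tensoring with identity). $X\bullet Y$ denotes $M\mapsto XMY$. $\mathcal I_k=\{(\mathbf P,\mathbf Q)\in\mathcal P_n^2:|\operatorname{supp}(\mathbf P)\cup\operatorname{supp}(\mathbf Q)|\le k\}$. Generator. A $k$-local Lindblad generator is $\mathcal L=\sum_{e\subseteq[n],|e|\le k}\mathcal L_e=-i[H,\bullet]+\sum_{e}\sum_{a}\bigl(L_{e,a}\bullet L_{e,a}^\dagger-\tfrac12\{L_{e,a}^\dagger L_{e,a},\bullet\}\bigr)$, with $H=\sum_{\operatorname{wt}(\mathbf P)\le k}h_{\mathbf P}\mathbf P$ Hermitian traceless, $L_{e,a}$ traceless supported on $e$, $\mathcal L_e$ the full contribution supported on $e$. It is uniquely $\mathcal L=-i[H,\bullet]+\sum_{\mathbf P,\mathbf Q\ne I}G_{\mathbf P,\mathbf Q}(\mathbf P\bullet\mathbf Q-\tfrac12\{\mathbf Q\mathbf P,\bullet\})=\sum_{\mathbf P,\mathbf Q}\chi_{\mathbf P,\mathbf Q}\mathbf P\bullet\mathbf Q$, with $G_{\mathbf P,\mathbf Q}=\chi_{\mathbf P,\mathbf Q}$ for $\mathbf P,\mathbf Q\neq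 I$ and $h_{\mathbf P}=\frac i2(\chi_{\mathbf P,I}-\chi_{I,\mathbf P})$. $\alpha=\max_u\sum_{e\ni u}\|\mathcal L_e^\dagger\|_{2\to2}$ (norm induced by the Hilbert--Schmidt norm). PTM entries: $L_{\mathbf P,\mathbf Q}=2^{-n}\operatorname{Tr}(\mathbf P\mathcal L(\mathbf Q))$. Supplied-support algorithm for a set $\Omega$ of index pairs. (i) One sample prepares a random product of single-qubit Pauli eigenstates, evolves it by $e^{t\mathcal L}$ with $t\in[0,(4\alpha k)^{-1}]$, and measures each qubit in a random Pauli basis; samples are independent. Overlaps $2^{-n}\operatorname{Tr}(\mathbf Pe^{t\mathcal L}(\mathbf Q))$ are estimated in parallel by median-of-means at $\mathcal O(d\log d)$ times, a degree-$d$ polynomial in $t$ ($d$ logarithmic in the inverse precision) is fitted by robust polynomial regression, and $\widehat L_{\mathbf P,\mathbf Q}$ is its derivative at $0$. (ii) For $u=(\mathbf P,\mathbf Q)\in\Omega$ with support union $S_u$, compute $\widehat\chi^{(S_u)}_u=2^{-3|S_u|}\sum_{\mathbf A,\mathbf B\in\mathcal P_{S_u}}\widehat L_{\mathbf A\otimes I,\mathbf B\otimes I}\operatorname{Tr}(\mathbf A\mathbf Q_{S_u}\mathbf B\mathbf P_{S_u})$; with registers $R_u=0$ initially, process $u\in\Omega$ in decreasing order of $|S_u|$: set $\widehat\chi_u=\widehat\chi_u^{(S_u)}-R_u$ and add $\widehat\chi_u$ to $R_w$ for every $w=(\mathbf P_T,\mathbf Q_T)\in\Omega$ with support union $T\subsetneq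 S_u$ and $\mathbf P_{S_u\setminus T}=\mathbf Q_{S_u\setminus T}$. (iii) Set $\widehat\chi=0$ outside $\Omega$ and $\widehat G_{\mathbf P,\mathbf Q}=\widehat\chi_{\mathbf P,\mathbf Q}$, $\widehat h_{\mathbf P}=\frac i2(\widehat\chi_{\mathbf P,I}-\widehat\chi_{I,\mathbf P})$. $\widetilde{\mathcal O}_k$ hides constants depending on $k$ and $\alpha$ and polylogarithmic factors in $D_{k,\Delta}/\varepsilon_\chi$ and $|\Omega_E|$. *)

theory Defs
  imports
    "HOL-Probability.Product_PMF"
    "HOL-Computational_Algebra.Polynomial"
    "Jordan_Normal_Form.Schur_Decomposition"
begin

section \<open>Pauli strings\<close>

datatype pauli = PI | PX | PY | PZ

fun pauli_entry :: "pauli \<Rightarrow> bool \<Rightarrow> bool \<Rightarrow> complex" where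
  "pauli_entry PI x y = (if x = y then 1 else 0)"
| "pauli_entry PX x y = (if x = y then 0 else 1)"
| "pauli_entry PY x y = (if x = y then 0 else if x then \<i> else - \<i>)"
| "pauli_entry PZ x y = (if x = y then (if x then - 1 else 1) else 0)"

text \<open>
  A Pauli string on a set of qubits is a letter for every natural number, trivial outside that
  set. Hence a string on \<open>S\<close> is literally also a string on every larger set (tensoring with
  identities), and restriction overwrites the other letters by \<open>PI\<close>.
\<close>

type_synonym pstring = "nat \<Rightarrow> pauli"
type_synonym pair_index = "pstring \<times> pstring"

definition pauli_strings :: "nat set \<Rightarrow> pstring set" where
  "pauli_strings S = {P. \<forall>q. q \<notin> S \<longrightarrow> P q = PI}"

definition id_string :: pstring where
  "id_string = (\<lambda>_. PI)"

definition supp :: "pstring \<Rightarrow> nat set" where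
  "supp P = {q. P q \<noteq> PI}"

definition wt :: "pstring \<Rightarrow> nat" where
  "wt P = card (supp P)"

definition restrict_string :: "pstring \<Rightarrow> nat set \<Rightarrow> pstring" where
  "restrict_string P S = (\<lambda>q. if q \<in> S then P q else PI)"

fun union_supp :: "pair_index \<Rightarrow> nat set" where
  "union_supp (P, Q) = supp P \<union> supp Q"

definition local_pairs :: "nat \<Rightarrow> nat \<Rightarrow> pair_index set" where
  "local_pairs n k = {u. fst u \<in> pauli_strings {..<n} \<and> snd u \<in> pauli_strings {..<n}
                         \<and> card (union_supp u) \<le> k}"

definition Omega :: "nat \<Rightarrow> nat \<Rightarrow> nat set set \<Rightarrow> pair_index set" where
  "Omega n k E = {u \<in> local_pairs n k. \<exists>e\<in>E. union_supp u \<subseteq> e}"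

section \<open>Matrices and superoperators\<close>

text \<open>
  The tensor product over \<open>q \<in> S\<close> of the \<open>2 \<times> 2\<close> matrices \<open>f q\<close>. Basis vectors are numbered by
  natural numbers below \<open>2 ^ card S\<close>; binary digit \<open>m\<close> is the state of the \<open>m\<close>-th smallest
  qubit of \<open>S\<close>.
\<close>

definition tensor_mat :: "nat set \<Rightarrow> (nat \<Rightarrow> bool \<Rightarrow> bool \<Rightarrow> complex) \<Rightarrow> complex mat" where
  "tensor_mat S f = Matrix.mat (2 ^ card S) (2 ^ card S)
     (\<lambda>(i, j). \<Prod>m<card S. f (sorted_list_of_set S ! m) (bit i m) (bit j m))"

text \<open>On \<open>S\<close> this is the matrix of the restriction of \<open>P\<close> to \<open>S\<close>.\<close>

definition pauli_mat :: "nat set \<Rightarrow> pstring \<Rightarrow> complex mat" where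
  "pauli_mat S P = tensor_mat S (\<lambda>q. pauli_entry (P q))"

abbreviation operators :: "nat \<Rightarrow> complex mat set" where
  "operators n \<equiv> carrier_mat (2 ^ n) (2 ^ n)"

definition mtrace :: "complex mat \<Rightarrow> complex" where
  "mtrace A = (\<Sum>i<dim_row A. A $$ (i, i))"

definition msum :: "nat \<Rightarrow> ('a \<Rightarrow> complex mat) \<Rightarrow> 'a set \<Rightarrow> complex mat" where
  "msum n f A = Matrix.mat (2 ^ n) (2 ^ n) (\<lambda>ij. \<Sum>a\<in>A. f a $$ ij)"

definition anticomm :: "complex mat \<Rightarrow> complex mat \<Rightarrow> complex mat" where
  "anticomm A B = A * B + B * A"

type_synonym superop = "complex mat \<Rightarrow> complex mat"

definition hs_norm :: "complex mat \<Rightarrow> real" where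
  "hs_norm A = sqrt (Re (mtrace (mat_adjoint A * A)))"

text \<open>Adjoint for \<open>\<langle>A, B\<rangle> = Tr (A\<^sup>\<dagger> B)\<close>, read off from the matrix units.\<close>

definition hs_adjoint :: "nat \<Rightarrow> superop \<Rightarrow> superop" where
  "hs_adjoint n F M = Matrix.mat (2 ^ n) (2 ^ n) (\<lambda>ij.
     mtrace (mat_adjoint (F (Matrix.mat (2 ^ n) (2 ^ n) (\<lambda>xy. if xy = ij then 1 else 0))) * M))"

definition superop_norm :: "nat \<Rightarrow> superop \<Rightarrow> real" where
  "superop_norm n F = (SUP M \<in> {M \<in> operators n. hs_norm M \<le> 1}. hs_norm (F M))"

definition exp_superop :: "nat \<Rightarrow> superop \<Rightarrow> real \<Rightarrow> superop" where
  "exp_superop n F t M = Matrix.mat (2 ^ n) (2 ^ n)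
     (\<lambda>ij. \<Sum>m. of_real (t ^ m / fact m) * (F ^^ m) M $$ ij)"

section \<open>Local Lindblad generators\<close>

text \<open>
  A generator is given by the Pauli coefficients \<open>h\<close> of its Hamiltonian and, for every set \<open>e\<close>
  of qubits, the finite list \<open>J e\<close> of its jump operators on \<open>e\<close>.
\<close>

definition edges :: "nat \<Rightarrow> nat \<Rightarrow> nat set set" where
  "edges n k = {e. e \<subseteq> {..<n} \<and> card e \<le> k}"

definition ham_mat :: "nat \<Rightarrow> (pstring \<Rightarrow> complex) \<Rightarrow> pstring set \<Rightarrow> complex mat" where
  "ham_mat n h A = msum n (\<lambda>P. h P \<cdot>\<^sub>m pauli_mat {..<n} P) A"

definition supported_on :: "nat \<Rightarrow> nat set \<Rightarrow> complex mat \<Rightarrow> bool" where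
  "supported_on n e M \<longleftrightarrow> (\<exists>c. M = msum n (\<lambda>P. c P \<cdot>\<^sub>m pauli_mat {..<n} P) (pauli_strings e))"

definition local_data ::
  "nat \<Rightarrow> nat \<Rightarrow> (pstring \<Rightarrow> complex) \<Rightarrow> (nat set \<Rightarrow> complex mat list) \<Rightarrow> bool" where
  "local_data n k h J \<longleftrightarrow>
     (\<forall>P. h P \<noteq> 0 \<longrightarrow> P \<in> pauli_strings {..<n} \<and> wt P \<le> k) \<and>
     mat_adjoint (ham_mat n h (pauli_strings {..<n})) = ham_mat n h (pauli_strings {..<n}) \<and>
     mtrace (ham_mat n h (pauli_strings {..<n})) = 0 \<and>
     (\<forall>e\<in>edges n k. \<forall>K\<in>set (J e). K \<in> operators n \<and> supported_on n e K \<and> mtrace K = 0)"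

definition ham_part :: "complex mat \<Rightarrow> superop" where
  "ham_part H M = (- \<i>) \<cdot>\<^sub>m (H * M - M * H)"

definition dissipator :: "complex mat \<Rightarrow> superop" where
  "dissipator K M = K * M * mat_adjoint K - (1/2) \<cdot>\<^sub>m anticomm (mat_adjoint K * K) M"

definition dissipative_part :: "nat \<Rightarrow> complex mat list \<Rightarrow> superop" where
  "dissipative_part n Ks M = msum n (\<lambda>a. dissipator (Ks ! a) M) {..<length Ks}"

definition generator ::
  "nat \<Rightarrow> nat \<Rightarrow> (pstring \<Rightarrow> complex) \<Rightarrow> (nat set \<Rightarrow> complex mat list) \<Rightarrow> superop" where
  "generator n k h J M = ham_part (ham_mat n h {P \<in> pauli_strings {..<n}. wt P \<le> k}) M
     + msum n (\<lambda>e. dissipative_part n (J e) M) (edges n k)"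

text \<open>The contribution of \<open>e\<close>: Hamiltonian terms with support exactly \<open>e\<close>, and the jumps on \<open>e\<close>.\<close>

definition local_generator ::
  "nat \<Rightarrow> (pstring \<Rightarrow> complex) \<Rightarrow> (nat set \<Rightarrow> complex mat list) \<Rightarrow> nat set \<Rightarrow> superop" where
  "local_generator n h J e M =
     ham_part (ham_mat n h {P \<in> pauli_strings {..<n}. supp P = e}) M + dissipative_part n (J e) M"

definition interaction_strength ::
  "nat \<Rightarrow> nat \<Rightarrow> (pstring \<Rightarrow> complex) \<Rightarrow> (nat set \<Rightarrow> complex mat list) \<Rightarrow> real" where
  "interaction_strength n k h J =
     Max ((\<lambda>u. \<Sum>e\<in>{e \<in> edges n k. u \<in> e}.
                 superop_norm n (hs_adjoint n (local_generator n h J e))) ` {..<n})"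

text \<open>
  The two Pauli expansions of a superoperator; each determines the coefficients at the index
  pairs it mentions.
\<close>

definition chi_expansion :: "nat \<Rightarrow> superop \<Rightarrow> (pair_index \<Rightarrow> complex) \<Rightarrow> bool" where
  "chi_expansion n F chi \<longleftrightarrow> (\<forall>M\<in>operators n.
     F M = msum n (\<lambda>(P, Q). chi (P, Q) \<cdot>\<^sub>m (pauli_mat {..<n} P * M * pauli_mat {..<n} Q))
             (pauli_strings {..<n} \<times> pauli_strings {..<n}))"

definition lindblad_expansion ::
  "nat \<Rightarrow> superop \<Rightarrow> (pstring \<Rightarrow> complex) \<Rightarrow> (pair_index \<Rightarrow> complex) \<Rightarrow> bool" where
  "lindblad_expansion n F h G \<longleftrightarrow> (\<forall>M\<in>operators n.
     F M = ham_part (ham_mat n h (pauli_strings {..<n})) M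
       + msum n (\<lambda>(P, Q). G (P, Q) \<cdot>\<^sub>m
            (pauli_mat {..<n} P * M * pauli_mat {..<n} Q
             - (1/2) \<cdot>\<^sub>m anticomm (pauli_mat {..<n} Q * pauli_mat {..<n} P) M))
          ((pauli_strings {..<n} - {id_string}) \<times> (pauli_strings {..<n} - {id_string})))"

section \<open>One sample\<close>

text \<open>
  A single-qubit Pauli eigenstate is a letter with a sign (\<open>True\<close> for \<open>+1\<close>); a sample is the
  pair of the prepared and the observed product of eigenstates.
\<close>

type_synonym eigen_labels = "nat \<Rightarrow> pauli \<times> bool"
type_synonym sample = "eigen_labels \<times> eigen_labels"

definition pm_one :: "bool \<Rightarrow> real" where
  "pm_one b = (if b then 1 else - 1)"

definition eigen_proj :: "nat \<Rightarrow> eigen_labels \<Rightarrow> complex mat" where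
  "eigen_proj n a = tensor_mat {..<n} (\<lambda>q x y.
     (pauli_entry PI x y + of_real (pm_one (snd (a q))) * pauli_entry (fst (a q)) x y) / 2)"

text \<open>Born's rule for measuring each qubit of \<open>\<rho>\<close> in the basis \<open>b\<close>.\<close>

definition measure_signs :: "nat \<Rightarrow> complex mat \<Rightarrow> pstring \<Rightarrow> (nat \<Rightarrow> bool) pmf" where
  "measure_signs n \<rho> b = embed_pmf (\<lambda>s.
     if s \<in> PiE_dflt {..<n} True (\<lambda>_. UNIV)
     then Re (mtrace (eigen_proj n (\<lambda>q. (b q, s q)) * \<rho>)) else 0)"

definition sample_pmf :: "nat \<Rightarrow> superop \<Rightarrow> real \<Rightarrow> sample pmf" where
  "sample_pmf n F t =
     bind_pmf (Pi_pmf {..<n} (PI, True) (\<lambda>_. pmf_of_set ({PX, PY, PZ} \<times> UNIV))) (\<lambda>a.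
     bind_pmf (Pi_pmf {..<n} PI (\<lambda>_. pmf_of_set {PX, PY, PZ})) (\<lambda>b.
     bind_pmf (measure_signs n (exp_superop n F t (eigen_proj n a)) b) (\<lambda>s.
     return_pmf (a, (\<lambda>q. (b q, s q))))))"

text \<open>
  Unbiased single-sample estimator of \<open>2\<^sup>-\<^sup>n Tr (P e\<^sup>t\<^sup>L(Q))\<close>: it vanishes unless the
  preparation bases agree with \<open>Q\<close> on \<open>supp Q\<close> and the measurement bases with \<open>P\<close> on \<open>supp P\<close>;
  each agreement has probability \<open>1/3\<close> per qubit.
\<close>

definition overlap_sample :: "pair_index \<Rightarrow> sample \<Rightarrow> real" where
  "overlap_sample = (\<lambda>(P, Q) (a, b).
     (\<Prod>q\<in>supp Q. if fst (a q) = Q q then 3 * pm_one (snd (a q)) else 0) *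
     (\<Prod>q\<in>supp P. if fst (b q) = P q then 3 * pm_one (snd (b q)) else 0))"

section \<open>Median of means and robust polynomial regression\<close>

definition median :: "real list \<Rightarrow> real" where
  "median xs = (sort xs ! ((length xs - 1) div 2) + sort xs ! (length xs div 2)) / 2"

text \<open>
  Tuning parameters of the estimation stage. Times are parametrized by nodes in \<open>[-1, 1]\<close>. Each
  time receives \<open>n_batches * batch_size\<close> samples, averaged within batches. \<open>n_intervals\<close>,
  \<open>rep_node\<close> and \<open>n_rounds\<close> belong to the robust regression.
\<close>

record design =
  fit_degree :: nat
  n_times :: nat
  time_node :: "nat \<Rightarrow> real"
  n_batches :: nat
  batch_size :: nat
  n_intervals :: nat
  rep_node :: "nat \<Rightarrow> real"
  n_rounds :: nat

definition n_samples :: "design \<Rightarrow> nat" where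
  "n_samples d = n_times d * n_batches d * batch_size d"

text \<open>The \<open>j\<close>-th interval, \<open>1 \<le> j \<le> m\<close>, of the Chebyshev partition of \<open>[-1, 1]\<close> of size \<open>m\<close>.\<close>

definition cheb_left :: "nat \<Rightarrow> nat \<Rightarrow> real" where
  "cheb_left m j = cos (pi * real j / real m)"

definition cheb_right :: "nat \<Rightarrow> nat \<Rightarrow> real" where
  "cheb_right m j = cos (pi * (real j - 1) / real m)"

definition interval_nodes :: "design \<Rightarrow> nat \<Rightarrow> nat list" where
  "interval_nodes d j = filter
     (\<lambda>i. time_node d i \<in> {cheb_left (n_intervals d) j .. cheb_right (n_intervals d) j})
     [0..<n_times d]"

definition valid_design :: "design \<Rightarrow> bool" where
  "valid_design d \<longleftrightarrow>
     1 \<le> fit_degree d \<and> 1 \<le> n_intervals d \<and> 1 \<le> n_rounds d \<and>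
     (\<forall>i<n_times d. time_node d i \<in> {-1..1}) \<and>
     (\<forall>j\<in>{1..n_intervals d}. interval_nodes d j \<noteq> [] \<and>
        rep_node d j \<in> {cheb_left (n_intervals d) j .. cheb_right (n_intervals d) j})"

text \<open>
  Robust polynomial regression of Kane, Karmalkar and Price (FOCS 2017), for data \<open>y i\<close> at
  \<open>time_node d i\<close>: an interval-weighted \<open>L\<^sub>1\<close> fit, followed by rounds of refinement in which
  the median residual of every interval is fitted in the maximum norm at one representative
  point per interval.
\<close>

definition l1_objective :: "design \<Rightarrow> (nat \<Rightarrow> real) \<Rightarrow> real poly \<Rightarrow> real" where
  "l1_objective d y p = (\<Sum>j=1..n_intervals d.
     (cheb_right (n_intervals d) j - cheb_left (n_intervals d) j) *
     (sum_list (map (\<lambda>i. \<bar>y i - poly p (time_node d i)\<bar>) (interval_nodes d j))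
        / real (length (interval_nodes d j))))"

definition refine :: "design \<Rightarrow> (nat \<Rightarrow> real) \<Rightarrow> real poly \<Rightarrow> real poly" where
  "refine d y p = p + arg_min
     (\<lambda>r. Max ((\<lambda>j. \<bar>poly r (rep_node d j)
                     - median (map (\<lambda>i. y i - poly p (time_node d i)) (interval_nodes d j))\<bar>)
               ` {1..n_intervals d}))
     (\<lambda>r. Polynomial.degree r \<le> fit_degree d)"

definition robust_fit :: "design \<Rightarrow> (nat \<Rightarrow> real) \<Rightarrow> real poly" where
  "robust_fit d y = (refine d y ^^ n_rounds d)
     (arg_min (l1_objective d y) (\<lambda>p. Polynomial.degree p \<le> fit_degree d))"

section \<open>Estimation stage\<close>

text \<open>The samples at time \<open>i\<close> are numbered by batch and by position within the batch.\<close>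

type_synonym data = "nat \<times> nat \<times> nat \<Rightarrow> sample"

definition sample_time :: "real \<Rightarrow> design \<Rightarrow> nat \<Rightarrow> real" where
  "sample_time T d i = T * (1 + time_node d i) / 2"

definition data_pmf :: "nat \<Rightarrow> superop \<Rightarrow> real \<Rightarrow> design \<Rightarrow> data pmf" where
  "data_pmf n F T d =
     Pi_pmf ({..<n_times d} \<times> {..<n_batches d} \<times> {..<batch_size d})
       ((\<lambda>_. (PI, True)), (\<lambda>_. (PI, True)))
       (\<lambda>(i, _, _). sample_pmf n F (sample_time T d i))"

definition overlap_estimate :: "design \<Rightarrow> data \<Rightarrow> pair_index \<Rightarrow> nat \<Rightarrow> real" where
  "overlap_estimate d \<omega> u i = median (map
     (\<lambda>b. (\<Sum>l<batch_size d. overlap_sample u (\<omega> (i, b, l))) / real (batch_size d))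
     [0..<n_batches d])"

text \<open>
  The polynomial fitted on \<open>[-1, 1]\<close> is rewritten in the time variable \<open>t \<in> [0, T]\<close> and
  differentiated at \<open>t = 0\<close>.
\<close>

definition ptm_estimate :: "real \<Rightarrow> design \<Rightarrow> data \<Rightarrow> pair_index \<Rightarrow> real" where
  "ptm_estimate T d \<omega> u =
     poly (pderiv (pcompose (robust_fit d (overlap_estimate d \<omega> u)) [:- 1, 2 / T:])) 0"

section \<open>Classical postprocessing with cost\<close>

text \<open>
  The postprocessing is a program that returns its result together with its running time. One
  unit is charged for each arithmetic operation, each access (read, write, membership test) to a
  dictionary indexed by pairs of Pauli strings, each access to a letter of a string, and each
  step of a loop. Strings are stored sparsely, so that reading the support of \<open>P\<close> costs \<open>wt P\<close>.
\<close>

type_synonym 'a timed = "'a \<times> nat"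

fun for_each :: "'a list \<Rightarrow> ('a \<Rightarrow> 's \<Rightarrow> 's timed) \<Rightarrow> 's \<Rightarrow> 's timed" where
  "for_each [] f s = (s, 0)"
| "for_each (x # xs) f s =
     (let (s', c) = f x s; (s'', c') = for_each xs f s' in (s'', 1 + c + c'))"

definition strings_list :: "nat set \<Rightarrow> pstring list" where
  "strings_list S =
     map (\<lambda>ls q. case map_of (zip (sorted_list_of_set S) ls) q of None \<Rightarrow> PI | Some l \<Rightarrow> l)
       (List.n_lists (card S) [PI, PX, PY, PZ])"

text \<open>
  Cost of the trace of a product of four Pauli matrices of dimension \<open>2 ^ s\<close>: filling them
  entry by entry (\<open>s\<close> factors each), three matrix products, one trace.
\<close>

definition trace_cost :: "nat \<Rightarrow> nat" where
  "trace_cost s = 4 * (s * 4 ^ s) + 3 * (2 * 8 ^ s) + 2 ^ s"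

text \<open>
  Letter accesses for forming \<open>A\<close> and \<open>B\<close>: \<open>2 * s\<close>. Further: one dictionary read, one
  multiplication and one addition per term; \<open>3 * s\<close> multiplications and a division at the end.
\<close>

definition local_inversion :: "(pair_index \<Rightarrow> real) \<Rightarrow> pair_index \<Rightarrow> complex timed" where
  "local_inversion Lhat u =
     (let S = union_supp u; s = card S;
          (x, c) = for_each (strings_list S) (\<lambda>A x. for_each (strings_list S) (\<lambda>B x.
             (x + of_real (Lhat (A, B)) *
                  mtrace (pauli_mat S A * pauli_mat S (snd u) * pauli_mat S B * pauli_mat S (fst u)),
              2 * s + trace_cost s + 3)) x) 0
      in (x / 2 ^ (3 * s), c + 3 * s + 1))"

type_synonym registers = "(pair_index \<Rightarrow> complex) \<times> (pair_index \<Rightarrow> complex)"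

text \<open>
  For every proper subset \<open>T\<close> of the support of size \<open>s\<close>: \<open>s\<close> units for enumerating it, \<open>2 * s\<close>
  letter accesses each for forming the restricted pair, for its support and for comparing \<open>P\<close>
  and \<open>Q\<close> off \<open>T\<close>; then a membership test, and a read, an addition and a write of \<open>R\<close>.
\<close>

definition process_index ::
  "pair_index set \<Rightarrow> (pair_index \<Rightarrow> real) \<Rightarrow> pair_index \<Rightarrow> registers \<Rightarrow> registers timed" where
  "process_index \<Omega> Lhat u st =
     (let (P, Q) = u; (chi, R) = st; S = union_supp u;
          (v, c) = local_inversion Lhat u;
          x = v - R u;
          (R', c') = for_each (filter (\<lambda>T. T \<noteq> S) (map set (subseqs (sorted_list_of_set S))))
             (\<lambda>T R. let w = (restrict_string P T, restrict_string Q T) in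
                (if w \<in> \<Omega> \<and> union_supp w = T \<and> (\<forall>q\<in>S - T. P q = Q q)
                 then R(w := R w + x) else R, 7 * card S + 4)) R
      in ((chi(u := x), R'), c + c' + 3))"

text \<open>
  Scanning the whole list once for every support size \<open>k, k - 1, ..., 0\<close> realizes the decreasing
  order; indices of the same size are processed in list order.
\<close>

definition peeling :: "nat \<Rightarrow> pair_index list \<Rightarrow> (pair_index \<Rightarrow> real) \<Rightarrow> (pair_index \<Rightarrow> complex) timed" where
  "peeling k us Lhat =
     (let ((chi, R), c) = for_each (rev [0..<Suc k]) (\<lambda>s. for_each us (\<lambda>u st.
            if card (union_supp u) = s
            then (let (st', c) = process_index (set us) Lhat u st
                  in (st', c + wt (fst u) + wt (snd u)))
            else (st, wt (fst u) + wt (snd u)))) ((\<lambda>_. 0), (\<lambda>_. 0))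
      in (chi, c))"

text \<open>
  Writing the output: \<open>G\<close> and \<open>h\<close> start as zero dictionaries, and every listed index fills its
  own entry. Testing whether a component is the identity costs one unit.
\<close>

definition read_off ::
  "pair_index list \<Rightarrow> (pair_index \<Rightarrow> complex) \<Rightarrow>
   ((pair_index \<Rightarrow> complex) \<times> (pstring \<Rightarrow> complex)) timed" where
  "read_off us chi = for_each us (\<lambda>(P, Q) (G, h).
     if P \<noteq> id_string \<and> Q \<noteq> id_string then ((G((P, Q) := chi (P, Q)), h), 4)
     else let P' = (if Q = id_string then P else Q) in
       ((G, h(P' := \<i> / 2 * (chi (P', id_string) - chi (id_string, P')))), 7))
     ((\<lambda>_. 0), (\<lambda>_. 0))"

text \<open>The first summand of the cost pays for entering \<open>us\<close> into the dictionary of \<open>set us\<close>.\<close>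

definition postprocess ::
  "nat \<Rightarrow> pair_index list \<Rightarrow> (pair_index \<Rightarrow> real) \<Rightarrow>
   ((pair_index \<Rightarrow> complex) \<times> (pstring \<Rightarrow> complex)) timed" where
  "postprocess k us Lhat =
     (let (chi, c) = peeling k us Lhat; (out, c') = read_off us chi
      in (out, length us + c + c'))"

section \<open>Supplied-support learning\<close>

definition degree_factor :: "nat \<Rightarrow> nat \<Rightarrow> real" where
  "degree_factor k \<Delta> = (\<Sum>l=0..k. ((real \<Delta> + 1) * (4 ^ k - 1)) ^ l)"

text \<open>
  The run of the whole algorithm on the list \<open>us\<close> of supplied indices and the measured data,
  with times in \<open>[0, 1 / (4 \<alpha> k)]\<close>; the result carries the postprocessing time.
\<close>

definition max_time :: "nat \<Rightarrow> real \<Rightarrow> real" where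
  "max_time k \<alpha> = 1 / (4 * \<alpha> * real k)"

definition supplied_support_run ::
  "nat \<Rightarrow> real \<Rightarrow> design \<Rightarrow> pair_index list \<Rightarrow> data \<Rightarrow>
   ((pair_index \<Rightarrow> complex) \<times> (pstring \<Rightarrow> complex)) timed" where
  "supplied_support_run k \<alpha> d us \<omega> = postprocess k us (ptm_estimate (max_time k \<alpha>) d \<omega>)"

definition accurate ::
  "nat \<Rightarrow> real \<Rightarrow> (pair_index \<Rightarrow> complex) \<Rightarrow> (pstring \<Rightarrow> complex) \<Rightarrow>
   (pair_index \<Rightarrow> complex) \<times> (pstring \<Rightarrow> complex) \<Rightarrow> bool" where
  "accurate n \<eta> G h = (\<lambda>(Ghat, hhat).
     (\<forall>P\<in>pauli_strings {..<n} - {id_string}. \<forall>Q\<in>pauli_strings {..<n} - {id_string}.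
        cmod (Ghat (P, Q) - G (P, Q)) \<le> \<eta>) \<and>
     (\<forall>P\<in>pauli_strings {..<n}. cmod (hhat P - h P) \<le> \<eta>))"

end

(*
  Every error probability enters through the overlaps Tr (P exp (t L) Q) / 2^n: Born's rule makes
  each sample an unbiased bounded estimator of them, so Hoeffding's inequality and a union bound
  over the index pairs and the times apply. With the times at Chebyshev nodes, as many as the fit
  has coefficients, the robust fit interpolates exactly, and the discrete orthogonality of the
  cosines bounds its derivative at time 0 by the accuracy of the overlaps times a polynomial in
  the degree d. Because L is local, the m-th time derivative of an overlap of Pauli strings of
  weight at most k is at most (alpha k)^m m!, so that for t <= 1 / (4 alpha k) the Taylor
  remainder of degree d is at most 4^-d, which a logarithmic d makes negligible.

  Inverting the transfer matrix on the support S of an index u yields chi_u plus the chi_v of all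
  larger v that agree with u on S and act by equal Pauli strings on both sides elsewhere. In the
  supplied set there are at most (Delta + 1) (4^k - 1) such v. Subtracting the estimates of the
  latter thus gives an error recursion with this branching number and depth at most k, whose
  solution is the factor D_{k,Delta}.
*)
theory Submission
  imports Defs "HOL-Probability.Hoeffding"
begin

section \<open>Polynomial regression at Chebyshev nodes\<close>

text \<open>Two obstacles lie outside that outline. \<open>measure_signs\<close> is an
  \<open>embed_pmf\<close>, which says something only if Born's weights are nonnegative and sum to
  one; so positivity and trace preservation of exp (t L) have to be proved, the former through Euler
  steps that are visibly positive. And \<open>chi\<close>, \<open>G\<close>, \<open>h\<close> are
  known only through expansions that they satisfy, so the relation between them must come from
  uniqueness of the Pauli coefficients. The design may depend on k, \<Delta>, \<epsilon>, \<delta>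
  and the number of supplied pairs, never on n. Hence every estimate must be free of n: the range
  9^k of one sample, and the Taylor coefficients, where the norms of the two Pauli strings cancel
  2^n. With so small a range a single batch suffices, and the median of means becomes a mean. The
  exponent 8 of the logarithm counts powers of d + 1: one for the number of times, six for the
  squared inverse accuracy of the overlaps (differentiation loses (d + 1)^3), and one for the
  logarithm from the union bound.\<close>

fun cheb :: "nat \<Rightarrow> real poly" where
  "cheb 0 = 1"
| "cheb (Suc 0) = [:0, 1:]"
| "cheb (Suc (Suc n)) = [:0, 2:] * cheb (Suc n) - cheb n"

lemma poly_cheb_cos: "poly (cheb n) (cos t) = cos (real n * t)"
proof (induction n rule: cheb.induct)
  case (3 n)
  have "cos (real (Suc (Suc n)) * t) = 2 * cos t * cos (real (Suc n) * t) - cos (real n * t)"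
    using cos_add[of "real (Suc n) * t" t] cos_diff[of "real (Suc n) * t" t]
    by (simp add: algebra_simps)
  with 3 show ?case by (simp add: algebra_simps)
qed auto

lemma poly_cheb_minus_one: "poly (cheb n) (-1) = (-1) ^ n"
  by (induction n rule: cheb.induct) auto

text \<open>The node -1 is time 0, so this is the derivative that the algorithm reads off. Its
  quadratic growth, summed over all degrees up to d, is the origin of the loss
  \<open>(d + 1) ^ 3\<close>.\<close>

lemma poly_pderiv_cheb_minus_one: "poly (pderiv (cheb n)) (-1) = - ((-1) ^ n * (real n)\<^sup>2)"
proof (induction n rule: cheb.induct)
  case (3 n)
  have "poly (pderiv (cheb (Suc (Suc n)))) (-1)
      = 2 * poly (cheb (Suc n)) (-1) - 2 * poly (pderiv (cheb (Suc n))) (-1) - poly (pderiv (cheb n)) (-1)"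
    by (simp add: pderiv_mult pderiv_diff pderiv_pCons pderiv_smult algebra_simps)
  also have "\<dots> = 2 * (-1) ^ Suc n + 2 * ((-1) ^ Suc n * (real (Suc n))\<^sup>2) + (-1) ^ n * (real n)\<^sup>2"
    unfolding 3 by (simp only: poly_cheb_minus_one)
  also have "\<dots> = - ((-1) ^ Suc (Suc n) * (real (Suc (Suc n)))\<^sup>2)"
    by (simp add: power2_eq_square algebra_simps)
  finally show ?case .
qed (simp_all add: pderiv_pCons)

lemma degree_cheb_le: "Polynomial.degree (cheb n) \<le> n"
proof (induction n rule: cheb.induct)
  case (3 n)
  have "Polynomial.degree ([:0, 2:] * cheb (Suc n)) \<le> Suc (Suc n)"
    using degree_mult_le[of "[:0, 2:]" "cheb (Suc n)"] 3 by simp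
  with 3 show ?case by (auto intro!: degree_diff_le)
qed auto

lemma coeff_cheb_Suc: "poly.coeff (cheb (Suc n)) (Suc n) = 2 ^ n"
proof (induction n)
  case (Suc n)
  have "poly.coeff (cheb n) (Suc (Suc n)) = 0"
    using degree_cheb_le[of n] by (intro coeff_eq_0) auto
  with Suc show ?case by simp
qed simp

lemma coeff_cheb_nonzero: "poly.coeff (cheb n) n \<noteq> 0"
  by (cases n) (simp_all only: coeff_cheb_Suc, simp_all)

text \<open>The leading coefficient of \<open>cheb d\<close> does not vanish, so subtracting a
  suitable multiple lowers the degree: the Chebyshev polynomials form a triangular basis.\<close>

lemma cheb_span:
  "Polynomial.degree p \<le> d \<Longrightarrow> \<exists>a. p = (\<Sum>j\<le>d. Polynomial.smult (a j) (cheb j))"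
proof (induction d arbitrary: p)
  case 0
  then obtain c where "p = [:c:]" using degree_eq_zeroE[of p] by auto
  then show ?case by (intro exI[of _ "\<lambda>_. c"]) simp
next
  case (Suc d)
  define c where "c = poly.coeff p (Suc d) / poly.coeff (cheb (Suc d)) (Suc d)"
  define r where "r = p - Polynomial.smult c (cheb (Suc d))"
  have "Polynomial.degree r \<le> Suc d"
    unfolding r_def using Suc.prems degree_cheb_le[of "Suc d"]
    by (intro degree_diff_le) (auto intro: order_trans[OF degree_smult_le])
  moreover have "poly.coeff r (Suc d) = 0"
    unfolding r_def c_def using coeff_cheb_nonzero[of "Suc d"] by simp
  ultimately have "Polynomial.degree r \<le> d"
    by (metis degree_le le_Suc_eq le_degree leading_coeff_0_iff not_less order_antisym_conv
        Suc_leI coeff_0)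
  from Suc.IH[OF this] obtain a where a: "r = (\<Sum>j\<le>d. Polynomial.smult (a j) (cheb j))" by auto
  have "p = (\<Sum>j\<le>Suc d. Polynomial.smult ((a(Suc d := c)) j) (cheb j))"
    using a by (simp add: r_def algebra_simps)
  then show ?case by blast
qed

section \<open>Discrete orthogonality of the cosines\<close>

text \<open>The angles of the zeros of \<open>cheb m\<close>. They are the midpoints of
  \<open>m\<close> equal pieces of the interval from 0 to pi, so each interval of the Chebyshev
  partition of size \<open>m\<close> contains exactly one node.\<close>

definition cheb_angle :: "nat \<Rightarrow> nat \<Rightarrow> real" where
  "cheb_angle m i = pi * (2 * real i + 1) / (2 * real m)"

text \<open>Multiplied by 2 sin x, with x half the angular spacing of the summands, the sum
  telescopes to sin (r pi) = 0; the range of r keeps sin x away from zero.\<close>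

lemma sum_cos_cheb_angle:
  assumes "0 < r" "r < 2 * m"
  shows "(\<Sum>i<m. cos (real r * cheb_angle m i)) = 0"
proof -
  define x where "x = real r * pi / (2 * real m)"
  have m: "m > 0" using assms by auto
  have "0 < x" "x < pi"
  proof -
    show "0 < x" using assms m by (simp add: x_def)
    have "real r < 2 * real m" using assms by linarith
    then show "x < pi" using m by (simp add: x_def field_simps)
  qed
  then have s: "sin x \<noteq> 0" using sin_gt_zero[of x] by simp
  have step: "2 * sin x * cos (real r * cheb_angle m i)
      = sin (2 * real (Suc i) * x) - sin (2 * real i * x)" for i
  proof -
    have e: "real r * cheb_angle m i = 2 * real i * x + x"
      using m by (simp add: cheb_angle_def x_def field_simps)
    have d: "2 * sin x * cos y = sin (y + x) - sin (y - x)" for y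
      by (simp add: sin_add sin_diff)
    have "2 * real i * x + x + x = 2 * real (Suc i) * x" by (simp add: algebra_simps)
    then show ?thesis unfolding e d by simp
  qed
  have "2 * sin x * (\<Sum>i<m. cos (real r * cheb_angle m i))
      = (\<Sum>i<m. sin (2 * real (Suc i) * x) - sin (2 * real i * x))"
    by (simp add: sum_distrib_left step del: of_nat_Suc)
  also have "\<dots> = sin (2 * real m * x)"
    by (subst sum_lessThan_telescope) simp
  also have "2 * real m * x = real r * pi" using m by (simp add: x_def)
  finally show ?thesis using s by simp
qed

lemma cheb_orthogonal:
  assumes "j < m" "l < m"
  shows "(\<Sum>i<m. cos (real j * cheb_angle m i) * cos (real l * cheb_angle m i))
    = (if j = l then if j = 0 then real m else real m / 2 else 0)"
proof -
  \<comment> \<open>The case j \<le> l is isolated because \<open>l - j\<close> is truncated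
    subtraction; the sum is symmetric in j and l. Since \<open>j + l < 2 * m\<close>, both cosines
    of the product formula fall under the vanishing sum.\<close>
  have wlog: "(\<Sum>i<m. cos (real j * cheb_angle m i) * cos (real l * cheb_angle m i))
    = (if j = l then if j = 0 then real m else real m / 2 else 0)"
    if jl: "j \<le> l" and lm: "l < m" for j l
  proof -
    have p: "cos (real j * t) * cos (real l * t) = (cos (real (l - j) * t) + cos (real (j + l) * t)) / 2" for t
      using jl cos_add[of "real l * t" "real j * t"] cos_diff[of "real l * t" "real j * t"]
      by (simp add: of_nat_diff algebra_simps)
    have "(\<Sum>i<m. cos (real j * cheb_angle m i) * cos (real l * cheb_angle m i))
        = ((\<Sum>i<m. cos (real (l - j) * cheb_angle m i)) + (\<Sum>i<m. cos (real (j + l) * cheb_angle m i))) / 2"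
      by (simp add: p sum.distrib flip: sum_divide_distrib)
    moreover have "(\<Sum>i<m. cos (real (l - j) * cheb_angle m i)) = (if j = l then real m else 0)"
      using sum_cos_cheb_angle[of "l - j" m] jl lm by auto
    moreover have "(\<Sum>i<m. cos (real (j + l) * cheb_angle m i)) = (if j = l \<and> j = 0 then real m else 0)"
      using sum_cos_cheb_angle[of "j + l" m] jl lm by auto
    ultimately show ?thesis by auto
  qed
  show ?thesis
  proof (cases "j \<le> l")
    case True then show ?thesis using wlog assms by blast
  next
    case False
    then have "(\<Sum>i<m. cos (real l * cheb_angle m i) * cos (real j * cheb_angle m i)) = 0"
      using wlog[of l j] assms by auto
    then show ?thesis using False by (simp add: mult.commute)
  qed
qed

text \<open>Orthogonality recovers each Chebyshev coefficient from the node values, with modulus at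
  most \<open>2 * \<eta>\<close>; the derivatives at -1 of the basis polynomials are then
  summed.\<close>

lemma pderiv_bound_cheb_nodes:
  assumes deg: "Polynomial.degree q \<le> d"
    and bnd: "\<And>i. i \<le> d \<Longrightarrow> \<bar>poly q (cos (cheb_angle (Suc d) i))\<bar> \<le> \<eta>"
  shows "\<bar>poly (pderiv q) (-1)\<bar> \<le> 2 * (real d + 1) ^ 3 * \<eta>"
proof -
  let ?m = "Suc d"
  let ?th = "cheb_angle ?m"
  obtain a where a: "q = (\<Sum>j\<le>d. Polynomial.smult (a j) (cheb j))" using cheb_span[OF deg] by auto
  have eta: "\<eta> \<ge> 0" using bnd[of 0] by linarith
  have al: "\<bar>a l\<bar> \<le> 2 * \<eta>" if l: "l \<le> d" for l
  proof -
    \<comment> \<open>The squared norm of the l-th cosine on the nodes. It is at least half the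
      number of nodes, which produces the factor 2 in the bound.\<close>
    define w where "w = (if l = 0 then real ?m else real ?m / 2)"
    have "(\<Sum>i<?m. poly q (cos (?th i)) * cos (real l * ?th i))
        = (\<Sum>i<?m. \<Sum>j<?m. a j * (cos (real j * ?th i) * cos (real l * ?th i)))"
      unfolding a lessThan_Suc_atMost
      by (simp add: poly_sum poly_cheb_cos sum_distrib_right mult.assoc)
    also have "\<dots> = (\<Sum>j<?m. a j * (\<Sum>i<?m. cos (real j * ?th i) * cos (real l * ?th i)))"
      by (subst sum.swap) (simp add: sum_distrib_left del: sum.lessThan_Suc)
    also have "\<dots> = (\<Sum>j<?m. a j * (if j = l then w else 0))"
      using l by (intro sum.cong refl, subst cheb_orthogonal) (auto simp: w_def)
    also have "\<dots> = a l * w"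
      using l by (simp add: if_distrib[of "\<lambda>x. _ * x"] sum.delta' cong: if_cong)
    finally have e: "a l * w = (\<Sum>i<?m. poly q (cos (?th i)) * cos (real l * ?th i))" ..
    have "\<bar>a l * w\<bar> \<le> (\<Sum>i<?m. \<bar>poly q (cos (?th i)) * cos (real l * ?th i)\<bar>)"
      unfolding e by (rule sum_abs)
    also have "\<dots> \<le> (\<Sum>i<?m. \<eta>)"
    proof (rule sum_mono)
      fix i assume "i \<in> {..<?m}"
      then have "\<bar>poly q (cos (?th i))\<bar> \<le> \<eta>" using bnd by auto
      then show "\<bar>poly q (cos (?th i)) * cos (real l * ?th i)\<bar> \<le> \<eta>"
        using mult_mono[of "\<bar>poly q (cos (?th i))\<bar>" \<eta> "\<bar>cos (real l * ?th i)\<bar>" 1] eta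
        by (simp add: abs_mult)
    qed
    also have "\<dots> = real ?m * \<eta>" by simp
    finally have "\<bar>a l\<bar> * w \<le> real ?m * \<eta>" by (simp add: abs_mult w_def split: if_splits)
    moreover have "\<bar>a l\<bar> * (real ?m / 2) \<le> \<bar>a l\<bar> * w"
      by (intro mult_left_mono) (auto simp: w_def)
    ultimately have "\<bar>a l\<bar> * (real ?m / 2) \<le> real ?m * \<eta>" by linarith
    then have "real ?m * \<bar>a l\<bar> \<le> real ?m * (2 * \<eta>)" by (simp add: field_simps)
    then show ?thesis by (subst (asm) mult_le_cancel_left_pos) auto
  qed
  have "pderiv q = (\<Sum>j\<le>d. Polynomial.smult (a j) (pderiv (cheb j)))"
    unfolding a by (simp add: higher_pderiv_sum[of 1, simplified] pderiv_smult)
  then have "\<bar>poly (pderiv q) (-1)\<bar> = \<bar>\<Sum>j\<le>d. a j * - ((-1) ^ j * (real j)\<^sup>2)\<bar>"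
    by (simp only: poly_sum poly_smult poly_pderiv_cheb_minus_one)
  also have "\<dots> \<le> (\<Sum>j\<le>d. \<bar>a j * - ((-1) ^ j * (real j)\<^sup>2)\<bar>)" by (rule sum_abs)
  also have "\<dots> \<le> (\<Sum>j\<le>d. (2 * \<eta>) * (real d + 1)\<^sup>2)"
  proof (rule sum_mono)
    fix j assume j: "j \<in> {..d}"
    have "\<bar>a j * - ((-1) ^ j * (real j)\<^sup>2)\<bar> = \<bar>a j\<bar> * (real j)\<^sup>2"
      by (simp add: abs_mult power_abs)
    also have "\<dots> \<le> (2 * \<eta>) * (real d + 1)\<^sup>2"
      using j al eta by (intro mult_mono power_mono) auto
    finally show "\<bar>a j * - ((-1) ^ j * (real j)\<^sup>2)\<bar> \<le> (2 * \<eta>) * (real d + 1)\<^sup>2" .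
  qed
  also have "\<dots> = 2 * (real d + 1) ^ 3 * \<eta>" by (simp add: power3_eq_cube power2_eq_square)
  finally show ?thesis .
qed

section \<open>The Chebyshev design and its fit\<close>

text \<open>Newton's construction: the value at a new node is corrected by a multiple of the
  polynomial that vanishes at all old nodes.\<close>

lemma poly_interpolation_exists:
  fixes x y :: "nat \<Rightarrow> real"
  assumes "inj_on x {..d}"
  shows "\<exists>p. Polynomial.degree p \<le> d \<and> (\<forall>i\<le>d. poly p (x i) = y i)"
  using assms
proof (induction d)
  case 0
  show ?case by (intro exI[of _ "[:y 0:]"]) auto
next
  case (Suc d)
  have "inj_on x {..d}" using Suc.prems by (rule inj_on_subset) auto
  with Suc.IH obtain p where p: "Polynomial.degree p \<le> d" "\<forall>i\<le>d. poly p (x i) = y i"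
    by blast
  define w where "w = (\<Prod>i\<le>d. [:- x i, 1:])"
  have "Polynomial.degree w \<le> (\<Sum>i\<le>d. Polynomial.degree [:- x i, 1:])"
    unfolding w_def by (rule order_trans[OF degree_prod_sum_le]) (auto simp: o_def)
  then have dw: "Polynomial.degree w \<le> Suc d" by simp
  have w0: "poly w (x i) = 0" if "i \<le> d" for i
    using that by (auto simp: w_def poly_prod)
  have w1: "poly w (x (Suc d)) \<noteq> 0"
    using inj_onD[OF Suc.prems, of "Suc d"] by (force simp: w_def poly_prod)
  define c where "c = (y (Suc d) - poly p (x (Suc d))) / poly w (x (Suc d))"
  have "Polynomial.degree (p + Polynomial.smult c w) \<le> Suc d"
    using p dw by (intro degree_add_le) (auto intro: order_trans[OF degree_smult_le])
  moreover have "poly (p + Polynomial.smult c w) (x i) = y i" if "i \<le> Suc d" for i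
    using that p w0 w1 by (auto simp: le_Suc_eq c_def)
  ultimately show ?case by blast
qed

lemma poly_eq_0_of_roots:
  fixes p :: "real poly" and x :: "nat \<Rightarrow> real"
  assumes "inj_on x {..d}" "Polynomial.degree p \<le> d" "\<And>i. i \<le> d \<Longrightarrow> poly p (x i) = 0"
  shows "p = 0"
proof (rule ccontr)
  assume "p \<noteq> 0"
  have "card (x ` {..d}) \<le> card {t. poly p t = 0}"
    using assms poly_roots_finite[OF \<open>p \<noteq> 0\<close>] by (intro card_mono) auto
  also have "\<dots> \<le> Polynomial.degree p" using poly_roots_degree[OF \<open>p \<noteq> 0\<close>] .
  finally show False using assms by (simp add: card_image)
qed

text \<open>The \<open>d + 1\<close> nodes match the coefficients of a polynomial of degree
  \<open>d\<close>, and there are as many intervals, so every median in the algorithm is taken over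
  one value. Intervals count from 1 and nodes from 0, whence \<open>j - 1\<close>; the
  representative of an interval is its own node.\<close>

definition cheb_design :: "nat \<Rightarrow> nat \<Rightarrow> design" where
  "cheb_design d B = \<lparr>fit_degree = d, n_times = Suc d,
     time_node = (\<lambda>i. cos (cheb_angle (Suc d) i)), n_batches = 1, batch_size = B,
     n_intervals = Suc d, rep_node = (\<lambda>j. cos (cheb_angle (Suc d) (j - 1))), n_rounds = 1\<rparr>"

lemma cheb_angle_range:
  assumes "i < m" shows "0 < cheb_angle m i" "cheb_angle m i < pi"
proof -
  show "0 < cheb_angle m i" using assms by (simp add: cheb_angle_def)
  have "2 * real i + 1 < 2 * real m" using assms by linarith
  then have "pi * ((2 * real i + 1) / (2 * real m)) < pi * 1"
    by (intro mult_strict_left_mono) auto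
  then show "cheb_angle m i < pi" by (simp add: cheb_angle_def)
qed

lemma inj_on_cheb_nodes: "inj_on (\<lambda>i. cos (cheb_angle (Suc d) i)) {..d}"
proof (rule inj_onI)
  fix i j assume "i \<in> {..d}" "j \<in> {..d}" "cos (cheb_angle (Suc d) i) = cos (cheb_angle (Suc d) j)"
  then have "cheb_angle (Suc d) i = cheb_angle (Suc d) j"
    using cheb_angle_range[of i "Suc d"] cheb_angle_range[of j "Suc d"] cos_inj_pi by auto
  then show "i = j" by (auto simp: cheb_angle_def field_simps)
qed

lemma cheb_left_less_right:
  assumes "1 \<le> j" "j \<le> m"
  shows "0 \<le> pi * (real j - 1) / real m" "pi * real j / real m \<le> pi"
    "cheb_left m j < cheb_right m j"
proof -
  have m: "m > 0" using assms by auto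
  show l: "0 \<le> pi * (real j - 1) / real m" using assms by simp
  have "pi * (real j / real m) \<le> pi * 1" using assms by (intro mult_left_mono) auto
  then show u: "pi * real j / real m \<le> pi" by simp
  have "pi * ((real j - 1) / real m) < pi * (real j / real m)"
    using m by (intro mult_strict_left_mono divide_strict_right_mono) auto
  with l u show "cheb_left m j < cheb_right m j"
    unfolding cheb_left_def cheb_right_def by (intro cos_monotone_0_pi) auto
qed

text \<open>Cosine decreases between 0 and pi, so membership means that the odd number
  \<open>2 * i + 1\<close> lies between the consecutive even numbers \<open>2 * (j - 1)\<close> and
  \<open>2 * j\<close>.\<close>

lemma cheb_node_in_interval_iff:
  assumes "i < m" "1 \<le> j" "j \<le> m"
  shows "cos (cheb_angle m i) \<in> {cheb_left m j..cheb_right m j} \<longleftrightarrow> i = j - 1"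
proof -
  have m: "m > 0" using assms by auto
  have r: "0 \<le> pi * real j / real m" "pi * real j / real m \<le> pi"
    "0 \<le> pi * (real j - 1) / real m" "pi * (real j - 1) / real m \<le> pi"
    using assms cheb_left_less_right(1,2)[of j m] cheb_left_less_right(2)[of "j - 1" m]
    by (cases "j = 1"; simp add: of_nat_diff)+
  have "cheb_left m j \<le> cos (cheb_angle m i) \<longleftrightarrow> cheb_angle m i \<le> pi * real j / real m"
    unfolding cheb_left_def using r cheb_angle_range[OF assms(1)] by (intro cos_mono_le_eq) auto
  also have "\<dots> \<longleftrightarrow> pi * (2 * real i + 1) \<le> pi * (2 * real j)"
    using m divide_le_cancel[of "pi * (2 * real i + 1)" "2 * real m" "pi * (2 * real j)"]
    by (simp add: cheb_angle_def)
  also have "\<dots> \<longleftrightarrow> 2 * real i + 1 \<le> 2 * real j" by (subst mult_le_cancel_left_pos) auto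
  finally have 1: "cheb_left m j \<le> cos (cheb_angle m i) \<longleftrightarrow> 2 * real i + 1 \<le> 2 * real j" .
  have "cos (cheb_angle m i) \<le> cheb_right m j \<longleftrightarrow> pi * (real j - 1) / real m \<le> cheb_angle m i"
    unfolding cheb_right_def using r cheb_angle_range[OF assms(1)] by (intro cos_mono_le_eq) auto
  also have "\<dots> \<longleftrightarrow> pi * (2 * (real j - 1)) \<le> pi * (2 * real i + 1)"
  proof -
    have "pi * (real j - 1) / real m = pi * (2 * (real j - 1)) / (2 * real m)"
      using m by (simp add: field_simps)
    then show ?thesis unfolding cheb_angle_def using m by (simp only: divide_le_cancel) simp
  qed
  also have "\<dots> \<longleftrightarrow> 2 * (real j - 1) \<le> 2 * real i + 1" by (subst mult_le_cancel_left_pos) auto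
  finally have 2: "cos (cheb_angle m i) \<le> cheb_right m j \<longleftrightarrow> 2 * (real j - 1) \<le> 2 * real i + 1" .
  show ?thesis using 1 2 assms by (auto; linarith)
qed

lemma interval_nodes_cheb_design:
  assumes "1 \<le> j" "j \<le> Suc d"
  shows "interval_nodes (cheb_design d B) j = [j - 1]"
proof -
  have "interval_nodes (cheb_design d B) j = filter (\<lambda>i. i = j - 1) [0..<Suc d]"
    unfolding interval_nodes_def using assms
    by (intro filter_cong) (simp_all add: cheb_design_def cheb_node_in_interval_iff del: upt_Suc atLeastAtMost_iff)
  also have "[0..<Suc d] = [0..<j - 1] @ (j - 1) # [j..<Suc d]"
    using assms upt_add_eq_append[of 0 "j - 1" "Suc d - (j - 1)"] upt_conv_Cons[of "j - 1" "Suc d"]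
    by (simp del: upt_Suc)
  finally show ?thesis using assms by (auto simp del: upt_Suc simp: filter_empty_conv)
qed

lemma valid_cheb_design: "1 \<le> d \<Longrightarrow> valid_design (cheb_design d B)"
  unfolding valid_design_def
proof (intro conjI ballI allI impI)
  fix j assume "1 \<le> d" "j \<in> {1..n_intervals (cheb_design d B)}"
  then have j: "1 \<le> j" "j \<le> Suc d" by (auto simp: cheb_design_def)
  show "interval_nodes (cheb_design d B) j \<noteq> []" using interval_nodes_cheb_design[OF j] by simp
  show "rep_node (cheb_design d B) j \<in> {cheb_left (n_intervals (cheb_design d B)) j
      ..cheb_right (n_intervals (cheb_design d B)) j}"
    using cheb_node_in_interval_iff[of "j - 1" "Suc d" j] j by (simp add: cheb_design_def)
qed (auto simp: cheb_design_def)

lemma median_singleton [simp]: "median [x] = x"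
  by (simp add: median_def)

text \<open>With one node per interval the weighted L1 objective vanishes exactly at the
  interpolating polynomial, and the refinement round sees zero residuals and adds nothing.\<close>

lemma robust_fit_interpolates:
  fixes y :: "nat \<Rightarrow> real" and d B :: nat
  defines "p \<equiv> robust_fit (cheb_design d B) y"
  shows "Polynomial.degree p \<le> d" "i \<le> d \<Longrightarrow> poly p (cos (cheb_angle (Suc d) i)) = y i"
proof -
  let ?D = "cheb_design d B" and ?x = "\<lambda>i. cos (cheb_angle (Suc d) i)"
  let ?deg = "\<lambda>p :: real poly. Polynomial.degree p \<le> d"
  have sel [simp]: "fit_degree ?D = d" "n_intervals ?D = Suc d" "time_node ?D = ?x" "n_rounds ?D = 1"
    "rep_node ?D = (\<lambda>j. ?x (j - 1))"
    by (simp_all add: cheb_design_def)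
  have obj: "l1_objective ?D y r = (\<Sum>j=1..Suc d. (cheb_right (Suc d) j - cheb_left (Suc d) j) *
      \<bar>y (j - 1) - poly r (?x (j - 1))\<bar>)" for r
    unfolding l1_objective_def by (intro sum.cong) (auto simp: interval_nodes_cheb_design)
  have width: "cheb_right (Suc d) j - cheb_left (Suc d) j > 0" if "1 \<le> j" "j \<le> Suc d" for j
    using cheb_left_less_right(3)[of j "Suc d"] that by simp
  \<comment> \<open>\<open>arg_min\<close> is a choice operator: its value is known to be a
    minimizer only once some minimizer is exhibited, and the interpolant serves for that.\<close>
  obtain p0 where p0: "?deg p0" "\<forall>i\<le>d. poly p0 (?x i) = y i"
    using poly_interpolation_exists[OF inj_on_cheb_nodes] by blast
  have obj0: "l1_objective ?D y p0 = 0" unfolding obj using p0 by (intro sum.neutral) auto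
  have nonneg: "l1_objective ?D y r \<ge> 0" for r
    unfolding obj using width by (intro sum_nonneg mult_nonneg_nonneg) (auto intro: less_imp_le)
  define p1 where "p1 = arg_min (l1_objective ?D y) ?deg"
  have "is_arg_min (l1_objective ?D y) ?deg p0"
    using p0 obj0 nonneg by (auto simp: is_arg_min_def not_less)
  then have "is_arg_min (l1_objective ?D y) ?deg p1"
    unfolding p1_def arg_min_def by (rule someI)
  then have p1: "?deg p1" "l1_objective ?D y p1 = 0"
    using p0(1) obj0 nonneg[of p1] by (auto simp: is_arg_min_def not_less intro: order_antisym)
  have wn: "0 \<le> (cheb_right (Suc d) j - cheb_left (Suc d) j) * \<bar>z\<bar>" if "j \<in> {1..Suc d}" for j z
    using width[of j] that by (intro mult_nonneg_nonneg) auto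
  have p1y: "poly p1 (?x i) = y i" if "i \<le> d" for i
  proof -
    have "\<forall>j\<in>{1..Suc d}. (cheb_right (Suc d) j - cheb_left (Suc d) j) *
      \<bar>y (j - 1) - poly p1 (?x (j - 1))\<bar> = 0"
      using p1(2) unfolding obj by (subst (asm) sum_nonneg_eq_0_iff) (blast intro: wn | simp)+
    from bspec[OF this, of "Suc i"] show ?thesis using that width[of "Suc i"] by auto
  qed
  define g where "g = (\<lambda>r. Max ((\<lambda>j. \<bar>poly r (?x (j - 1)) - median (map (\<lambda>i. y i - poly p1 (?x i)) (interval_nodes ?D j))\<bar>)
               ` {1..Suc d}))"
  \<comment> \<open>All residuals are zero by now, so the refinement minimizes the maximum of a
    polynomial over the nodes; the zero polynomial attains the value 0, and no other of degree at
    most d does.\<close>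
  have g: "g r = Max ((\<lambda>j. \<bar>poly r (?x (j - 1))\<bar>) ` {1..Suc d})" for r
    unfolding g_def by (rule arg_cong[where f = Max], intro image_cong refl)
      (auto simp: interval_nodes_cheb_design p1y)
  have gge: "\<bar>poly r (?x i)\<bar> \<le> g r" if "i \<le> d" for r i
    unfolding g using that by (intro Max_ge) (auto intro!: image_eqI[of _ _ "Suc i"])
  have g0: "g 0 = 0" unfolding g by (auto simp: image_constant_conv)
  define r where "r = arg_min g ?deg"
  have "is_arg_min g ?deg 0"
    using gge[of 0] by (auto simp: is_arg_min_def not_less g0) (meson abs_ge_zero order_trans)
  then have "is_arg_min g ?deg r" unfolding r_def arg_min_def by (rule someI)
  then have r: "?deg r" "g r \<le> 0"
    using g0 by (auto simp: is_arg_min_def not_less dest!: spec[of _ 0])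
  have "r = 0"
  proof (rule poly_eq_0_of_roots[OF inj_on_cheb_nodes r(1)])
    fix i assume "i \<le> d" then show "poly r (?x i) = 0" using gge[of i r] r(2) by auto
  qed
  then have "p = p1"
    unfolding p_def robust_fit_def refine_def by (simp add: r_def g_def p1_def)
  then show "?deg p" "i \<le> d \<Longrightarrow> poly p (?x i) = y i" using p1 p1y by auto
qed

section \<open>Postprocessing: functional specification and cost\<close>

lemma fst_for_each: "fst (for_each xs f s) = fold (\<lambda>x s. fst (f x s)) xs s"
  by (induction xs arbitrary: s) (auto simp: Let_def case_prod_unfold)

lemma snd_for_each_le:
  assumes "\<And>x s. x \<in> set xs \<Longrightarrow> snd (f x s) \<le> c"
  shows "snd (for_each xs f s) \<le> length xs * (1 + c)"
  using assms
proof (induction xs arbitrary: s)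
  case (Cons x xs)
  obtain s' c1 where 1: "f x s = (s', c1)" by fastforce
  obtain s'' c2 where 2: "for_each xs f s' = (s'', c2)" by fastforce
  have "c1 \<le> c" using Cons.prems[of x s] 1 by simp
  moreover have "c2 \<le> length xs * (1 + c)" using Cons.IH[of s'] Cons.prems 2 by simp
  ultimately show ?case using 1 2 by simp
qed simp

lemma fold_add_eq_sum_list:
  fixes g :: "'a \<Rightarrow> 'b :: comm_monoid_add"
  shows "fold (\<lambda>x s. s + g x) xs s = s + sum_list (map g xs)"
  by (induction xs arbitrary: s) (auto simp: add_ac)

lemma card_pauli [simp]: "card (UNIV :: pauli set) = 4"
  and finite_pauli [simp]: "finite (UNIV :: pauli set)"
  and UNIV_pauli: "(UNIV :: pauli set) = {PI, PX, PY, PZ}"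
proof -
  show u: "(UNIV :: pauli set) = {PI, PX, PY, PZ}" using pauli.exhaust by auto
  show "card (UNIV :: pauli set) = 4" "finite (UNIV :: pauli set)" unfolding u by auto
qed

text \<open>Seen as functions with default \<open>PI\<close>, strings inherit finiteness and
  counting, and later the exchange of sums over strings with products over qubits.\<close>

lemma pauli_strings_eq_PiE_dflt: "pauli_strings S = PiE_dflt S PI (\<lambda>_. UNIV)"
  by (auto simp: pauli_strings_def PiE_dflt_def)

lemma finite_pauli_strings [simp]: "finite S \<Longrightarrow> finite (pauli_strings S)"
  by (auto simp: pauli_strings_eq_PiE_dflt intro!: finite_PiE_dflt)

lemma card_pauli_strings: "finite S \<Longrightarrow> card (pauli_strings S) = 4 ^ card S"
  unfolding pauli_strings_eq_PiE_dflt by (subst card_PiE_dflt) auto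

lemma length_strings_list: "length (strings_list S) = 4 ^ card S"
  by (simp add: strings_list_def length_n_lists numeral_eq_Suc)

lemma set_strings_list: 
  assumes "finite S"
  shows "set (strings_list S) = pauli_strings S"
proof (intro equalityI subsetI)
  fix P assume "P \<in> set (strings_list S)"
  then obtain ls where l: "length ls = card S"
    and P: "P = (\<lambda>q. case map_of (zip (sorted_list_of_set S) ls) q of None \<Rightarrow> PI | Some l \<Rightarrow> l)"
    by (auto simp: strings_list_def set_n_lists)
  show "P \<in> pauli_strings S"
    unfolding pauli_strings_def P using l assms
    by (auto split: option.splits dest!: map_of_SomeD set_zip_leftD)
next
  fix P assume P: "P \<in> pauli_strings S"
  let ?xs = "sorted_list_of_set S"
  have "P = (\<lambda>q. case map_of (zip ?xs (map P ?xs)) q of None \<Rightarrow> PI | Some l \<Rightarrow> l)"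
    using P assms by (auto simp: map_of_zip_map pauli_strings_def)
  moreover have "map P ?xs \<in> set (List.n_lists (card S) [PI, PX, PY, PZ])"
    using UNIV_pauli by (auto simp: set_n_lists)
  ultimately show "P \<in> set (strings_list S)" unfolding strings_list_def by auto
qed

text \<open>By counting: the list is as long as the set of its members is large.\<close>

lemma distinct_strings_list: "finite S \<Longrightarrow> distinct (strings_list S)"
  by (rule card_distinct) (simp add: set_strings_list card_pauli_strings length_strings_list)

lemma union_supp_eq: "union_supp u = supp (fst u) \<union> supp (snd u)"
  by (cases u) auto

text \<open>The value computed by \<open>local_inversion\<close>, but for a complex table, so that
  it can be applied to the exact transfer matrix as well as to the estimated one.\<close>

definition local_inverse :: "(pair_index \<Rightarrow> complex) \<Rightarrow> nat set \<Rightarrow> pair_index \<Rightarrow> complex" where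
  "local_inverse L S u = (\<Sum>A\<in>pauli_strings S. \<Sum>B\<in>pauli_strings S. L (A, B) *
     mtrace (pauli_mat S A * pauli_mat S (snd u) * pauli_mat S B * pauli_mat S (fst u))) / 2 ^ (3 * card S)"

lemma fst_local_inversion:
  assumes "finite (union_supp u)"
  shows "fst (local_inversion Lhat u) = local_inverse (\<lambda>v. of_real (Lhat v)) (union_supp u) u"
  using assms
  by (simp add: local_inversion_def local_inverse_def Let_def fst_for_each case_prod_unfold
      fold_add_eq_sum_list sum_list_distinct_conv_sum_set distinct_strings_list set_strings_list)

lemma trace_cost_mono: "s \<le> k \<Longrightarrow> trace_cost s \<le> trace_cost k"
  unfolding trace_cost_def by (intro add_mono mult_mono power_increasing) auto

definition inversion_cost :: "nat \<Rightarrow> nat" where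
  "inversion_cost k = 4 ^ k * (1 + 4 ^ k * (1 + (2 * k + trace_cost k + 3))) + 3 * k + 1"

lemma snd_local_inversion_le:
  assumes "card (union_supp u) \<le> k"
  shows "snd (local_inversion Lhat u) \<le> inversion_cost k"
proof -
  let ?s = "card (union_supp u)"
  have "snd (for_each (strings_list (union_supp u)) (\<lambda>A x. for_each (strings_list (union_supp u)) (\<lambda>B x.
             (x + of_real (Lhat (A, B)) *
                  mtrace (pauli_mat (union_supp u) A * pauli_mat (union_supp u) (snd u) * pauli_mat (union_supp u) B * pauli_mat (union_supp u) (fst u)),
              2 * ?s + trace_cost ?s + 3)) x) 0)
      \<le> 4 ^ ?s * (1 + 4 ^ ?s * (1 + (2 * ?s + trace_cost ?s + 3)))"
    by (intro order_trans[OF snd_for_each_le[where c = "4 ^ ?s * (1 + (2 * ?s + trace_cost ?s + 3))"]]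
        order_trans[OF snd_for_each_le[where c = "2 * ?s + trace_cost ?s + 3"]])
      (simp_all add: length_strings_list)
  also have "\<dots> \<le> 4 ^ k * (1 + 4 ^ k * (1 + (2 * k + trace_cost k + 3)))"
    using assms trace_cost_mono[OF assms] by (intro mult_mono add_mono power_increasing) auto
  finally show ?thesis
    using assms unfolding local_inversion_def inversion_cost_def Let_def case_prod_unfold by simp
qed

section \<open>Registers and the order of peeling\<close>

text \<open>For supplied \<open>v\<close> and \<open>w\<close> this is the condition under which
  processing \<open>v\<close> updates the register of \<open>w\<close>. The exact local inverse at
  \<open>w\<close> is contaminated by \<open>chi v\<close> for just these \<open>v\<close>.\<close>

definition projects :: "pair_index \<Rightarrow> pair_index \<Rightarrow> bool" where
  "projects v w \<longleftrightarrow> union_supp w \<subset> union_supp v \<and>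
     w = (restrict_string (fst v) (union_supp w), restrict_string (snd v) (union_supp w)) \<and>
     (\<forall>q\<in>union_supp v - union_supp w. fst v q = snd v q)"

text \<open>Different subsets address different registers, so no register receives \<open>x\<close>
  twice and the updates do not interfere.\<close>

lemma fold_register_update:
  fixes c :: "'t \<Rightarrow> bool" and f :: "'t \<Rightarrow> 'w" and x :: complex
  assumes "distinct Ts" "inj_on f {T \<in> set Ts. c T}"
  shows "fold (\<lambda>T R. if c T then R(f T := R (f T) + x) else R) Ts R
       = (\<lambda>w. R w + (if w \<in> f ` {T \<in> set Ts. c T} then x else 0))"
  using assms
proof (induction Ts arbitrary: R)
  case (Cons T Ts)
  have i: "inj_on f {T \<in> set Ts. c T}" using Cons.prems(2) by (rule inj_on_subset) auto
  have "c T \<Longrightarrow> f T \<notin> f ` {T \<in> set Ts. c T}"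
    using Cons.prems by (auto simp: inj_on_def)
  then show ?case using Cons.IH[OF _ i] Cons.prems(1) by (auto intro!: ext)
qed simp

text \<open>Turns the loop over subsets \<open>T\<close> into a pointwise statement about indices
  \<open>w\<close>: an index that is hit determines its \<open>T\<close> as its own support.\<close>

lemma fst_process_index:
  assumes "finite (union_supp u)"
  shows "fst (process_index \<Omega> Lhat u (chi, R)) =
    (let x = fst (local_inversion Lhat u) - R u
     in (chi(u := x), \<lambda>w. R w + (if w \<in> \<Omega> \<and> projects u w then x else 0)))"
proof -
  obtain P Q where u: "u = (P, Q)" by fastforce
  let ?S = "union_supp u"
  let ?Ts = "filter (\<lambda>T. T \<noteq> ?S) (map set (subseqs (sorted_list_of_set ?S)))"
  let ?f = "\<lambda>T. (restrict_string P T, restrict_string Q T)"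
  let ?c = "\<lambda>T. ?f T \<in> \<Omega> \<and> union_supp (?f T) = T \<and> (\<forall>q\<in>?S - T. P q = Q q)"
  define x where "x = fst (local_inversion Lhat u) - R u"
  have d: "distinct ?Ts" by (intro distinct_filter distinct_set_subseqs) simp
  have s: "set ?Ts = {T. T \<subset> ?S}"
    using subseqs_powset[of "sorted_list_of_set ?S"] assms by auto
  \<comment> \<open>The test passed by \<open>T\<close> says that \<open>union_supp\<close> recovers
    it from the restricted pair.\<close>
  have inj: "inj_on ?f {T \<in> set ?Ts. ?c T}" by (intro inj_on_inverseI[where g = union_supp]) blast
  have im: "w \<in> ?f ` {T \<in> set ?Ts. ?c T} \<longleftrightarrow> w \<in> \<Omega> \<and> projects u w" for w
  proof
    assume "w \<in> \<Omega> \<and> projects u w"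
    then have "?c (union_supp w)" "w = ?f (union_supp w)" "union_supp w \<in> set ?Ts"
      unfolding s by (auto simp: projects_def u)
    then show "w \<in> ?f ` {T \<in> set ?Ts. ?c T}" by blast
  next
    assume "w \<in> ?f ` {T \<in> set ?Ts. ?c T}"
    then obtain T where T: "T \<in> set ?Ts" "?c T" "w = ?f T" by blast
    have "T \<subset> ?S" using T(1) unfolding s by blast
    moreover have "union_supp w = T" "w \<in> \<Omega>" using T by blast+
    moreover have "fst u = P" "snd u = Q" using u by auto
    ultimately show "w \<in> \<Omega> \<and> projects u w"
      unfolding projects_def using T(2,3) by (simp del: union_supp.simps)
  qed
  have "fold (\<lambda>T R. if ?c T then R(?f T := R (?f T) + x) else R) ?Ts R =
      (\<lambda>w. R w + (if w \<in> \<Omega> \<and> projects u w then x else 0))"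
    by (rule trans[OF fold_register_update[OF d inj]]) (simp only: im)
  then show ?thesis
    unfolding process_index_def Let_def case_prod_unfold
    by (simp add: fst_for_each x_def u cong: if_cong)
qed

definition process_cost :: "nat \<Rightarrow> nat" where
  "process_cost k = inversion_cost k + 2 ^ k * (1 + (7 * k + 4)) + 3"

lemma snd_process_index_le:
  assumes "card (union_supp u) \<le> k"
  shows "snd (process_index \<Omega> Lhat u st) \<le> process_cost k"
proof -
  obtain P Q where u: "u = (P, Q)" by fastforce
  obtain chi R where st: "st = (chi, R)" by fastforce
  let ?S = "union_supp u"
  let ?Ts = "filter (\<lambda>T. T \<noteq> ?S) (map set (subseqs (sorted_list_of_set ?S)))"
  have l: "length ?Ts \<le> 2 ^ k"
  proof -
    have "length ?Ts \<le> 2 ^ card ?S"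
      by (rule order_trans[OF length_filter_le]) (simp add: length_subseqs)
    also have "(2::nat) ^ card ?S \<le> 2 ^ k" using assms by (intro power_increasing) auto
    finally show ?thesis .
  qed
  have "snd (for_each ?Ts f R) \<le> 2 ^ k * (1 + (7 * k + 4))"
    if "\<And>T R. snd (f T R) = 7 * card ?S + 4" for f :: "nat set \<Rightarrow> (pair_index \<Rightarrow> complex) \<Rightarrow> (pair_index \<Rightarrow> complex) timed" and R
  proof -
    have "snd (for_each ?Ts f R) \<le> length ?Ts * (1 + (7 * k + 4))"
      using assms that by (intro snd_for_each_le) simp
    also have "\<dots> \<le> 2 ^ k * (1 + (7 * k + 4))" using l by (intro mult_right_mono) auto
    finally show ?thesis .
  qed
  then show ?thesis
    using snd_local_inversion_le[OF assms, of Lhat]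
    unfolding process_index_def process_cost_def Let_def case_prod_unfold
    by (auto intro!: add_mono)
qed

definition peeling_order :: "nat \<Rightarrow> pair_index list \<Rightarrow> pair_index list" where
  "peeling_order k us = concat (map (\<lambda>s. filter (\<lambda>u. card (union_supp u) = s) us) (rev [0..<Suc k]))"

lemma fold_if_filter: "fold (\<lambda>x s. if P x then f x s else s) xs s = fold f (filter P xs) s"
  by (induction xs arbitrary: s) auto

text \<open>A scan for size \<open>s\<close> leaves the registers alone at indices of other sizes,
  so the nested loops flatten to a single pass over \<open>peeling_order\<close>.\<close>

lemma fst_peeling:
  "fst (peeling k us Lhat) =
    fst (fold (\<lambda>u st. fst (process_index (set us) Lhat u st)) (peeling_order k us) ((\<lambda>_. 0), (\<lambda>_. 0)))"
proof -
  have [simp]: "fst (if c then case p of (st', c) \<Rightarrow> (st', c + a + b) else (st, d)) = (if c then fst p else st)"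
    for c and p :: "registers timed" and a b d and st
    by (simp add: case_prod_unfold)
  have "fold (\<lambda>s st. fst (for_each us (\<lambda>u st.
            if card (union_supp u) = s
            then (let (st', c) = process_index (set us) Lhat u st
                  in (st', c + wt (fst u) + wt (snd u)))
            else (st, wt (fst u) + wt (snd u))) st)) ss st =
      fold (\<lambda>u st. fst (process_index (set us) Lhat u st))
        (concat (map (\<lambda>s. filter (\<lambda>u. card (union_supp u) = s) us) ss)) st" for ss st
    by (induction ss arbitrary: st)
      (simp_all add: fst_for_each fold_if_filter cong: if_cong)
  then show ?thesis
    unfolding peeling_def peeling_order_def by (simp add: case_prod_unfold fst_for_each del: upt_Suc)
qed

text \<open>Projecting strictly shrinks the support, so in decreasing order of size a later index
  never projects onto an earlier one.\<close>

lemma peeling_order_props: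
  assumes "\<And>u. u \<in> set us \<Longrightarrow> finite (union_supp u) \<and> card (union_supp u) \<le> k" "distinct us"
  shows "set (peeling_order k us) = set us" "distinct (peeling_order k us)"
    "sorted_wrt (\<lambda>a b. \<not> projects b a) (peeling_order k us)"
proof -
  show "set (peeling_order k us) = set us"
    using assms(1) by (auto simp: peeling_order_def less_Suc_eq_le simp del: upt_Suc)
  have np: "\<not> projects b a" if "card (union_supp b) \<le> card (union_supp a)" "b \<in> set us" for a b
  proof
    assume "projects b a"
    then have "card (union_supp a) < card (union_supp b)"
      using assms(1)[OF that(2)] by (intro psubset_card_mono) (auto simp only: projects_def)
    with that(1) show False by simp
  qed
  have all: "sorted_wrt R xs" if "\<And>a b. a \<in> set xs \<Longrightarrow> b \<in> set xs \<Longrightarrow> R a b"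
    for R :: "pair_index \<Rightarrow> pair_index \<Rightarrow> bool" and xs
    using that by (induction xs) auto
  have main: "distinct (concat (map (\<lambda>s. filter (\<lambda>u. card (union_supp u) = s) us) (rev [0..<m]))) \<and>
     sorted_wrt (\<lambda>a b. \<not> projects b a) (concat (map (\<lambda>s. filter (\<lambda>u. card (union_supp u) = s) us) (rev [0..<m])))" for m
  proof (induction m)
    case (Suc m)
    have "sorted_wrt (\<lambda>a b. \<not> projects b a) (filter (\<lambda>u. card (union_supp u) = m) us)"
      by (intro all np) auto
    moreover have "\<not> projects b a" if "a \<in> set us" "card (union_supp a) = m" "b \<in> set us" "card (union_supp b) < m" for a b
      using that by (intro np) auto
    ultimately show ?case using Suc assms(2) by (auto simp: sorted_wrt_append)
  qed simp
  show "distinct (peeling_order k us)" "sorted_wrt (\<lambda>a b. \<not> projects b a) (peeling_order k us)"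
    unfolding peeling_order_def using main[of "Suc k"] by (simp_all only: simp_thms)
qed

text \<open>At any moment the register of \<open>w\<close> holds the sum of the outputs processed so
  far that project onto \<open>w\<close>. Nothing processed after \<open>u\<close> projects onto
  \<open>u\<close>, so the value subtracted at \<open>u\<close> is already the final one.\<close>

lemma peeling_invariant:
  assumes "distinct L" "sorted_wrt (\<lambda>a b. \<not> projects b a) L" "set L \<subseteq> \<Omega>"
    "\<And>u. u \<in> set L \<Longrightarrow> finite (union_supp u)"
  shows "\<exists>chi R. fold (\<lambda>u st. fst (process_index \<Omega> Lhat u st)) L ((\<lambda>_. 0), (\<lambda>_. 0)) = (chi, R) \<and>
    (\<forall>w\<in>\<Omega>. R w = (\<Sum>v\<in>{v \<in> set L. projects v w}. chi v)) \<and>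
    (\<forall>w. w \<notin> set L \<longrightarrow> chi w = 0) \<and>
    (\<forall>u\<in>set L. chi u = fst (local_inversion Lhat u) - (\<Sum>v\<in>{v \<in> set L. projects v u}. chi v))"
  using assms
proof (induction L rule: rev_induct)
  case Nil
  show ?case by (intro exI[of _ "\<lambda>_. 0"] conjI) auto
next
  case (snoc u L)
  have fin: "finite (union_supp u)" using snoc.prems by auto
  have u: "u \<notin> set L" "u \<in> \<Omega>" and irr: "\<not> projects u u"
    using snoc.prems by (auto simp: projects_def)
  \<comment> \<open>The order of the list keeps \<open>u\<close> from contributing to an index whose
    register has already been read.\<close>
  have late: "\<not> projects u a" if "a \<in> set L" for a
    using snoc.prems(2) that by (auto simp: sorted_wrt_append)
  obtain chi R where IH: "fold (\<lambda>u st. fst (process_index \<Omega> Lhat u st)) L ((\<lambda>_. 0), (\<lambda>_. 0)) = (chi, R)"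
    "\<forall>w\<in>\<Omega>. R w = (\<Sum>v\<in>{v \<in> set L. projects v w}. chi v)"
    "\<forall>w. w \<notin> set L \<longrightarrow> chi w = 0"
    "\<forall>u\<in>set L. chi u = fst (local_inversion Lhat u) - (\<Sum>v\<in>{v \<in> set L. projects v u}. chi v)"
  proof -
    have "\<exists>chi R. fold (\<lambda>u st. fst (process_index \<Omega> Lhat u st)) L ((\<lambda>_. 0), (\<lambda>_. 0)) = (chi, R) \<and>
      (\<forall>w\<in>\<Omega>. R w = (\<Sum>v\<in>{v \<in> set L. projects v w}. chi v)) \<and>
      (\<forall>w. w \<notin> set L \<longrightarrow> chi w = 0) \<and>
      (\<forall>u\<in>set L. chi u = fst (local_inversion Lhat u) - (\<Sum>v\<in>{v \<in> set L. projects v u}. chi v))"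
      by (rule snoc.IH) (use snoc.prems in \<open>simp_all add: sorted_wrt_append\<close>)
    then show ?thesis using that by blast
  qed
  define x where "x = fst (local_inversion Lhat u) - R u"
  define chi' where "chi' = chi(u := x)"
  have sum_eq: "(\<Sum>v\<in>{v \<in> set (L @ [u]). projects v w}. chi' v) =
      (\<Sum>v\<in>{v \<in> set L. projects v w}. chi v) + (if projects u w then x else 0)" for w
  proof -
    have "{v \<in> set (L @ [u]). projects v w} = {v \<in> set L. projects v w} \<union> (if projects u w then {u} else {})"
      by auto
    moreover have "(\<Sum>v\<in>{v \<in> set L. projects v w}. chi' v) = (\<Sum>v\<in>{v \<in> set L. projects v w}. chi v)"
      using u by (intro sum.cong) (auto simp: chi'_def)
    ultimately show ?thesis using u by (auto simp: chi'_def add.commute)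
  qed
  show ?case
  proof (intro exI conjI)
    show "fold (\<lambda>u st. fst (process_index \<Omega> Lhat u st)) (L @ [u]) ((\<lambda>_. 0), (\<lambda>_. 0)) =
        (chi', \<lambda>w. R w + (if w \<in> \<Omega> \<and> projects u w then x else 0))"
      using IH(1) fst_process_index[OF fin, of \<Omega> Lhat chi R]
      by (simp only: fold_append o_apply fold_simps Let_def chi'_def x_def)
    show "\<forall>w\<in>\<Omega>. R w + (if w \<in> \<Omega> \<and> projects u w then x else 0) =
        (\<Sum>v\<in>{v \<in> set (L @ [u]). projects v w}. chi' v)"
    proof
      fix w assume "w \<in> \<Omega>"
      then show "R w + (if w \<in> \<Omega> \<and> projects u w then x else 0) =
        (\<Sum>v\<in>{v \<in> set (L @ [u]). projects v w}. chi' v)"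
        unfolding sum_eq using bspec[OF IH(2), of w] by (simp only: simp_thms)
    qed
    show "\<forall>w. w \<notin> set (L @ [u]) \<longrightarrow> chi' w = 0" using IH(3) by (auto simp: chi'_def)
    show "\<forall>a\<in>set (L @ [u]). chi' a = fst (local_inversion Lhat a) -
        (\<Sum>v\<in>{v \<in> set (L @ [u]). projects v a}. chi' v)"
    proof
      fix a assume a: "a \<in> set (L @ [u])"
      show "chi' a = fst (local_inversion Lhat a) - (\<Sum>v\<in>{v \<in> set (L @ [u]). projects v a}. chi' v)"
      proof (cases "a = u")
        case True
        then show ?thesis unfolding sum_eq using bspec[OF IH(2) u(2)] irr
          by (simp only: True chi'_def x_def fun_upd_same if_False add_0_right)
      next
        case False
        then have "a \<in> set L" using a by simp
        then show ?thesis unfolding sum_eq using bspec[OF IH(4), of a] late[of a] False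
          by (simp only: chi'_def fun_upd_other if_False add_0_right not_False_eq_True)
      qed
    qed
  qed
qed

text \<open>The mutable registers disappear: the output obeys the recursion of the exact
  coefficients, with the estimated transfer matrix in place of the exact one. Subtracting the two
  recursions later gives the error recursion.\<close>

lemma fst_peeling_recursion:
  fixes Lhat :: "pair_index \<Rightarrow> real"
  assumes "\<And>u. u \<in> set us \<Longrightarrow> finite (union_supp u) \<and> card (union_supp u) \<le> k" "distinct us"
  defines "chi \<equiv> fst (peeling k us Lhat)"
  shows "u \<in> set us \<Longrightarrow> chi u = local_inverse (\<lambda>v. of_real (Lhat v)) (union_supp u) u
      - (\<Sum>v\<in>{v \<in> set us. projects v u}. chi v)"
    and "u \<notin> set us \<Longrightarrow> chi u = 0"
proof -
  note p = peeling_order_props[OF assms(1,2)]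
  obtain chi' R where c: "fold (\<lambda>u st. fst (process_index (set us) Lhat u st)) (peeling_order k us) ((\<lambda>_. 0), (\<lambda>_. 0)) = (chi', R)"
    "\<forall>w. w \<notin> set us \<longrightarrow> chi' w = 0"
    "\<forall>u\<in>set us. chi' u = fst (local_inversion Lhat u) - (\<Sum>v\<in>{v \<in> set us. projects v u}. chi' v)"
  proof -
    have "\<exists>chi R. fold (\<lambda>u st. fst (process_index (set us) Lhat u st)) (peeling_order k us) ((\<lambda>_. 0), (\<lambda>_. 0)) = (chi, R) \<and>
      (\<forall>w\<in>set us. R w = (\<Sum>v\<in>{v \<in> set (peeling_order k us). projects v w}. chi v)) \<and>
      (\<forall>w. w \<notin> set (peeling_order k us) \<longrightarrow> chi w = 0) \<and>
      (\<forall>u\<in>set (peeling_order k us). chi u = fst (local_inversion Lhat u)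
        - (\<Sum>v\<in>{v \<in> set (peeling_order k us). projects v u}. chi v))"
      using p(1) assms(1) by (intro peeling_invariant p(2,3)) auto
    then show ?thesis by (elim exE conjE, intro that) (simp_all only: p(1))
  qed
  have "chi = chi'" unfolding chi_def fst_peeling c(1) by simp
  with c(2) show "u \<notin> set us \<Longrightarrow> chi u = 0" by metis
  assume u: "u \<in> set us"
  with assms(1) have "fst (local_inversion Lhat u) = local_inverse (\<lambda>v. of_real (Lhat v)) (union_supp u) u"
    by (intro fst_local_inversion) blast
  with bspec[OF c(3) u] \<open>chi = chi'\<close> show "chi u = local_inverse (\<lambda>v. of_real (Lhat v)) (union_supp u) u
      - (\<Sum>v\<in>{v \<in> set us. projects v u}. chi v)"
    by (simp only:)
qed

section \<open>Output and running time\<close>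

text \<open>An entry of \<open>h\<close> may be written twice, for (P, I) and for (I, P), but with
  the same value. Entries that are never written stay zero, in agreement with the formula because
  \<open>chi\<close> is zero there.\<close>

lemma fst_read_off:
  assumes "\<And>u. u \<notin> set us \<Longrightarrow> chi u = 0"
  shows "fst (read_off us chi) =
    ((\<lambda>(P, Q). if P \<noteq> id_string \<and> Q \<noteq> id_string then chi (P, Q) else 0),
     (\<lambda>P. \<i> / 2 * (chi (P, id_string) - chi (id_string, P))))"
proof -
  define H where "H = (\<lambda>P. \<i> / 2 * (chi (P, id_string) - chi (id_string, P)))"
  define f where "f = (\<lambda>(P, Q) (G, h).
     if P \<noteq> id_string \<and> Q \<noteq> id_string then ((G((P, Q) := chi (P, Q)), h), 4::nat)
     else let P' = (if Q = id_string then P else Q) in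
       ((G, h(P' := \<i> / 2 * (chi (P', id_string) - chi (id_string, P')))), 7))"
  have f: "fst (f u (G, h)) = (if fst u \<noteq> id_string \<and> snd u \<noteq> id_string then (G(u := chi u), h)
      else let P' = (if snd u = id_string then fst u else snd u) in (G, h(P' := H P')))" for u G h
    by (cases u) (auto simp: f_def H_def Let_def)
  have "fold (\<lambda>x s. fst (f x s)) xs (G, h) =
    ((\<lambda>u. if u \<in> set xs \<and> fst u \<noteq> id_string \<and> snd u \<noteq> id_string then chi u else G u),
     (\<lambda>P. if (P, id_string) \<in> set xs \<or> (id_string, P) \<in> set xs then H P else h P))" for xs G h
  proof (induction xs arbitrary: G h)
    case (Cons u xs)
    show ?case unfolding fold_simps f Let_def
      by (cases u; cases "fst u = id_string"; cases "snd u = id_string"; simp only: Cons.IH if_True if_False simp_thms)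
        (auto intro!: ext)
  qed simp
  moreover have "read_off us chi = for_each us f ((\<lambda>_. 0), (\<lambda>_. 0))"
    unfolding read_off_def f_def ..
  ultimately have "fst (read_off us chi) =
    ((\<lambda>u. if u \<in> set us \<and> fst u \<noteq> id_string \<and> snd u \<noteq> id_string then chi u else 0),
     (\<lambda>P. if (P, id_string) \<in> set us \<or> (id_string, P) \<in> set us then H P else 0))"
    by (simp only: fst_for_each)
  moreover have "H P = 0" if "(P, id_string) \<notin> set us" "(id_string, P) \<notin> set us" for P
    using assms[OF that(1)] assms[OF that(2)] by (simp add: H_def)
  ultimately show ?thesis using assms by (auto simp: fun_eq_iff H_def)
qed

lemma fst_postprocess: "fst (postprocess k us Lhat) = fst (read_off us (fst (peeling k us Lhat)))"
  by (simp add: postprocess_def case_prod_unfold Let_def)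

definition postprocess_cost :: "nat \<Rightarrow> nat" where
  "postprocess_cost k = 9 + 2 * Suc k + Suc k * (1 + (process_cost k + 2 * k))"

text \<open>The maximum with 1 is there because an empty list still pays for the
  \<open>k + 1\<close> steps of the outer loop. Each of those steps scans the list once, and each
  processed index costs an amount depending on \<open>k\<close> only.\<close>

lemma snd_postprocess_le:
  assumes "\<And>u. u \<in> set us \<Longrightarrow> finite (union_supp u) \<and> card (union_supp u) \<le> k"
  shows "snd (postprocess k us Lhat) \<le> postprocess_cost k * max 1 (length us)"
proof -
  let ?c = "process_cost k + 2 * k" and ?n = "length us"
  have w: "wt (fst u) + wt (snd u) \<le> 2 * k" if "u \<in> set us" for u
  proof -
    have "wt (fst u) \<le> card (union_supp u)" "wt (snd u) \<le> card (union_supp u)"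
      using assms[OF that] by (auto simp: wt_def union_supp_eq intro!: card_mono)
    then show ?thesis using assms[OF that] by linarith
  qed
  let ?g = "\<lambda>s u st. if card (union_supp u) = s
            then (let (st', c) = process_index (set us) Lhat u st
                  in (st', c + wt (fst u) + wt (snd u)))
            else (st, wt (fst u) + wt (snd u))"
  have "snd (?g s u st) \<le> ?c" if u: "u \<in> set us" for s u st
    using w[OF u] snd_process_index_le[of u k "set us" Lhat st] assms[OF u]
    by (auto simp: case_prod_unfold Let_def)
  then have "snd (for_each us (?g s) st) \<le> ?n * (1 + ?c)" for s st
    by (intro snd_for_each_le)
  then have "snd (for_each (rev [0..<Suc k]) (\<lambda>s. for_each us (?g s)) st) \<le> length (rev [0..<Suc k]) * (1 + ?n * (1 + ?c))" for st
    by (rule snd_for_each_le)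
  then have p: "snd (peeling k us Lhat) \<le> Suc k * (1 + ?n * (1 + ?c))"
    by (simp add: peeling_def case_prod_unfold Let_def del: upt_Suc)
  have r: "snd (read_off us chi) \<le> ?n * (1 + 7)" for chi
    unfolding read_off_def by (intro snd_for_each_le) (auto simp: Let_def split: prod.splits)
  have "snd (postprocess k us Lhat) \<le> ?n + Suc k * (1 + ?n * (1 + ?c)) + ?n * (1 + 7)"
    unfolding postprocess_def case_prod_unfold Let_def using p r[of "fst (peeling k us Lhat)"] by simp
  also have "\<dots> = (9 + Suc k * (1 + ?c)) * ?n + Suc k" by (simp add: algebra_simps)
  also have "\<dots> \<le> (9 + Suc k * (1 + ?c)) * max 1 ?n + (2 * Suc k) * max 1 ?n"
  proof (intro add_mono)
    have "Suc k * 1 \<le> (2 * Suc k) * max 1 ?n" by (intro mult_le_mono) auto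
    then show "Suc k \<le> (2 * Suc k) * max 1 ?n" by simp
  qed (intro mult_le_mono; simp)
  also have "\<dots> = postprocess_cost k * max 1 ?n" by (simp add: postprocess_cost_def algebra_simps)
  finally show ?thesis .
qed

section \<open>Operators, traces and adjoints\<close>

lemma mult_mat_index:
  assumes "A \<in> carrier_mat a N" "B \<in> carrier_mat N b" "i < a" "j < b"
  shows "(A * B) $$ (i, j) = (\<Sum>k<N. A $$ (i, k) * B $$ (k, j))"
  using assms by (auto simp: scalar_prod_def atLeast0LessThan intro!: sum.cong)

lemma operators_closed [simp, intro]:
  assumes "A \<in> carrier_mat N N" "B \<in> carrier_mat N N"
  shows "A * B \<in> carrier_mat N N" "A + B \<in> carrier_mat N N" "A - B \<in> carrier_mat N N" "c \<cdot>\<^sub>m A \<in> carrier_mat N N"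
  using assms by auto

lemma mult_assoc_square:
  "A \<in> carrier_mat N N \<Longrightarrow> B \<in> carrier_mat N N \<Longrightarrow> C \<in> carrier_mat N N \<Longrightarrow> A * B * C = A * (B * C)"
  by (rule assoc_mult_mat)

lemma mat_adjoint_carrier [simp, intro]: "A \<in> carrier_mat a b \<Longrightarrow> mat_adjoint A \<in> carrier_mat b a"
  by (auto simp: mat_adjoint_def)

lemma mat_adjoint_index:
  "A \<in> carrier_mat a b \<Longrightarrow> i < b \<Longrightarrow> j < a \<Longrightarrow> mat_adjoint A $$ (i, j) = cnj (A $$ (j, i))"
  by (auto simp: mat_adjoint_def mat_of_rows_def)

lemma mat_adjoint_mult:
  fixes A B :: "complex mat"
  assumes "A \<in> carrier_mat a b" "B \<in> carrier_mat b c"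
  shows "mat_adjoint (A * B) = mat_adjoint B * mat_adjoint A"
proof (rule eq_matI)
  fix i j assume "i < dim_row (mat_adjoint B * mat_adjoint A)" "j < dim_col (mat_adjoint B * mat_adjoint A)"
  then have ij: "i < c" "j < a" using assms by (auto dest: carrier_matD simp: mat_adjoint_def)
  have "mat_adjoint (A * B) $$ (i, j) = (\<Sum>k<b. cnj (A $$ (j, k)) * cnj (B $$ (k, i)))"
    using assms ij mat_adjoint_index[of "A * B" a c i j] by (simp add: mult_mat_index[of _ a b _ c] del: index_mult_mat(1))
  also have "\<dots> = (mat_adjoint B * mat_adjoint A) $$ (i, j)"
    using assms ij by (simp add: mult_mat_index[of _ c b _ a] mat_adjoint_index[of _ a b] mat_adjoint_index[of _ b c] mult.commute del: index_mult_mat(1))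
  finally show "mat_adjoint (A * B) $$ (i, j) = (mat_adjoint B * mat_adjoint A) $$ (i, j)" .
qed (use assms in \<open>auto simp: mat_adjoint_def\<close>)

lemma mat_adjoint_adjoint [simp]: "mat_adjoint (mat_adjoint (A :: complex mat)) = A"
  by (rule eq_matI) (auto simp: mat_adjoint_def mat_of_rows_def)

lemma dim_mat_adjoint [simp]: "dim_row (mat_adjoint A) = dim_col A" "dim_col (mat_adjoint A) = dim_row A"
  by (auto simp: mat_adjoint_def)

lemma mat_adjoint_minus:
  "A \<in> carrier_mat a b \<Longrightarrow> B \<in> carrier_mat a b \<Longrightarrow> mat_adjoint (A - B :: complex mat) = mat_adjoint A - mat_adjoint B"
  by (rule eq_matI) (auto simp: mat_adjoint_def mat_of_rows_def)

lemma mat_adjoint_add: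
  "A \<in> carrier_mat a b \<Longrightarrow> B \<in> carrier_mat a b \<Longrightarrow> mat_adjoint (A + B :: complex mat) = mat_adjoint A + mat_adjoint B"
  by (rule eq_matI) (auto simp: mat_adjoint_def mat_of_rows_def)

lemma mat_adjoint_smult: "mat_adjoint (c \<cdot>\<^sub>m A) = cnj c \<cdot>\<^sub>m mat_adjoint (A :: complex mat)"
  by (rule eq_matI) (auto simp: mat_adjoint_def mat_of_rows_def)

lemma msum_carrier [simp]: "msum n f A \<in> operators n"
  by (simp add: msum_def)

lemma msum_index: "i < 2 ^ n \<Longrightarrow> j < 2 ^ n \<Longrightarrow> msum n f A $$ (i, j) = (\<Sum>a\<in>A. f a $$ (i, j))"
  by (simp add: msum_def)

lemma dim_msum [simp]: "dim_row (msum n f A) = 2 ^ n" "dim_col (msum n f A) = 2 ^ n"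
  by (simp_all add: msum_def)

lemma msum_cong: "(\<And>a. a \<in> A \<Longrightarrow> f a = g a) \<Longrightarrow> msum n f A = msum n g A"
  by (auto simp: msum_def intro!: cong_mat sum.cong)

lemma msum_mult_left:
  assumes "B \<in> operators n" "\<And>a. a \<in> A \<Longrightarrow> f a \<in> operators n"
  shows "B * msum n f A = msum n (\<lambda>a. B * f a) A"
proof (rule eq_matI)
  fix i j assume "i < dim_row (msum n (\<lambda>a. B * f a) A)" "j < dim_col (msum n (\<lambda>a. B * f a) A)"
  then have ij: "i < 2 ^ n" "j < 2 ^ n" by auto
  have "(B * msum n f A) $$ (i, j) = (\<Sum>k<2 ^ n. \<Sum>a\<in>A. B $$ (i, k) * f a $$ (k, j))"
    using ij assms by (simp add: mult_mat_index[of _ "2 ^ n" "2 ^ n" _ "2 ^ n"] msum_index sum_distrib_left del: index_mult_mat(1))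
  also have "\<dots> = msum n (\<lambda>a. B * f a) A $$ (i, j)"
    using ij assms by (subst sum.swap) (simp add: msum_index mult_mat_index[of _ "2 ^ n" "2 ^ n" _ "2 ^ n"] del: index_mult_mat(1))
  finally show "(B * msum n f A) $$ (i, j) = msum n (\<lambda>a. B * f a) A $$ (i, j)" .
qed (use assms in auto)

lemma msum_mult_right:
  assumes "B \<in> operators n" "\<And>a. a \<in> A \<Longrightarrow> f a \<in> operators n"
  shows "msum n f A * B = msum n (\<lambda>a. f a * B) A"
proof (rule eq_matI)
  fix i j assume "i < dim_row (msum n (\<lambda>a. f a * B) A)" "j < dim_col (msum n (\<lambda>a. f a * B) A)"
  then have ij: "i < 2 ^ n" "j < 2 ^ n" by auto
  have "(msum n f A * B) $$ (i, j) = (\<Sum>k<2 ^ n. \<Sum>a\<in>A. f a $$ (i, k) * B $$ (k, j))"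
    using ij assms by (simp add: mult_mat_index[of _ "2 ^ n" "2 ^ n" _ "2 ^ n"] msum_index sum_distrib_right del: index_mult_mat(1))
  also have "\<dots> = msum n (\<lambda>a. f a * B) A $$ (i, j)"
    using ij assms by (subst sum.swap) (simp add: msum_index mult_mat_index[of _ "2 ^ n" "2 ^ n" _ "2 ^ n"] del: index_mult_mat(1))
  finally show "(msum n f A * B) $$ (i, j) = msum n (\<lambda>a. f a * B) A $$ (i, j)" .
qed (use assms in auto)

lemma mat_adjoint_msum:
  assumes "\<And>a. a \<in> A \<Longrightarrow> f a \<in> operators n"
  shows "mat_adjoint (msum n f A) = msum n (\<lambda>a. mat_adjoint (f a)) A"
  by (rule eq_matI) (auto simp: msum_index mat_adjoint_index[OF msum_carrier] mat_adjoint_index[OF assms] intro!: sum.cong)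

lemma mtrace_eq: "A \<in> carrier_mat N N \<Longrightarrow> mtrace A = (\<Sum>i<N. A $$ (i, i))"
  by (simp add: mtrace_def)

lemma mtrace_add: "A \<in> carrier_mat N N \<Longrightarrow> B \<in> carrier_mat N N \<Longrightarrow> mtrace (A + B) = mtrace A + mtrace B"
  by (simp add: mtrace_def sum.distrib)

lemma mtrace_minus: "A \<in> carrier_mat N N \<Longrightarrow> B \<in> carrier_mat N N \<Longrightarrow> mtrace (A - B) = mtrace A - mtrace B"
  by (simp add: mtrace_def sum_subtractf)

lemma mtrace_smult: "A \<in> carrier_mat N N \<Longrightarrow> mtrace (c \<cdot>\<^sub>m A) = c * mtrace A"
  by (simp add: mtrace_def sum_distrib_left)

lemma mtrace_msum:
  assumes "\<And>a. a \<in> A \<Longrightarrow> f a \<in> operators n"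
  shows "mtrace (msum n f A) = (\<Sum>a\<in>A. mtrace (f a))"
proof -
  have "mtrace (msum n f A) = (\<Sum>a\<in>A. \<Sum>i<2 ^ n. f a $$ (i, i))"
    by (subst sum.swap) (simp add: mtrace_eq[OF msum_carrier] msum_index)
  also have "\<dots> = (\<Sum>a\<in>A. mtrace (f a))"
    using mtrace_eq[OF assms] by (intro sum.cong) auto
  finally show ?thesis .
qed

lemma mtrace_mult:
  assumes "A \<in> carrier_mat N N" "B \<in> carrier_mat N N"
  shows "mtrace (A * B) = (\<Sum>i<N. \<Sum>j<N. A $$ (i, j) * B $$ (j, i))"
  using assms by (simp add: mtrace_eq[of _ N] mult_mat_index[of _ N N _ N] del: index_mult_mat(1))

lemma mtrace_comm:
  assumes "A \<in> carrier_mat N N" "B \<in> carrier_mat N N"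
  shows "mtrace (A * B) = mtrace (B * A)"
  unfolding mtrace_mult[OF assms] mtrace_mult[OF assms(2,1)]
  by (subst sum.swap) (simp add: mult.commute)

lemma mtrace_adjoint: "A \<in> carrier_mat N N \<Longrightarrow> mtrace (mat_adjoint A) = cnj (mtrace A)"
  by (simp add: mtrace_eq[of _ N] mat_adjoint_index[of _ N N])

section \<open>Tensor products and Pauli matrices\<close>

lemma sum_lessThan_double:
  "(\<Sum>k<2 * N. g k) = (\<Sum>k<N. g (2 * k) + g (Suc (2 * k)))" for g :: "nat \<Rightarrow> 'a :: comm_monoid_add"
  by (induction N) (simp_all add: add_ac)

text \<open>A number below \<open>2 ^ s\<close> is its string of \<open>s\<close> binary digits, so
  the sum factorizes digit by digit. The induction splits off the lowest digit, that is, even and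
  odd numbers. This carries products and traces of tensor products over to single qubits.\<close>

lemma sum_bits_prod:
  fixes f :: "nat \<Rightarrow> bool \<Rightarrow> 'a :: comm_semiring_1"
  shows "(\<Sum>k<2 ^ s. \<Prod>m<s. f m (bit (k::nat) m)) = (\<Prod>m<s. f m False + f m True)"
proof (induction s arbitrary: f)
  case (Suc s)
  have "(\<Sum>k<2 ^ Suc s. \<Prod>m<Suc s. f m (bit (k::nat) m))
      = (\<Sum>k<(2::nat) ^ s. (\<Prod>m<Suc s. f m (bit (2 * k) m)) + (\<Prod>m<Suc s. f m (bit (Suc (2 * k)) m)))"
    by (simp only: power_Suc sum_lessThan_double)
  also have "\<dots> = (\<Sum>k<(2::nat) ^ s. (f 0 False + f 0 True) * (\<Prod>m<s. f (Suc m) (bit k m)))"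
    by (simp add: prod.lessThan_Suc_shift bit_Suc bit_0 algebra_simps del: prod.lessThan_Suc)
  also have "\<dots> = (f 0 False + f 0 True) * (\<Prod>m<s. f (Suc m) False + f (Suc m) True)"
    using Suc[of "\<lambda>m. f (Suc m)"] by (simp flip: sum_distrib_left)
  also have "\<dots> = (\<Prod>m<Suc s. f m False + f m True)"
    by (simp add: prod.lessThan_Suc_shift del: prod.lessThan_Suc)
  finally show ?case .
qed simp

text \<open>The product of two 2 by 2 matrices given as functions of bits.\<close>

definition lmul :: "(bool \<Rightarrow> bool \<Rightarrow> complex) \<Rightarrow> (bool \<Rightarrow> bool \<Rightarrow> complex) \<Rightarrow> bool \<Rightarrow> bool \<Rightarrow> complex" where
  "lmul f g x y = f x False * g False y + f x True * g True y"

definition ltr :: "(bool \<Rightarrow> bool \<Rightarrow> complex) \<Rightarrow> complex" where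
  "ltr f = f False False + f True True"

lemma tensor_mat_carrier [simp]: "tensor_mat S f \<in> carrier_mat (2 ^ card S) (2 ^ card S)"
  by (simp add: tensor_mat_def)

lemma dim_tensor_mat [simp]: "dim_row (tensor_mat S f) = 2 ^ card S" "dim_col (tensor_mat S f) = 2 ^ card S"
  by (simp_all add: tensor_mat_def)

lemma tensor_mat_operators [simp]: "tensor_mat {..<n} f \<in> operators n"
  using tensor_mat_carrier[of "{..<n}" f] by simp

lemma tensor_mat_mult: "tensor_mat S f * tensor_mat S g = tensor_mat S (\<lambda>q. lmul (f q) (g q))"
proof (rule eq_matI)
  let ?x = "\<lambda>m. sorted_list_of_set S ! m"
  fix i j assume "i < dim_row (tensor_mat S (\<lambda>q. lmul (f q) (g q)))"
    "j < dim_col (tensor_mat S (\<lambda>q. lmul (f q) (g q)))"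
  then have ij: "i < 2 ^ card S" "j < 2 ^ card S" by (auto simp: tensor_mat_def)
  have "(tensor_mat S f * tensor_mat S g) $$ (i, j)
      = (\<Sum>k<(2::nat) ^ card S. \<Prod>m<card S. f (?x m) (bit i m) (bit k m) * g (?x m) (bit k m) (bit j m))"
    using ij by (simp add: mult_mat_index[OF tensor_mat_carrier tensor_mat_carrier] del: index_mult_mat(1)) (simp add: tensor_mat_def prod.distrib)
  also have "\<dots> = tensor_mat S (\<lambda>q. lmul (f q) (g q)) $$ (i, j)"
    by (subst sum_bits_prod[of "\<lambda>m b. f (?x m) (bit i m) b * g (?x m) b (bit j m)" "card S"])
      (use ij in \<open>simp add: tensor_mat_def lmul_def\<close>)
  finally show "(tensor_mat S f * tensor_mat S g) $$ (i, j) = tensor_mat S (\<lambda>q. lmul (f q) (g q)) $$ (i, j)" .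
qed (auto simp: tensor_mat_def)

lemma prod_sorted_list_of_set:
  assumes "finite S"
  shows "(\<Prod>m<card S. f (sorted_list_of_set S ! m)) = (\<Prod>q\<in>S. f q)"
proof -
  have "bij_betw (\<lambda>m. sorted_list_of_set S ! m) {..<card S} S"
    using bij_betw_nth[of "sorted_list_of_set S" "{..<card S}" S] assms by simp
  then show ?thesis by (rule prod.reindex_bij_betw)
qed

lemma mtrace_tensor_mat:
  assumes "finite S"
  shows "mtrace (tensor_mat S f) = (\<Prod>q\<in>S. ltr (f q))"
proof -
  have "mtrace (tensor_mat S f) = (\<Sum>k<(2::nat) ^ card S. \<Prod>m<card S. f (sorted_list_of_set S ! m) (bit k m) (bit k m))"
    by (subst mtrace_eq[OF tensor_mat_carrier]) (simp add: tensor_mat_def)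
  also have "\<dots> = (\<Prod>m<card S. ltr (f (sorted_list_of_set S ! m)))"
    by (subst sum_bits_prod[of "\<lambda>m b. f (sorted_list_of_set S ! m) b b" "card S"]) (simp add: ltr_def)
  finally show ?thesis by (simp add: prod_sorted_list_of_set[OF assms, of "\<lambda>q. ltr (f q)"])
qed

lemma nth_sorted_list_of_set_mem: "m < card S \<Longrightarrow> sorted_list_of_set S ! m \<in> S"
  by (metis card.infinite length_sorted_list_of_set not_less_zero nth_mem set_sorted_list_of_set)

lemma tensor_mat_cong: "(\<And>q. q \<in> S \<Longrightarrow> f q = g q) \<Longrightarrow> tensor_mat S f = tensor_mat S g"
  unfolding tensor_mat_def by (intro cong_mat) (auto intro!: prod.cong simp: nth_sorted_list_of_set_mem)

lemma mat_adjoint_tensor_mat: "mat_adjoint (tensor_mat S f) = tensor_mat S (\<lambda>q x y. cnj (f q y x))"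
  by (rule eq_matI) (auto simp: tensor_mat_def mat_adjoint_def mat_of_rows_def)

lemma pauli_mat_carrier [simp]: "pauli_mat S P \<in> carrier_mat (2 ^ card S) (2 ^ card S)"
  by (simp add: pauli_mat_def)

lemma pauli_mat_operators [simp]: "pauli_mat {..<n} P \<in> operators n"
  using pauli_mat_carrier[of "{..<n}" P] by simp

lemma dim_pauli_mat [simp]: "dim_row (pauli_mat S P) = 2 ^ card S" "dim_col (pauli_mat S P) = 2 ^ card S"
  by (simp_all add: pauli_mat_def)

lemma cnj_pauli_entry: "cnj (pauli_entry p x y) = pauli_entry p y x"
  by (cases p) auto

lemma mat_adjoint_pauli_mat [simp]: "mat_adjoint (pauli_mat S P) = pauli_mat S P"
  by (simp add: pauli_mat_def mat_adjoint_tensor_mat cnj_pauli_entry)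

lemma lmul_PI [simp]: "lmul (pauli_entry PI) f = f" "lmul f (pauli_entry PI) = f"
  by (auto simp: lmul_def fun_eq_iff)

lemma ltr_lmul_pauli: "ltr (lmul (pauli_entry p) (pauli_entry q)) = (if p = q then 2 else 0)"
  by (cases p; cases q) (auto simp: ltr_def lmul_def)

lemma mtrace_pauli_mult:
  assumes "finite S"
  shows "mtrace (pauli_mat S P * pauli_mat S Q) = (if \<forall>q\<in>S. P q = Q q then 2 ^ card S else 0)"
  using assms by (auto simp: pauli_mat_def tensor_mat_mult mtrace_tensor_mat ltr_lmul_pauli)

lemma pauli_mat_id_string: "pauli_mat S id_string = 1\<^sub>m (2 ^ card S)"
proof (rule eq_matI)
  fix i j assume "i < dim_row (1\<^sub>m (2 ^ card S) :: complex mat)" "j < dim_col (1\<^sub>m (2 ^ card S) :: complex mat)"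
  then have ij: "i < 2 ^ card S" "j < 2 ^ card S" by auto
  \<comment> \<open>Both numbers are below \<open>2 ^ card S\<close>, so their higher digits vanish
    and the lower ones decide.\<close>
  have "i = j" if "\<forall>m<card S. bit i m = bit j m"
  proof (rule bit_eqI)
    fix m show "bit i m = bit j m"
    proof (cases "m < card S")
      case False
      then have "(2::nat) ^ card S \<le> 2 ^ m" by (intro power_increasing) auto
      then have "i < 2 ^ m" "j < 2 ^ m" using ij by (auto intro: less_le_trans)
      then show ?thesis by (simp add: bit_iff_odd)
    qed (use that in auto)
  qed
  then show "pauli_mat S id_string $$ (i, j) = 1\<^sub>m (2 ^ card S) $$ (i, j)"
    using ij by (auto simp: pauli_mat_def tensor_mat_def id_string_def)
qed auto

lemma pauli_mat_square: "pauli_mat S P * pauli_mat S P = 1\<^sub>m (2 ^ card S)"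
proof -
  have "lmul (pauli_entry p) (pauli_entry p) = pauli_entry PI" for p
    by (cases p) (auto simp: lmul_def fun_eq_iff)
  then show ?thesis
    unfolding pauli_mat_id_string[symmetric] by (simp add: pauli_mat_def tensor_mat_mult id_string_def)
qed

lemma pauli_mat_commute:
  assumes "\<And>q. q \<in> S \<Longrightarrow> P q = PI \<or> Q q = PI"
  shows "pauli_mat S P * pauli_mat S Q = pauli_mat S Q * pauli_mat S P"
  unfolding pauli_mat_def tensor_mat_mult by (rule tensor_mat_cong) (use assms in force)

lemma mtrace_four_paulis:
  assumes "finite S"
  shows "mtrace (pauli_mat S A * pauli_mat S P * pauli_mat S B * pauli_mat S Q) =
    (\<Prod>q\<in>S. ltr (lmul (lmul (lmul (pauli_entry (A q)) (pauli_entry (P q))) (pauli_entry (B q))) (pauli_entry (Q q))))"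
  using assms by (simp add: pauli_mat_def tensor_mat_mult mtrace_tensor_mat)

text \<open>Distributivity, transported from extensional functions: the two function spaces differ
  only in the value outside \<open>A\<close>.\<close>

lemma sum_prod_PiE_dflt:
  fixes f :: "'a \<Rightarrow> 'b \<Rightarrow> 'c :: comm_semiring_1"
  assumes "finite A" "\<And>x. x \<in> A \<Longrightarrow> finite (B x)"
  shows "(\<Sum>g\<in>PiE_dflt A d B. \<Prod>x\<in>A. f x (g x)) = (\<Prod>x\<in>A. \<Sum>y\<in>B x. f x y)"
  by (subst prod_sum_PiE[OF assms], simp,
      rule sum.reindex_bij_witness[of _ "\<lambda>g x. if x \<in> A then g x else d" "\<lambda>g. restrict g A"])
    (auto simp: PiE_dflt_def fun_eq_iff PiE_def extensional_def intro!: prod.cong)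

lemma sum_prod_pauli_strings:
  fixes f :: "nat \<Rightarrow> pauli \<Rightarrow> 'c :: comm_semiring_1"
  assumes "finite S"
  shows "(\<Sum>A\<in>pauli_strings S. \<Prod>q\<in>S. f q (A q)) = (\<Prod>q\<in>S. \<Sum>a\<in>UNIV. f q a)"
  unfolding pauli_strings_eq_PiE_dflt by (rule sum_prod_PiE_dflt[OF assms]) simp

section \<open>Completeness of the Pauli matrices on one qubit\<close>

lemma sum_four_swap:
  fixes f :: "'a \<Rightarrow> 'u \<Rightarrow> 'v \<Rightarrow> 'c :: comm_semiring_1"
  shows "(\<Sum>a\<in>A. \<Sum>b\<in>B. \<Sum>u\<in>U. \<Sum>v\<in>V. f a u v * (g b u v * h u v)) =
    (\<Sum>u\<in>U. \<Sum>v\<in>V. (\<Sum>a\<in>A. f a u v) * ((\<Sum>b\<in>B. g b u v) * h u v))" (is "?l = _")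
proof -
  let ?X = "\<lambda>a b u v. f a u v * (g b u v * h u v)"
  have "?l = (\<Sum>a\<in>A. \<Sum>u\<in>U. \<Sum>b\<in>B. \<Sum>v\<in>V. ?X a b u v)" by (intro sum.cong refl sum.swap)
  also have "\<dots> = (\<Sum>u\<in>U. \<Sum>a\<in>A. \<Sum>b\<in>B. \<Sum>v\<in>V. ?X a b u v)" by (rule sum.swap)
  also have "\<dots> = (\<Sum>u\<in>U. \<Sum>a\<in>A. \<Sum>v\<in>V. \<Sum>b\<in>B. ?X a b u v)" by (intro sum.cong refl sum.swap)
  also have "\<dots> = (\<Sum>u\<in>U. \<Sum>v\<in>V. \<Sum>a\<in>A. \<Sum>b\<in>B. ?X a b u v)" by (intro sum.cong refl sum.swap)
  finally show ?thesis by (simp only: sum_distrib_right) (simp only: sum_distrib_left)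
qed

lemma UNIV_bool4: "(UNIV :: (bool \<times> bool \<times> bool \<times> bool) set) = {False, True} \<times> {False, True} \<times> {False, True} \<times> {False, True}"
  unfolding UNIV_bool[symmetric] by simp

text \<open>The factors are arranged so that \<open>f\<close> and \<open>h\<close>, the matrices to
  be summed over, come first and the two fixed ones form a separate weight.\<close>

lemma ltr_four: "ltr (lmul (lmul (lmul f g) h) k) =
    (\<Sum>(x, y, z, w)\<in>UNIV. f x y * (h z w * (g y z * k w x)))"
  unfolding UNIV_bool4
  by (simp add: ltr_def lmul_def sum.cartesian_product[symmetric] ring_distribs mult.assoc add.assoc)

text \<open>The completeness relation: the Pauli matrices tensored with themselves sum to twice the
  swap operator.\<close>

lemma sum_pauli_swap:
  "(\<Sum>a\<in>UNIV. pauli_entry a x y * pauli_entry a z w) = (if x = w \<and> y = z then 2 else 0)"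
  unfolding UNIV_pauli by (cases x; cases y; cases z; cases w) auto

lemma sum_delta_bool4:
  fixes f g :: "bool \<Rightarrow> bool \<Rightarrow> complex"
  shows "(\<Sum>(x', y', z', w')\<in>UNIV. (if x = y' \<and> y = x' then 2 else 0) *
      ((if z = w' \<and> w = z' then 2 else 0) * (c * (f y' z' * g w' x')))) = 4 * (c * (f x w * g z y))"
  unfolding UNIV_bool4 by (cases x; cases y; cases z; cases w) (simp_all add: sum.cartesian_product[symmetric])

lemma sum_ltr_product:
  fixes f g f' g' :: "bool \<Rightarrow> bool \<Rightarrow> complex"
  shows "(\<Sum>(x, y, z, w)\<in>UNIV. (f y z * g w x) * (f' x w * g' z y)) = ltr (lmul f g') * ltr (lmul g f')"
  unfolding UNIV_bool4
  by (simp add: ltr_def lmul_def sum.cartesian_product[symmetric] ring_distribs mult_ac add_ac)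

text \<open>Completeness, applied to the sums over a and over b, contracts the two traces into 4 Tr
  (p' p) Tr (q' q). Orthogonality of the Pauli matrices turns this into 4 times 2 times 2, or
  zero.\<close>

lemma single_qubit_inversion:
  "(\<Sum>a\<in>UNIV. \<Sum>b\<in>UNIV.
      ltr (lmul (lmul (lmul (pauli_entry a) (pauli_entry p')) (pauli_entry b)) (pauli_entry q')) *
      ltr (lmul (lmul (lmul (pauli_entry a) (pauli_entry q)) (pauli_entry b)) (pauli_entry p)))
    = (if p' = p \<and> q' = q then 16 else 0)"
proof -
  let ?A = "\<lambda>a (x, y, z, w). pauli_entry a x y" and ?B = "\<lambda>b (x, y, z, w). pauli_entry b z w"
  let ?C = "\<lambda>g k (x, y, z, w). (pauli_entry g y z * pauli_entry k w x :: complex)"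
  let ?U = "UNIV :: (bool \<times> bool \<times> bool \<times> bool) set"
  have four: "ltr (lmul (lmul (lmul (pauli_entry a) (pauli_entry g)) (pauli_entry b)) (pauli_entry k)) =
    (\<Sum>u\<in>?U. ?A a u * (?B b u * ?C g k u))" for a b g k
    unfolding ltr_four by (simp only: case_prod_unfold)
  have "(\<Sum>a\<in>UNIV. \<Sum>b\<in>UNIV.
      ltr (lmul (lmul (lmul (pauli_entry a) (pauli_entry p')) (pauli_entry b)) (pauli_entry q')) *
      ltr (lmul (lmul (lmul (pauli_entry a) (pauli_entry q)) (pauli_entry b)) (pauli_entry p)))
    = (\<Sum>a\<in>UNIV. \<Sum>b\<in>UNIV. \<Sum>u\<in>?U. \<Sum>v\<in>?U. (?A a u * ?A a v) * ((?B b u * ?B b v) * (?C p' q' u * ?C q p v)))"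
    unfolding four sum_product by (intro sum.cong refl) (simp only: mult_ac)
  also have "\<dots> = (\<Sum>u\<in>?U. \<Sum>v\<in>?U. (\<Sum>a\<in>UNIV. ?A a u * ?A a v) * ((\<Sum>b\<in>UNIV. ?B b u * ?B b v) * (?C p' q' u * ?C q p v)))"
    by (rule sum_four_swap)
  also have "\<dots> = (\<Sum>(x, y, z, w)\<in>?U. \<Sum>(x', y', z', w')\<in>?U. (if x = y' \<and> y = x' then 2 else 0) *
      ((if z = w' \<and> w = z' then 2 else 0) * (?C p' q' (x, y, z, w) * (pauli_entry q y' z' * pauli_entry p w' x'))))"
    by (simp only: case_prod_unfold fst_conv snd_conv sum_pauli_swap)
  also have "\<dots> = (\<Sum>(x, y, z, w)\<in>?U. 4 * ((pauli_entry p' y z * pauli_entry q' w x) * (pauli_entry q x w * pauli_entry p z y)))"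
    unfolding sum_delta_bool4 by (simp only: case_prod_unfold fst_conv snd_conv)
  also have "\<dots> = 4 * (ltr (lmul (pauli_entry p') (pauli_entry p)) * ltr (lmul (pauli_entry q') (pauli_entry q)))"
    unfolding sum_ltr_product[symmetric] by (simp only: sum_distrib_left case_prod_unfold)
  also have "\<dots> = (if p' = p \<and> q' = q then 16 else 0)" unfolding ltr_lmul_pauli by auto
  finally show ?thesis .
qed

section \<open>Local inversion of the Pauli transfer matrix\<close>

definition ptm :: "nat \<Rightarrow> superop \<Rightarrow> pair_index \<Rightarrow> complex" where
  "ptm n F u = mtrace (pauli_mat {..<n} (fst u) * F (pauli_mat {..<n} (snd u))) / 2 ^ n"

abbreviation ltr4 :: "pauli \<Rightarrow> pauli \<Rightarrow> pauli \<Rightarrow> pauli \<Rightarrow> complex" where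
  "ltr4 a p b q \<equiv> ltr (lmul (lmul (lmul (pauli_entry a) (pauli_entry p)) (pauli_entry b)) (pauli_entry q))"

text \<open>The trace of four Pauli strings splits into one-qubit traces, and the normalization
  gives one half to each qubit.\<close>

lemma ptm_chi_expansion:
  assumes "chi_expansion n F chi"
  shows "ptm n F (A, B) = (\<Sum>v\<in>pauli_strings {..<n} \<times> pauli_strings {..<n}. chi v *
    (\<Prod>q<n. ltr4 (A q) (fst v q) (B q) (snd v q) / 2))"
proof -
  let ?V = "pauli_strings {..<n} \<times> pauli_strings {..<n}"
  let ?p = "pauli_mat {..<n}"
  have "F (?p B) = msum n (\<lambda>v. chi v \<cdot>\<^sub>m (?p (fst v) * ?p B * ?p (snd v))) ?V"
    using assms by (auto simp: chi_expansion_def case_prod_unfold)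
  then have "mtrace (?p A * F (?p B)) = mtrace (msum n (\<lambda>v. ?p A * (chi v \<cdot>\<^sub>m (?p (fst v) * ?p B * ?p (snd v)))) ?V)"
    by (subst (asm) eq_commute, elim subst, subst msum_mult_left)
      (auto intro!: mult_carrier_mat[of _ _ "2 ^ n"] smult_carrier_mat)
  also have "\<dots> = (\<Sum>v\<in>?V. mtrace (?p A * (chi v \<cdot>\<^sub>m (?p (fst v) * ?p B * ?p (snd v)))))"
    by (intro mtrace_msum mult_carrier_mat[of _ _ "2 ^ n"] smult_carrier_mat) auto
  also have "\<dots> = (\<Sum>v\<in>?V. chi v * (\<Prod>q<n. ltr4 (A q) (fst v q) (B q) (snd v q)))"
  proof (rule sum.cong[OF refl])
    fix v assume "v \<in> ?V"
    have c: "?p (fst v) * ?p B * ?p (snd v) \<in> operators n"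
      by (intro mult_carrier_mat[of _ _ "2 ^ n"]) auto
    have "?p A * (chi v \<cdot>\<^sub>m (?p (fst v) * ?p B * ?p (snd v))) = chi v \<cdot>\<^sub>m (?p A * (?p (fst v) * ?p B * ?p (snd v)))"
      by (rule mult_smult_distrib[OF pauli_mat_operators c])
    moreover have "?p A * (?p (fst v) * ?p B * ?p (snd v)) = ?p A * ?p (fst v) * ?p B * ?p (snd v)"
      by (simp add: mult_assoc_square[of _ "2 ^ n"])
    moreover have c4: "?p A * ?p (fst v) * ?p B * ?p (snd v) \<in> operators n"
      by (intro mult_carrier_mat[of _ _ "2 ^ n"]) auto
    ultimately show "mtrace (?p A * (chi v \<cdot>\<^sub>m (?p (fst v) * ?p B * ?p (snd v)))) = chi v * (\<Prod>q<n. ltr4 (A q) (fst v q) (B q) (snd v q))"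
      by (simp only: mtrace_smult[OF c4] mtrace_four_paulis[OF finite_lessThan])
  qed
  finally show ?thesis
    by (simp add: ptm_def prod_dividef sum_divide_distrib)
qed

lemma sum_sum_prod_pauli_strings:
  fixes f :: "nat \<Rightarrow> pauli \<Rightarrow> pauli \<Rightarrow> 'c :: comm_semiring_1"
  assumes "finite S"
  shows "(\<Sum>A\<in>pauli_strings S. \<Sum>B\<in>pauli_strings S. \<Prod>q\<in>S. f q (A q) (B q)) = (\<Prod>q\<in>S. \<Sum>a\<in>UNIV. \<Sum>b\<in>UNIV. f q a b)"
proof -
  have "(\<Sum>B\<in>pauli_strings S. \<Prod>q\<in>S. f q (A q) (B q)) = (\<Prod>q\<in>S. \<Sum>b\<in>UNIV. f q (A q) b)" for A
    by (rule sum_prod_pauli_strings[OF assms])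
  then show ?thesis
    using sum_prod_pauli_strings[OF assms, of "\<lambda>q a. \<Sum>b\<in>UNIV. f q a b"] by (simp only:)
qed

text \<open>On \<open>S\<close> the one-qubit inversion selects the letters of the index. Off
  \<open>S\<close> the test strings are trivial, which only detects whether both sides of v carry
  the same letter; those v cannot be told apart.\<close>

lemma local_inverse_ptm:
  assumes chi: "chi_expansion n F chi" and S: "S \<subseteq> {..<n}"
  shows "local_inverse (ptm n F) S (P, Q) =
    (\<Sum>v\<in>{v \<in> pauli_strings {..<n} \<times> pauli_strings {..<n}.
       (\<forall>q\<in>S. fst v q = P q \<and> snd v q = Q q) \<and> (\<forall>q\<in>{..<n} - S. fst v q = snd v q)}. chi v)"
proof -
  let ?V = "pauli_strings {..<n} \<times> pauli_strings {..<n}"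
  have fin: "finite S" using S finite_subset by blast
  define off where "off = (\<lambda>v :: pair_index. \<forall>q\<in>{..<n} - S. fst v q = snd v q)"
  define on where "on = (\<lambda>v :: pair_index. \<forall>q\<in>S. fst v q = P q \<and> snd v q = Q q)"
  let ?r = "\<lambda>A B. \<Prod>q\<in>S. ltr4 (A q) (Q q) (B q) (P q)"
  have ptm: "ptm n F (A, B) = (\<Sum>v\<in>?V. chi v * (if off v then 1 else 0) *
      (\<Prod>q\<in>S. ltr4 (A q) (fst v q) (B q) (snd v q) / 2))"
    if "A \<in> pauli_strings S" "B \<in> pauli_strings S" for A B
    unfolding ptm_chi_expansion[OF chi]
  proof (rule sum.cong[OF refl])
    fix v assume "v \<in> ?V"
    have "(\<Prod>q<n. ltr4 (A q) (fst v q) (B q) (snd v q) / 2) =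
      (\<Prod>q\<in>{..<n} - S. ltr4 (A q) (fst v q) (B q) (snd v q) / 2) * (\<Prod>q\<in>S. ltr4 (A q) (fst v q) (B q) (snd v q) / 2)"
      by (rule prod.subset_diff[OF S]) simp
    \<comment> \<open>Off \<open>S\<close> both test letters are \<open>PI\<close>, and half the
      trace of the two letters of v is one or zero as they agree or not.\<close>
    also have "(\<Prod>q\<in>{..<n} - S. ltr4 (A q) (fst v q) (B q) (snd v q) / 2) = (\<Prod>q\<in>{..<n} - S. if fst v q = snd v q then 1 else 0)"
      using that by (intro prod.cong refl) (auto simp: pauli_strings_def ltr_lmul_pauli)
    also have "\<dots> = (if off v then 1 else 0)" by (auto simp: off_def)
    finally show "chi v * (\<Prod>q<n. ltr4 (A q) (fst v q) (B q) (snd v q) / 2) =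
      chi v * (if off v then 1 else 0) * (\<Prod>q\<in>S. ltr4 (A q) (fst v q) (B q) (snd v q) / 2)" by simp
  qed
  have inv: "(\<Sum>A\<in>pauli_strings S. \<Sum>B\<in>pauli_strings S.
      (\<Prod>q\<in>S. ltr4 (A q) (fst v q) (B q) (snd v q) / 2) * ?r A B) = (if on v then 2 ^ (3 * card S) else 0)" for v
  proof -
    have "(\<Sum>A\<in>pauli_strings S. \<Sum>B\<in>pauli_strings S. (\<Prod>q\<in>S. ltr4 (A q) (fst v q) (B q) (snd v q) / 2) * ?r A B)
      = (\<Prod>q\<in>S. \<Sum>a\<in>UNIV. \<Sum>b\<in>UNIV. ltr4 a (fst v q) b (snd v q) / 2 * ltr4 a (Q q) b (P q))"
      unfolding prod.distrib[symmetric]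
      by (rule sum_sum_prod_pauli_strings[OF fin, of "\<lambda>q a b. ltr4 a (fst v q) b (snd v q) / 2 * ltr4 a (Q q) b (P q)"])
    also have "\<dots> = (\<Prod>q\<in>S. (\<Sum>a\<in>UNIV. \<Sum>b\<in>UNIV. ltr4 a (fst v q) b (snd v q) * ltr4 a (Q q) b (P q)) / 2)"
      by (simp add: sum_divide_distrib)
    \<comment> \<open>16 from the one-qubit sum over 2 from the normalization: 8 per qubit, which is
      what \<open>2 ^ (3 * card S)\<close> divides out.\<close>
    also have "\<dots> = (\<Prod>q\<in>S. if fst v q = P q \<and> snd v q = Q q then 2 ^ 3 else 0)"
      unfolding single_qubit_inversion by (intro prod.cong refl) simp
    also have "\<dots> = (if on v then 2 ^ (3 * card S) else 0)"
      using fin by (auto simp: on_def power_mult[symmetric] power_mult)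
    finally show ?thesis .
  qed
  have "local_inverse (ptm n F) S (P, Q) =
    (\<Sum>A\<in>pauli_strings S. \<Sum>B\<in>pauli_strings S. ptm n F (A, B) * ?r A B) / 2 ^ (3 * card S)"
    by (simp add: local_inverse_def mtrace_four_paulis[OF fin])
  then have "local_inverse (ptm n F) S (P, Q) * 2 ^ (3 * card S) =
    (\<Sum>A\<in>pauli_strings S. \<Sum>B\<in>pauli_strings S. ptm n F (A, B) * ?r A B)"
    by (simp only:) simp
  also have "\<dots> = (\<Sum>A\<in>pauli_strings S. \<Sum>B\<in>pauli_strings S. \<Sum>v\<in>?V. chi v * (if off v then 1 else 0) *
      ((\<Prod>q\<in>S. ltr4 (A q) (fst v q) (B q) (snd v q) / 2) * ?r A B))"
    by (simp add: ptm sum_distrib_right mult.assoc)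
  also have "\<dots> = (\<Sum>A\<in>pauli_strings S. \<Sum>v\<in>?V. \<Sum>B\<in>pauli_strings S. chi v * (if off v then 1 else 0) *
      ((\<Prod>q\<in>S. ltr4 (A q) (fst v q) (B q) (snd v q) / 2) * ?r A B))"
    by (intro sum.cong refl sum.swap)
  also have "\<dots> = (\<Sum>v\<in>?V. \<Sum>A\<in>pauli_strings S. \<Sum>B\<in>pauli_strings S. chi v * (if off v then 1 else 0) *
      ((\<Prod>q\<in>S. ltr4 (A q) (fst v q) (B q) (snd v q) / 2) * ?r A B))"
    by (rule sum.swap)
  also have "\<dots> = (\<Sum>v\<in>?V. chi v * (if off v then 1 else 0) * (if on v then 2 ^ (3 * card S) else 0))"
    unfolding sum_distrib_left[symmetric] inv ..
  also have "\<dots> = (\<Sum>v\<in>?V. if on v \<and> off v then chi v else 0) * 2 ^ (3 * card S)"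
    unfolding sum_distrib_right by (intro sum.cong) auto
  also have "(\<Sum>v\<in>?V. if on v \<and> off v then chi v else 0) = sum chi {v \<in> ?V. on v \<and> off v}"
    by (rule sum.inter_filter[symmetric]) simp
  finally show ?thesis by (simp add: on_def off_def)
qed

lemma local_inverse_ptm_projects:
  assumes chi: "chi_expansion n F chi" and u: "u \<in> pauli_strings {..<n} \<times> pauli_strings {..<n}"
  shows "local_inverse (ptm n F) (union_supp u) u =
    chi u + (\<Sum>v\<in>{v \<in> pauli_strings {..<n} \<times> pauli_strings {..<n}. projects v u}. chi v)"
proof -
  let ?V = "pauli_strings {..<n} \<times> pauli_strings {..<n}" and ?S = "union_supp u"
  have S: "?S \<subseteq> {..<n}" using u by (auto simp: union_supp_eq supp_def pauli_strings_def mem_Times_iff)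
  have "{v \<in> ?V. (\<forall>q\<in>?S. fst v q = fst u q \<and> snd v q = snd u q) \<and> (\<forall>q\<in>{..<n} - ?S. fst v q = snd v q)}
    = insert u {v \<in> ?V. projects v u}" (is "?L = ?R")
  proof (intro equalityI subsetI)
    fix v assume v: "v \<in> ?L"
    then have on: "fst v q = fst u q" "snd v q = snd u q" if "q \<in> ?S" for q using that by auto
    have sub: "?S \<subseteq> union_supp v"
    proof
      fix q assume "q \<in> ?S"
      with on[OF this] show "q \<in> union_supp v" by (auto simp: union_supp_eq supp_def)
    qed
    have out: "fst u q = PI" "snd u q = PI" if "q \<notin> ?S" for q
      using that by (auto simp: union_supp_eq supp_def)
    have r: "u = (restrict_string (fst v) ?S, restrict_string (snd v) ?S)"
      using on out by (intro prod_eqI) (auto simp: restrict_string_def)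
    show "v \<in> ?R"
    \<comment> \<open>With equal supports there are no letters off \<open>?S\<close>, so v is u
      itself; a larger support makes v one of the projecting indices.\<close>
    proof (cases "?S = union_supp v")
      case True
      then have "fst v q = PI" "snd v q = PI" if "q \<notin> ?S" for q
        using that by (auto simp: union_supp_eq supp_def)
      with on out have "fst v q = fst u q" "snd v q = snd u q" for q
        by (cases "q \<in> ?S"; simp del: union_supp.simps)+
      then have "v = u" by (intro prod_eqI ext)
      then show ?thesis by simp
    next
      case False
      have "q < n" if "q \<in> union_supp v" for q
        using that v by (auto simp: union_supp_eq supp_def pauli_strings_def mem_Times_iff)
      then have "projects v u"
        unfolding projects_def using v sub False by (intro conjI ballI r) auto
      then show ?thesis using v by blast
    qed
  next
    fix v assume "v \<in> ?R"
    then consider "v = u" | "v \<in> ?V" "projects v u" by auto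
    then show "v \<in> ?L"
    proof cases
      case 1
      then show ?thesis using u by (auto simp: union_supp_eq supp_def)
    next
      case 2
      have e: "u = (restrict_string (fst v) ?S, restrict_string (snd v) ?S)"
        using 2(2) unfolding projects_def by blast
      have "fst v q = fst u q \<and> snd v q = snd u q" if "q \<in> ?S" for q
        using fun_cong[OF arg_cong[OF e, of fst], of q] fun_cong[OF arg_cong[OF e, of snd], of q] that
        by (simp only: fst_conv snd_conv restrict_string_def if_True simp_thms)
      moreover have "fst v q = snd v q" if "q \<notin> ?S" for q
      proof (cases "q \<in> union_supp v")
        case True
        then show ?thesis using that 2(2) unfolding projects_def by blast
      qed (auto simp: union_supp_eq supp_def)
      ultimately show ?thesis using 2(1) by auto
    qed
  qed
  moreover have "\<not> projects u u" by (auto simp: projects_def)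
  moreover have "finite ?V" by simp
  ultimately show ?thesis
    using local_inverse_ptm[OF chi S, of "fst u" "snd u"] by simp
qed

section \<open>Uniqueness of the Pauli coefficients\<close>

definition unit_mat :: "nat \<Rightarrow> nat \<times> nat \<Rightarrow> complex mat" where
  "unit_mat n ij = Matrix.mat (2 ^ n) (2 ^ n) (\<lambda>xy. if xy = ij then 1 else 0)"

lemma unit_mat_carrier [simp]: "unit_mat n ij \<in> operators n"
  by (simp add: unit_mat_def)

text \<open>Read at its own position, a sandwiched matrix unit separates into one diagonal entry of
  each factor; the sum over all positions then becomes a product of two traces.\<close>

lemma mult_unit_mat_index:
  assumes "X \<in> operators n" "Y \<in> operators n" "i < 2 ^ n" "j < 2 ^ n"
  shows "(X * unit_mat n (i, j) * Y) $$ (i, j) = X $$ (i, i) * Y $$ (j, j)"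
proof -
  have "(X * unit_mat n (i, j)) $$ (i, l) = (if l = j then X $$ (i, i) else 0)" if "l < 2 ^ n" for l
  proof -
    have "(X * unit_mat n (i, j)) $$ (i, l) = (\<Sum>k<2 ^ n. X $$ (i, k) * unit_mat n (i, j) $$ (k, l))"
      using assms that by (intro mult_mat_index) auto
    also have "\<dots> = (\<Sum>k<2 ^ n. if k = i then (if l = j then X $$ (i, i) else 0) else 0)"
      using that assms by (intro sum.cong) (auto simp: unit_mat_def)
    also have "\<dots> = (if l = j then X $$ (i, i) else 0)" using assms by simp
    finally show ?thesis .
  qed
  moreover have "(X * unit_mat n (i, j) * Y) $$ (i, j) = (\<Sum>l<2 ^ n. (X * unit_mat n (i, j)) $$ (i, l) * Y $$ (l, j))"
    using assms by (intro mult_mat_index) auto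
  ultimately have "(X * unit_mat n (i, j) * Y) $$ (i, j) = (\<Sum>l<2 ^ n. (if l = j then X $$ (i, i) else 0) * Y $$ (l, j))"
    by simp
  also have "\<dots> = (\<Sum>l<2 ^ n. if l = j then X $$ (i, i) * Y $$ (j, j) else 0)"
    by (intro sum.cong) auto
  finally show ?thesis using assms by simp
qed

text \<open>
  For \<open>F M = A M B\<close> the following is \<open>Tr (P A) Tr (B Q)\<close>, so that it extracts
  \<open>4 ^ n\<close> times the coefficient of \<open>P \<bullet> Q\<close> from a Pauli expansion.
\<close>

definition coeff_extract :: "nat \<Rightarrow> pstring \<Rightarrow> pstring \<Rightarrow> superop \<Rightarrow> complex" where
  "coeff_extract n P Q F = (\<Sum>i<2 ^ n. \<Sum>j<2 ^ n.
     (pauli_mat {..<n} P * F (unit_mat n (i, j)) * pauli_mat {..<n} Q) $$ (i, j))"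

lemma coeff_extract_cong:
  "(\<And>M. M \<in> operators n \<Longrightarrow> F M = G M) \<Longrightarrow> coeff_extract n P Q F = coeff_extract n P Q G"
  by (simp add: coeff_extract_def)

lemma coeff_extract_sandwich:
  assumes "A \<in> operators n" "B \<in> operators n"
  shows "coeff_extract n P Q (\<lambda>M. A * M * B) = mtrace (pauli_mat {..<n} P * A) * mtrace (B * pauli_mat {..<n} Q)"
proof -
  let ?p = "pauli_mat {..<n}"
  have "?p P * (A * unit_mat n (i, j) * B) * ?p Q = (?p P * A) * unit_mat n (i, j) * (B * ?p Q)" for i j
    using assms by (simp add: mult_assoc_square[of _ "2 ^ n"])
  then have "coeff_extract n P Q (\<lambda>M. A * M * B) = (\<Sum>i<2 ^ n. \<Sum>j<2 ^ n. (?p P * A) $$ (i, i) * (B * ?p Q) $$ (j, j))"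
    unfolding coeff_extract_def using assms
    by (simp add: mult_unit_mat_index del: index_mult_mat(1))
  also have "\<dots> = mtrace (?p P * A) * mtrace (B * ?p Q)"
    using assms by (subst (1 2) mtrace_eq[of _ "2 ^ n"]) (auto simp: sum_product)
  finally show ?thesis .
qed

lemma coeff_extract_add:
  assumes "\<And>M. M \<in> operators n \<Longrightarrow> F M \<in> operators n \<and> G M \<in> operators n"
  shows "coeff_extract n P Q (\<lambda>M. F M + G M) = coeff_extract n P Q F + coeff_extract n P Q G"
proof -
  let ?p = "pauli_mat {..<n}"
  have "(?p P * (A + B) * ?p Q) $$ (i, j) = (?p P * A * ?p Q) $$ (i, j) + (?p P * B * ?p Q) $$ (i, j)"
    if "A \<in> operators n" "B \<in> operators n" "i < 2 ^ n" "j < 2 ^ n" for A B i j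
  proof -
    have "?p P * (A + B) * ?p Q = ?p P * A * ?p Q + ?p P * B * ?p Q"
      using that by (simp add: mult_add_distrib_mat[of _ "2 ^ n" "2 ^ n" _ "2 ^ n"] add_mult_distrib_mat[of _ "2 ^ n" "2 ^ n" _ _ "2 ^ n"])
    then show ?thesis using that by simp
  qed
  then show ?thesis using assms by (simp add: coeff_extract_def sum.distrib del: index_mult_mat(1))
qed

lemma coeff_extract_smult:
  assumes "\<And>M. M \<in> operators n \<Longrightarrow> F M \<in> operators n"
  shows "coeff_extract n P Q (\<lambda>M. c \<cdot>\<^sub>m F M) = c * coeff_extract n P Q F"
proof -
  let ?p = "pauli_mat {..<n}"
  have "(?p P * (c \<cdot>\<^sub>m A) * ?p Q) $$ (i, j) = c * (?p P * A * ?p Q) $$ (i, j)"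
    if "A \<in> operators n" "i < 2 ^ n" "j < 2 ^ n" for A i j
  proof -
    have "?p P * (c \<cdot>\<^sub>m A) * ?p Q = c \<cdot>\<^sub>m (?p P * A * ?p Q)"
      using that by (simp add: mult_smult_distrib[of _ "2 ^ n" "2 ^ n" _ "2 ^ n"] mult_smult_assoc_mat[of _ "2 ^ n" "2 ^ n" _ "2 ^ n"])
    then show ?thesis using that by simp
  qed
  then show ?thesis using assms by (simp add: coeff_extract_def sum_distrib_left del: index_mult_mat(1))
qed

lemma minus_eq_add_smult: "A \<in> carrier_mat N N \<Longrightarrow> B \<in> carrier_mat N N \<Longrightarrow> A - B = A + (- 1) \<cdot>\<^sub>m (B :: complex mat)"
  by (rule eq_matI) auto

lemma coeff_extract_minus:
  assumes "\<And>M. M \<in> operators n \<Longrightarrow> F M \<in> operators n \<and> G M \<in> operators n"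
  shows "coeff_extract n P Q (\<lambda>M. F M - G M) = coeff_extract n P Q F - coeff_extract n P Q G"
proof -
  have "coeff_extract n P Q (\<lambda>M. F M - G M) = coeff_extract n P Q (\<lambda>M. F M + (- 1) \<cdot>\<^sub>m G M)"
    using assms by (intro coeff_extract_cong minus_eq_add_smult) auto
  then show ?thesis using assms by (simp add: coeff_extract_add coeff_extract_smult)
qed

lemma coeff_extract_msum:
  assumes "\<And>M a. M \<in> operators n \<Longrightarrow> a \<in> A \<Longrightarrow> F a M \<in> operators n"
  shows "coeff_extract n P Q (\<lambda>M. msum n (\<lambda>a. F a M) A) = (\<Sum>a\<in>A. coeff_extract n P Q (F a))"
proof -
  let ?p = "pauli_mat {..<n}"
  have "(?p P * msum n (\<lambda>a. F a M) A * ?p Q) $$ (i, j) = (\<Sum>a\<in>A. (?p P * F a M * ?p Q) $$ (i, j))"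
    if "M \<in> operators n" "i < 2 ^ n" "j < 2 ^ n" for M i j
    using that assms by (simp add: msum_mult_left msum_mult_right msum_index del: index_mult_mat(1))
  then have "coeff_extract n P Q (\<lambda>M. msum n (\<lambda>a. F a M) A)
      = (\<Sum>i<2 ^ n. \<Sum>j<2 ^ n. \<Sum>a\<in>A. (?p P * F a (unit_mat n (i, j)) * ?p Q) $$ (i, j))"
    by (simp add: coeff_extract_def del: index_mult_mat(1))
  also have "\<dots> = (\<Sum>i<2 ^ n. \<Sum>a\<in>A. \<Sum>j<2 ^ n. (?p P * F a (unit_mat n (i, j)) * ?p Q) $$ (i, j))"
    by (intro sum.cong refl sum.swap)
  also have "\<dots> = (\<Sum>a\<in>A. coeff_extract n P Q (F a))"
    unfolding coeff_extract_def by (rule sum.swap)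
  finally show ?thesis .
qed

lemma pauli_strings_eq_on:
  "P \<in> pauli_strings S \<Longrightarrow> Q \<in> pauli_strings S \<Longrightarrow> (\<forall>q\<in>S. P q = Q q) \<longleftrightarrow> P = Q"
  by (auto simp: pauli_strings_def fun_eq_iff)

lemma id_string_mem [simp]: "id_string \<in> pauli_strings S"
  by (simp add: pauli_strings_def id_string_def)

lemma mtrace_pauli_pair:
  "P \<in> pauli_strings {..<n} \<Longrightarrow> Q \<in> pauli_strings {..<n} \<Longrightarrow>
    mtrace (pauli_mat {..<n} P * pauli_mat {..<n} Q) = (if P = Q then 2 ^ n else 0)"
  using pauli_strings_eq_on[of P "{..<n}" Q] by (simp add: mtrace_pauli_mult)

lemma pauli_mat_id_mult [simp]:
  "A \<in> operators n \<Longrightarrow> A * pauli_mat {..<n} id_string = A"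
  "A \<in> operators n \<Longrightarrow> pauli_mat {..<n} id_string * A = A"
  by (simp_all add: pauli_mat_id_string)

lemma mtrace_pauli: "P \<in> pauli_strings {..<n} \<Longrightarrow> mtrace (pauli_mat {..<n} P) = (if P = id_string then 2 ^ n else 0)"
  using mtrace_pauli_pair[of P n id_string] by simp

lemma coeff_extract_chi:
  assumes "chi_expansion n F chi" and PQ: "P \<in> pauli_strings {..<n}" "Q \<in> pauli_strings {..<n}"
  shows "coeff_extract n P Q F = 4 ^ n * chi (P, Q)"
proof -
  let ?p = "pauli_mat {..<n}" and ?V = "pauli_strings {..<n} \<times> pauli_strings {..<n}"
  have "coeff_extract n P Q F = coeff_extract n P Q (\<lambda>M. msum n (\<lambda>v. chi v \<cdot>\<^sub>m (?p (fst v) * M * ?p (snd v))) ?V)"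
    using assms(1) by (intro coeff_extract_cong) (auto simp: chi_expansion_def case_prod_unfold)
  also have "\<dots> = (\<Sum>v\<in>?V. chi v * (mtrace (?p P * ?p (fst v)) * mtrace (?p (snd v) * ?p Q)))"
    by (simp add: coeff_extract_msum coeff_extract_smult coeff_extract_sandwich)
  also have "\<dots> = (\<Sum>v\<in>?V. if v = (P, Q) then 4 ^ n * chi (P, Q) else 0)"
    using PQ by (intro sum.cong refl) (auto simp: mtrace_pauli_pair mem_Times_iff simp flip: power_mult_distrib)
  also have "\<dots> = 4 ^ n * chi (P, Q)" using PQ by simp
  finally show ?thesis .
qed

lemma ham_mat_operators [simp]: "ham_mat n h A \<in> operators n"
  by (simp add: ham_mat_def)

lemma mtrace_pauli_ham_mat:
  assumes "R \<in> pauli_strings {..<n}"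
  shows "mtrace (pauli_mat {..<n} R * ham_mat n h (pauli_strings {..<n})) = 2 ^ n * h R"
proof -
  let ?p = "pauli_mat {..<n}"
  have "mtrace (?p R * ham_mat n h (pauli_strings {..<n})) = (\<Sum>P\<in>pauli_strings {..<n}. h P * mtrace (?p R * ?p P))"
    unfolding ham_mat_def
    by (simp add: msum_mult_left mtrace_msum mult_smult_distrib[of _ "2 ^ n" "2 ^ n" _ "2 ^ n"] mtrace_smult[of _ "2 ^ n"])
  also have "\<dots> = (\<Sum>P\<in>pauli_strings {..<n}. if P = R then 2 ^ n * h R else 0)"
    using assms by (intro sum.cong refl) (auto simp: mtrace_pauli_pair)
  finally show ?thesis using assms by simp
qed

lemma coeff_extract_lindblad:
  assumes "lindblad_expansion n F h G" and PQ: "P \<in> pauli_strings {..<n}" "Q \<in> pauli_strings {..<n}"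
  shows "coeff_extract n P Q F =
    - \<i> * (2 ^ n * h P * mtrace (pauli_mat {..<n} Q) - mtrace (pauli_mat {..<n} P) * (2 ^ n * h Q)) +
    (\<Sum>v\<in>(pauli_strings {..<n} - {id_string}) \<times> (pauli_strings {..<n} - {id_string}). G v *
       ((if v = (P, Q) then 4 ^ n else 0)
        - (1/2) * (mtrace (pauli_mat {..<n} P * (pauli_mat {..<n} (snd v) * pauli_mat {..<n} (fst v))) * mtrace (pauli_mat {..<n} Q)
           + mtrace (pauli_mat {..<n} P) * mtrace (pauli_mat {..<n} (snd v) * pauli_mat {..<n} (fst v) * pauli_mat {..<n} Q))))"
proof -
  let ?p = "pauli_mat {..<n}" and ?V = "(pauli_strings {..<n} - {id_string}) \<times> (pauli_strings {..<n} - {id_string})"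
  let ?H = "ham_mat n h (pauli_strings {..<n})" and ?I = "1\<^sub>m (2 ^ n) :: complex mat"
  \<comment> \<open>Identity matrices are inserted so that every term is a sandwich
    \<open>A * M * B\<close>, whose coefficients are products of traces.\<close>
  let ?L = "\<lambda>v M. G v \<cdot>\<^sub>m (?p (fst v) * M * ?p (snd v) - (1/2) \<cdot>\<^sub>m (?p (snd v) * ?p (fst v) * M * ?I + ?I * M * (?p (snd v) * ?p (fst v))))"
  have "coeff_extract n P Q F = coeff_extract n P Q (\<lambda>M. (- \<i>) \<cdot>\<^sub>m (?H * M * ?I - ?I * M * ?H) + msum n (\<lambda>v. ?L v M) ?V)"
  proof (rule coeff_extract_cong)
    fix M assume M: "M \<in> operators n"
    then have "F M = ham_part ?H M + msum n (\<lambda>v. G v \<cdot>\<^sub>m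
            (?p (fst v) * M * ?p (snd v) - (1/2) \<cdot>\<^sub>m anticomm (?p (snd v) * ?p (fst v)) M)) ?V"
      using assms(1) unfolding lindblad_expansion_def by (simp add: case_prod_unfold)
    also have "\<dots> = (- \<i>) \<cdot>\<^sub>m (?H * M * ?I - ?I * M * ?H) + msum n (\<lambda>v. ?L v M) ?V"
      using M by (simp add: ham_part_def anticomm_def)
    finally show "F M = (- \<i>) \<cdot>\<^sub>m (?H * M * ?I - ?I * M * ?H) + msum n (\<lambda>v. ?L v M) ?V" .
  qed
  also have "\<dots> = - \<i> * (mtrace (?p P * ?H) * mtrace (?p Q) - mtrace (?p P) * mtrace (?H * ?p Q)) +
    (\<Sum>v\<in>?V. G v * (mtrace (?p P * ?p (fst v)) * mtrace (?p (snd v) * ?p Q)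
      - (1/2) * (mtrace (?p P * (?p (snd v) * ?p (fst v))) * mtrace (?p Q)
         + mtrace (?p P) * mtrace (?p (snd v) * ?p (fst v) * ?p Q))))"
    by (simp add: coeff_extract_add coeff_extract_msum coeff_extract_smult coeff_extract_minus coeff_extract_sandwich)
  also have "mtrace (?H * ?p Q) = 2 ^ n * h Q"
    using PQ by (subst mtrace_comm[of _ "2 ^ n"]) (auto simp: mtrace_pauli_ham_mat)
  also have "mtrace (?p P * ?H) = 2 ^ n * h P" using PQ by (simp add: mtrace_pauli_ham_mat)
  also have "(\<Sum>v\<in>?V. G v * (mtrace (?p P * ?p (fst v)) * mtrace (?p (snd v) * ?p Q)
      - (1/2) * (mtrace (?p P * (?p (snd v) * ?p (fst v))) * mtrace (?p Q)
         + mtrace (?p P) * mtrace (?p (snd v) * ?p (fst v) * ?p Q)))) =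
    (\<Sum>v\<in>?V. G v * ((if v = (P, Q) then 4 ^ n else 0)
      - (1/2) * (mtrace (?p P * (?p (snd v) * ?p (fst v))) * mtrace (?p Q)
         + mtrace (?p P) * mtrace (?p (snd v) * ?p (fst v) * ?p Q))))"
  proof (rule sum.cong[OF refl])
    fix v assume "v \<in> ?V"
    then have "mtrace (?p P * ?p (fst v)) * mtrace (?p (snd v) * ?p Q) = (if v = (P, Q) then 4 ^ n else 0)"
      using PQ by (cases v) (auto simp: mtrace_pauli_pair simp flip: power_mult_distrib)
    then show "G v * (mtrace (?p P * ?p (fst v)) * mtrace (?p (snd v) * ?p Q)
      - (1/2) * (mtrace (?p P * (?p (snd v) * ?p (fst v))) * mtrace (?p Q)
         + mtrace (?p P) * mtrace (?p (snd v) * ?p (fst v) * ?p Q))) = G v * ((if v = (P, Q) then 4 ^ n else 0)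
      - (1/2) * (mtrace (?p P * (?p (snd v) * ?p (fst v))) * mtrace (?p Q)
         + mtrace (?p P) * mtrace (?p (snd v) * ?p (fst v) * ?p Q)))" by (simp only:)
  qed
  finally show ?thesis .
qed

text \<open>For nontrivial P and Q the Hamiltonian and anticommutator terms carry a factor Tr P or
  Tr Q and vanish. At (P, I) and (I, P) the anticommutators contribute equally and cancel in the
  difference, leaving the commutator.\<close>

lemma lindblad_coeff_eq_chi:
  assumes chi: "chi_expansion n F chi" and L: "lindblad_expansion n F h G"
    and P: "P \<in> pauli_strings {..<n}" "P \<noteq> id_string"
  shows "Q \<in> pauli_strings {..<n} \<Longrightarrow> Q \<noteq> id_string \<Longrightarrow> G (P, Q) = chi (P, Q)"
    and "h P = \<i> / 2 * (chi (P, id_string) - chi (id_string, P))"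
proof -
  let ?p = "pauli_mat {..<n}" and ?V = "(pauli_strings {..<n} - {id_string}) \<times> (pauli_strings {..<n} - {id_string})"
  { assume Q: "Q \<in> pauli_strings {..<n}" "Q \<noteq> id_string"
    have "4 ^ n * chi (P, Q) = (\<Sum>v\<in>?V. G v * (if v = (P, Q) then 4 ^ n else 0))"
      using coeff_extract_chi[OF chi P(1) Q(1)] coeff_extract_lindblad[OF L P(1) Q(1)] P Q
      by (simp add: mtrace_pauli)
    also have "\<dots> = (\<Sum>v\<in>?V. if v = (P, Q) then 4 ^ n * G (P, Q) else 0)"
      by (intro sum.cong) auto
    also have "\<dots> = 4 ^ n * G (P, Q)" using P Q by simp
    finally show "G (P, Q) = chi (P, Q)" by simp }
  \<comment> \<open>The anticommutator contribution common to (P, I) and (I, P).\<close>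
  define S where "S = (\<Sum>v\<in>?V. G v * (1/2 * (mtrace (?p P * (?p (snd v) * ?p (fst v))) * 2 ^ n)))"
  have ne: "v \<noteq> (P, id_string)" "v \<noteq> (id_string, P)" if "v \<in> ?V" for v using that by auto
  have "4 ^ n * chi (P, id_string) = - \<i> * (2 ^ n * h P * 2 ^ n) - S"
    using coeff_extract_chi[OF chi P(1) id_string_mem] coeff_extract_lindblad[OF L P(1) id_string_mem] P ne
    by (simp add: mtrace_pauli sum_negf S_def cong: sum.cong)
  moreover have "4 ^ n * chi (id_string, P) = \<i> * (2 ^ n * h P * 2 ^ n) - S"
  proof -
    have "mtrace (?p (snd v) * ?p (fst v) * ?p P) = mtrace (?p P * (?p (snd v) * ?p (fst v)))" for v
      by (rule mtrace_comm[of _ "2 ^ n"]) auto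
    then show ?thesis
      using coeff_extract_chi[OF chi id_string_mem P(1)] coeff_extract_lindblad[OF L id_string_mem P(1)] P ne
      by (simp add: mtrace_pauli sum_negf mult.commute S_def cong: sum.cong)
  qed
  ultimately have "4 ^ n * (chi (P, id_string) - chi (id_string, P)) =
      (- \<i> * (2 ^ n * h P * 2 ^ n) - S) - (\<i> * (2 ^ n * h P * 2 ^ n) - S)"
    by (simp only: right_diff_distrib)
  also have "\<dots> = (2 ^ n * 2 ^ n) * (- 2 * \<i> * h P)" by (simp add: algebra_simps)
  also have "(2 ^ n * 2 ^ n :: complex) = 4 ^ n" by (simp flip: power_mult_distrib)
  finally have "4 ^ n * (chi (P, id_string) - chi (id_string, P)) = 4 ^ n * (- 2 * \<i> * h P)" .
  then have "chi (P, id_string) - chi (id_string, P) = - 2 * \<i> * h P"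
    by (subst (asm) mult_left_cancel) auto
  then show "h P = \<i> / 2 * (chi (P, id_string) - chi (id_string, P))" by simp
qed

section \<open>The Hilbert-Schmidt norm and adjoint superoperators\<close>

abbreviation grid :: "nat \<Rightarrow> (nat \<times> nat) set" where
  "grid n \<equiv> {..<2 ^ n} \<times> {..<2 ^ n}"

definition hs_inner :: "complex mat \<Rightarrow> complex mat \<Rightarrow> complex" where
  "hs_inner A B = mtrace (mat_adjoint A * B)"

lemma hs_inner_eq:
  assumes "A \<in> operators n" "B \<in> operators n"
  shows "hs_inner A B = (\<Sum>ij\<in>grid n. cnj (A $$ ij) * B $$ ij)"
proof -
  have "hs_inner A B = (\<Sum>i<2 ^ n. \<Sum>j<2 ^ n. cnj (A $$ (j, i)) * B $$ (j, i))"
    unfolding hs_inner_def using assms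
    by (subst mtrace_mult[of _ "2 ^ n"]) (auto simp: mat_adjoint_index[of _ "2 ^ n" "2 ^ n"] intro!: sum.cong)
  also have "\<dots> = (\<Sum>j<2 ^ n. \<Sum>i<2 ^ n. cnj (A $$ (j, i)) * B $$ (j, i))" by (rule sum.swap)
  finally show ?thesis by (simp add: sum.cartesian_product)
qed

lemma hs_norm_eq:
  assumes "A \<in> operators n"
  shows "hs_norm A = L2_set (\<lambda>ij. cmod (A $$ ij)) (grid n)"
proof -
  have "Re (hs_inner A A) = (\<Sum>ij\<in>grid n. (cmod (A $$ ij))\<^sup>2)"
    unfolding hs_inner_eq[OF assms assms] Re_sum
    by (intro sum.cong refl) (simp only: cmod_power2, simp add: power2_eq_square)
  then show ?thesis by (simp add: hs_norm_def hs_inner_def L2_set_def)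
qed

lemma hs_norm_nonneg [simp]: "A \<in> operators n \<Longrightarrow> 0 \<le> hs_norm A"
  by (simp add: hs_norm_eq[of _ n] L2_set_nonneg)

lemma cmod_hs_inner_le:
  assumes "A \<in> operators n" "B \<in> operators n"
  shows "cmod (hs_inner A B) \<le> hs_norm A * hs_norm B"
proof -
  have "cmod (hs_inner A B) \<le> (\<Sum>ij\<in>grid n. cmod (A $$ ij) * cmod (B $$ ij))"
    unfolding hs_inner_eq[OF assms] by (rule order_trans[OF norm_sum]) (simp add: norm_mult)
  also have "\<dots> = (\<Sum>ij\<in>grid n. \<bar>cmod (A $$ ij)\<bar> * \<bar>cmod (B $$ ij)\<bar>)" by simp
  also have "\<dots> \<le> hs_norm A * hs_norm B"
    unfolding hs_norm_eq[OF assms(1)] hs_norm_eq[OF assms(2)] by (rule L2_set_mult_ineq)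
  finally show ?thesis .
qed

lemma hs_norm_triangle:
  assumes "A \<in> operators n" "B \<in> operators n"
  shows "hs_norm (A + B) \<le> hs_norm A + hs_norm B"
proof -
  have "hs_norm (A + B) = L2_set (\<lambda>ij. cmod (A $$ ij + B $$ ij)) (grid n)"
    using assms by (subst hs_norm_eq[of _ n]) (auto intro!: L2_set_cong)
  also have "\<dots> \<le> L2_set (\<lambda>ij. cmod (A $$ ij) + cmod (B $$ ij)) (grid n)"
    by (intro L2_set_mono norm_triangle_ineq) auto
  also have "\<dots> \<le> hs_norm A + hs_norm B"
    unfolding hs_norm_eq[OF assms(1)] hs_norm_eq[OF assms(2)] by (rule L2_set_triangle_ineq)
  finally show ?thesis .
qed

lemma hs_norm_smult:
  assumes "A \<in> operators n"
  shows "hs_norm (c \<cdot>\<^sub>m A) = cmod c * hs_norm A"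
proof -
  have "hs_norm (c \<cdot>\<^sub>m A) = L2_set (\<lambda>ij. cmod c * cmod (A $$ ij)) (grid n)"
    using assms by (subst hs_norm_eq[of _ n]) (auto simp: norm_mult intro!: L2_set_cong)
  then show ?thesis using assms by (simp add: L2_set_right_distrib hs_norm_eq)
qed

lemma cmod_entry_le_hs_norm:
  assumes "A \<in> operators n" "ij \<in> grid n"
  shows "cmod (A $$ ij) \<le> hs_norm A"
  unfolding hs_norm_eq[OF assms(1)] using assms(2)
  by (intro member_le_L2_set) auto

lemma hs_norm_zero [simp]: "hs_norm (0\<^sub>m (2 ^ n) (2 ^ n)) = 0"
  using hs_norm_smult[of "0\<^sub>m (2 ^ n) (2 ^ n)" n 0] by simp

lemma msum_empty [simp]: "msum n f {} = 0\<^sub>m (2 ^ n) (2 ^ n)"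
  by (rule eq_matI) (auto simp: msum_index)

lemma msum_insert:
  assumes "finite I" "a \<notin> I" "f a \<in> operators n"
  shows "msum n f (insert a I) = f a + msum n f I"
  using assms by (intro eq_matI) (auto simp: msum_index)

lemma hs_norm_msum_le:
  assumes "finite I" "\<And>a. a \<in> I \<Longrightarrow> f a \<in> operators n"
  shows "hs_norm (msum n f I) \<le> (\<Sum>a\<in>I. hs_norm (f a))"
  using assms
proof (induction I rule: finite_induct)
  case (insert a I)
  have "hs_norm (msum n f (insert a I)) \<le> hs_norm (f a) + hs_norm (msum n f I)"
    using insert by (subst msum_insert) (auto intro: hs_norm_triangle[of _ n])
  also have "\<dots> \<le> hs_norm (f a) + (\<Sum>a\<in>I. hs_norm (f a))" using insert by auto
  finally show ?case using insert by simp
qed simp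

lemma unit_mat_decomposition:
  assumes "M \<in> operators n"
  shows "M = msum n (\<lambda>ij. M $$ ij \<cdot>\<^sub>m unit_mat n ij) (grid n)"
proof (rule eq_matI)
  fix i j assume "i < dim_row (msum n (\<lambda>ij. M $$ ij \<cdot>\<^sub>m unit_mat n ij) (grid n))"
    "j < dim_col (msum n (\<lambda>ij. M $$ ij \<cdot>\<^sub>m unit_mat n ij) (grid n))"
  then have ij: "i < 2 ^ n" "j < 2 ^ n" by auto
  have "msum n (\<lambda>ij. M $$ ij \<cdot>\<^sub>m unit_mat n ij) (grid n) $$ (i, j) = (\<Sum>xy\<in>grid n. if xy = (i, j) then M $$ (i, j) else 0)"
    unfolding msum_index[OF ij] by (intro sum.cong) (use ij in \<open>auto simp: unit_mat_def\<close>)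
  also have "\<dots> = M $$ (i, j)" using ij by simp
  finally show "M $$ (i, j) = msum n (\<lambda>ij. M $$ ij \<cdot>\<^sub>m unit_mat n ij) (grid n) $$ (i, j)" ..
qed (use assms in auto)

lemma hs_inner_unit_mat:
  assumes "Y \<in> operators n" "ij \<in> grid n"
  shows "hs_inner (unit_mat n ij) Y = Y $$ ij"
proof -
  have "hs_inner (unit_mat n ij) Y = (\<Sum>xy\<in>grid n. if xy = ij then Y $$ ij else 0)"
    unfolding hs_inner_eq[OF unit_mat_carrier assms(1)]
    by (intro sum.cong) (auto simp: unit_mat_def)
  then show ?thesis using assms by simp
qed

text \<open>Superoperators are functions on matrices of every dimension, so linearity is required
  only on the operators of \<open>n\<close> qubits.\<close>

definition linear_superop :: "nat \<Rightarrow> superop \<Rightarrow> bool" where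
  "linear_superop n F \<longleftrightarrow> (\<forall>A\<in>operators n. F A \<in> operators n) \<and>
     (\<forall>A\<in>operators n. \<forall>B\<in>operators n. F (A + B) = F A + F B) \<and>
     (\<forall>A\<in>operators n. \<forall>c. F (c \<cdot>\<^sub>m A) = c \<cdot>\<^sub>m F A)"

lemma linear_superopD:
  assumes "linear_superop n F" "A \<in> operators n"
  shows "F A \<in> operators n" "B \<in> operators n \<Longrightarrow> F (A + B) = F A + F B" "F (c \<cdot>\<^sub>m A) = c \<cdot>\<^sub>m F A"
  using assms by (auto simp: linear_superop_def)

lemma linear_superop_msum:
  assumes F: "linear_superop n F" and "finite I" "\<And>a. a \<in> I \<Longrightarrow> f a \<in> operators n"
  shows "F (msum n f I) = msum n (\<lambda>a. F (f a)) I"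
  using assms(2,3)
proof (induction I rule: finite_induct)
  case empty
  have z: "0\<^sub>m (2 ^ n) (2 ^ n) = (0 :: complex) \<cdot>\<^sub>m 0\<^sub>m (2 ^ n) (2 ^ n)" by (rule eq_matI) auto
  have "F (0\<^sub>m (2 ^ n) (2 ^ n)) = 0 \<cdot>\<^sub>m F (0\<^sub>m (2 ^ n) (2 ^ n))"
    by (subst z, subst linear_superopD(3)[OF F]) auto
  also have "\<dots> = 0\<^sub>m (2 ^ n) (2 ^ n)"
    using linear_superopD(1)[OF F, of "0\<^sub>m (2 ^ n) (2 ^ n)"] by (intro eq_matI) auto
  finally show ?case by simp
next
  case (insert a I)
  then show ?case
    using linear_superopD(1)[OF F] by (simp add: msum_insert linear_superopD(2)[OF F])
qed

lemma linear_superop_funpow: "linear_superop n F \<Longrightarrow> linear_superop n (F ^^ m)"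
  by (induction m) (auto simp: linear_superop_def)

text \<open>Decomposition into matrix units gives some bound. Its size does not matter: it serves to
  make the supremum in \<open>superop_norm\<close> finite and exponential series converge.\<close>

lemma linear_superop_bounded:
  assumes F: "linear_superop n F"
  obtains c where "0 \<le> c" "\<And>M. M \<in> operators n \<Longrightarrow> hs_norm (F M) \<le> c * hs_norm M"
proof
  define c where "c = (\<Sum>ij\<in>grid n. hs_norm (F (unit_mat n ij)))"
  have o: "F (unit_mat n ij) \<in> operators n" for ij using linear_superopD(1)[OF F] by simp
  show "0 \<le> c" unfolding c_def using o by (intro sum_nonneg hs_norm_nonneg[of _ n])
  fix M assume M: "M \<in> operators n"
  have "F M = msum n (\<lambda>ij. F (M $$ ij \<cdot>\<^sub>m unit_mat n ij)) (grid n)"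
    by (subst unit_mat_decomposition[OF M], subst linear_superop_msum[OF F]) auto
  also have "\<dots> = msum n (\<lambda>ij. M $$ ij \<cdot>\<^sub>m F (unit_mat n ij)) (grid n)"
    by (simp add: linear_superopD(3)[OF F])
  finally have "hs_norm (F M) \<le> (\<Sum>ij\<in>grid n. hs_norm (M $$ ij \<cdot>\<^sub>m F (unit_mat n ij)))"
    using hs_norm_msum_le[of "grid n" "\<lambda>ij. M $$ ij \<cdot>\<^sub>m F (unit_mat n ij)" n] o by auto
  also have "\<dots> \<le> (\<Sum>ij\<in>grid n. hs_norm (F (unit_mat n ij)) * hs_norm M)"
  proof (rule sum_mono)
    fix ij assume "ij \<in> grid n"
    then show "hs_norm (M $$ ij \<cdot>\<^sub>m F (unit_mat n ij)) \<le> hs_norm (F (unit_mat n ij)) * hs_norm M"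
      unfolding hs_norm_smult[OF o] mult.commute[of "cmod _"]
      by (intro mult_left_mono cmod_entry_le_hs_norm[OF M] hs_norm_nonneg[OF o])
  qed
  also have "\<dots> = c * hs_norm M" by (simp add: c_def sum_distrib_right)
  finally show "hs_norm (F M) \<le> c * hs_norm M" .
qed

lemma superop_norm_bound:
  assumes F: "linear_superop n F" and M: "M \<in> operators n"
  shows "hs_norm (F M) \<le> superop_norm n F * hs_norm M" "0 \<le> superop_norm n F"
proof -
  obtain c where c: "0 \<le> c" "\<And>M. M \<in> operators n \<Longrightarrow> hs_norm (F M) \<le> c * hs_norm M"
    using linear_superop_bounded[OF F] by blast
  let ?U = "{M \<in> operators n. hs_norm M \<le> 1}"
  \<comment> \<open>A real supremum is informative only for a bounded set.\<close>
  have bdd: "bdd_above ((\<lambda>M. hs_norm (F M)) ` ?U)"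
  proof (rule bdd_aboveI2)
    fix M assume "M \<in> ?U"
    then show "hs_norm (F M) \<le> c"
      using c(2)[of M] mult_left_mono[of "hs_norm M" 1 c] c(1) by simp
  qed
  have up: "hs_norm (F X) \<le> superop_norm n F" if "X \<in> operators n" "hs_norm X \<le> 1" for X
    unfolding superop_norm_def using that by (intro cSUP_upper bdd) auto
  have "0 \<le> hs_norm (F (0\<^sub>m (2 ^ n) (2 ^ n)))"
    by (rule hs_norm_nonneg[of _ n], rule linear_superopD(1)[OF F]) simp
  also have "\<dots> \<le> superop_norm n F" by (rule up) auto
  finally show "0 \<le> superop_norm n F" .
  show "hs_norm (F M) \<le> superop_norm n F * hs_norm M"
  proof (cases "hs_norm M = 0")
    case True
    then show ?thesis using c(2)[OF M] by simp
  next
    case False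
    then have p: "hs_norm M > 0" using hs_norm_nonneg[OF M] by linarith
    define r where "r = complex_of_real (1 / hs_norm M)"
    have r: "cmod r = 1 / hs_norm M" using p by (simp add: r_def norm_divide)
    have "hs_norm (F (r \<cdot>\<^sub>m M)) \<le> superop_norm n F"
      using M p by (intro up) (auto simp: hs_norm_smult[OF M] r)
    then have "hs_norm (F M) / hs_norm M \<le> superop_norm n F"
      using linear_superopD(1)[OF F M] by (simp add: linear_superopD(3)[OF F M] hs_norm_smult[of _ n] r)
    then show ?thesis using p by (simp add: pos_divide_le_eq)
  qed
qed

text \<open>\<open>hs_adjoint\<close> is read off from pairings with matrix units, so those pairings
  determine it.\<close>

lemma hs_adjoint_eqI:
  assumes "Y \<in> operators n" "\<And>ij. ij \<in> grid n \<Longrightarrow> hs_inner (F (unit_mat n ij)) X = hs_inner (unit_mat n ij) Y"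
  shows "hs_adjoint n F X = Y"
proof (rule eq_matI)
  fix i j assume "i < dim_row Y" "j < dim_col Y"
  then have ij: "i < 2 ^ n" "j < 2 ^ n" using assms by auto
  then have "hs_adjoint n F X $$ (i, j) = hs_inner (F (unit_mat n (i, j))) X"
    by (simp add: hs_adjoint_def hs_inner_def unit_mat_def)
  also have "\<dots> = Y $$ (i, j)"
    using ij assms by (simp add: hs_inner_unit_mat)
  finally show "hs_adjoint n F X $$ (i, j) = Y $$ (i, j)" .
qed (use assms in \<open>auto simp: hs_adjoint_def\<close>)

lemma hs_inner_add_left:
  assumes "A \<in> operators n" "B \<in> operators n" "C \<in> operators n"
  shows "hs_inner (A + B) C = hs_inner A C + hs_inner B C"
  unfolding hs_inner_def mat_adjoint_add[OF assms(1,2)]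
    add_mult_distrib_mat[OF mat_adjoint_carrier[OF assms(1)] mat_adjoint_carrier[OF assms(2)] assms(3)]
  using assms by (intro mtrace_add[of _ "2 ^ n"]) auto

lemma hs_inner_add_right:
  assumes "A \<in> operators n" "B \<in> operators n" "C \<in> operators n"
  shows "hs_inner C (A + B) = hs_inner C A + hs_inner C B"
  unfolding hs_inner_def mult_add_distrib_mat[OF mat_adjoint_carrier[OF assms(3)] assms(1,2)]
  using assms by (intro mtrace_add[of _ "2 ^ n"]) auto

lemma hs_inner_minus_left:
  assumes "A \<in> operators n" "B \<in> operators n" "C \<in> operators n"
  shows "hs_inner (A - B) C = hs_inner A C - hs_inner B C"
  unfolding hs_inner_def mat_adjoint_minus[OF assms(1,2)]
    minus_mult_distrib_mat[OF mat_adjoint_carrier[OF assms(1)] mat_adjoint_carrier[OF assms(2)] assms(3)]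
  using assms by (intro mtrace_minus[of _ "2 ^ n"]) auto

lemma hs_inner_minus_right:
  assumes "A \<in> operators n" "B \<in> operators n" "C \<in> operators n"
  shows "hs_inner C (A - B) = hs_inner C A - hs_inner C B"
  unfolding hs_inner_def mult_minus_distrib_mat[OF mat_adjoint_carrier[OF assms(3)] assms(1,2)]
  using assms by (intro mtrace_minus[of _ "2 ^ n"]) auto

lemma hs_inner_smult_left:
  assumes "A \<in> operators n" "C \<in> operators n"
  shows "hs_inner (c \<cdot>\<^sub>m A) C = cnj c * hs_inner A C"
  unfolding hs_inner_def mat_adjoint_smult mult_smult_assoc_mat[OF mat_adjoint_carrier[OF assms(1)] assms(2)]
  using assms by (intro mtrace_smult[of _ "2 ^ n"]) auto

lemma hs_inner_smult_right:
  assumes "A \<in> operators n" "C \<in> operators n"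
  shows "hs_inner C (c \<cdot>\<^sub>m A) = c * hs_inner C A"
  unfolding hs_inner_def mult_smult_distrib[OF mat_adjoint_carrier[OF assms(2)] assms(1)]
  using assms by (intro mtrace_smult[of _ "2 ^ n"]) auto

lemma hs_inner_msum_left:
  assumes "\<And>a. a \<in> I \<Longrightarrow> f a \<in> operators n" "C \<in> operators n"
  shows "hs_inner (msum n f I) C = (\<Sum>a\<in>I. hs_inner (f a) C)"
  unfolding hs_inner_def using assms
  by (simp add: mat_adjoint_msum msum_mult_right mtrace_msum)

lemma hs_inner_msum_right:
  assumes "\<And>a. a \<in> I \<Longrightarrow> f a \<in> operators n" "C \<in> operators n"
  shows "hs_inner C (msum n f I) = (\<Sum>a\<in>I. hs_inner C (f a))"
  unfolding hs_inner_def using assms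
  by (simp add: msum_mult_left mtrace_msum)

lemma hs_inner_sandwich:
  assumes "A \<in> operators n" "B \<in> operators n" "M \<in> operators n" "X \<in> operators n"
  shows "hs_inner (A * M * B) X = hs_inner M (mat_adjoint A * X * mat_adjoint B)"
proof -
  have "hs_inner (A * M * B) X = mtrace (mat_adjoint B * (mat_adjoint M * (mat_adjoint A * X)))"
    unfolding hs_inner_def using assms
    by (simp add: mat_adjoint_mult[of _ "2 ^ n" "2 ^ n" _ "2 ^ n"] mult_assoc_square[of _ "2 ^ n"])
  also have "\<dots> = mtrace ((mat_adjoint M * (mat_adjoint A * X)) * mat_adjoint B)"
    using assms by (intro mtrace_comm[of _ "2 ^ n"]) auto
  also have "\<dots> = hs_inner M (mat_adjoint A * X * mat_adjoint B)"
    unfolding hs_inner_def using assms by (simp add: mult_assoc_square[of _ "2 ^ n"])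
  finally show ?thesis .
qed

lemma hs_norm_pauli_mat: "hs_norm (pauli_mat {..<n} P) = sqrt (2 ^ n)"
proof -
  have "mtrace (1\<^sub>m (2 ^ n) :: complex mat) = 2 ^ n" by (simp add: mtrace_def)
  then show ?thesis by (simp add: hs_norm_def pauli_mat_square)
qed

section \<open>Locality of the Heisenberg evolution\<close>

lemma linear_superop_sandwich:
  "A \<in> operators n \<Longrightarrow> B \<in> operators n \<Longrightarrow> linear_superop n (\<lambda>M. A * M * B)"
  by (auto simp: linear_superop_def mult_add_distrib_mat[of _ "2 ^ n" "2 ^ n" _ "2 ^ n"]
      add_mult_distrib_mat[of _ "2 ^ n" "2 ^ n" _ _ "2 ^ n"] mult_smult_distrib[of _ "2 ^ n" "2 ^ n" _ "2 ^ n"]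
      mult_smult_assoc_mat[of _ "2 ^ n" "2 ^ n" _ "2 ^ n"])

lemma linear_superop_add:
  assumes "linear_superop n F" "linear_superop n G"
  shows "linear_superop n (\<lambda>M. F M + G M)"
proof -
  note F = linear_superopD[OF assms(1)] and G = linear_superopD[OF assms(2)]
  have "F A + F B + (G A + G B) = F A + G A + (F B + G B)" if "A \<in> operators n" "B \<in> operators n" for A B
    using F(1)[OF that(1)] F(1)[OF that(2)] G(1)[OF that(1)] G(1)[OF that(2)] by (intro eq_matI) auto
  moreover have "c \<cdot>\<^sub>m F A + c \<cdot>\<^sub>m G A = c \<cdot>\<^sub>m (F A + G A)" if "A \<in> operators n" for A c
    using F(1)[OF that] G(1)[OF that] by (intro eq_matI) (auto simp: ring_distribs)
  ultimately show ?thesis using F G by (auto simp: linear_superop_def)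
qed

lemma linear_superop_smult:
  assumes "linear_superop n F"
  shows "linear_superop n (\<lambda>M. c \<cdot>\<^sub>m F M)"
proof -
  note F = linear_superopD[OF assms(1)]
  have "c \<cdot>\<^sub>m (F A + F B) = c \<cdot>\<^sub>m F A + c \<cdot>\<^sub>m F B" if "A \<in> operators n" "B \<in> operators n" for A B
    using F(1)[OF that(1)] F(1)[OF that(2)] by (intro eq_matI) (auto simp: ring_distribs)
  moreover have "c \<cdot>\<^sub>m (d \<cdot>\<^sub>m F A) = d \<cdot>\<^sub>m (c \<cdot>\<^sub>m F A)" if "A \<in> operators n" for A d
    using F(1)[OF that] by (intro eq_matI) auto
  ultimately show ?thesis using F by (auto simp: linear_superop_def)
qed

lemma linear_superop_cong:
  assumes "linear_superop n F" "\<And>M. M \<in> operators n \<Longrightarrow> G M = F M"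
  shows "linear_superop n G"
  using assms(1) unfolding linear_superop_def by (simp add: assms(2))

lemma linear_superop_minus:
  assumes "linear_superop n F" "linear_superop n G"
  shows "linear_superop n (\<lambda>M. F M - G M)"
proof (rule linear_superop_cong)
  show "linear_superop n (\<lambda>M. F M + (- 1) \<cdot>\<^sub>m G M)"
    by (intro linear_superop_add linear_superop_smult assms)
  show "F M - G M = F M + (- 1) \<cdot>\<^sub>m G M" if "M \<in> operators n" for M
    using linear_superopD(1)[OF assms(1) that] linear_superopD(1)[OF assms(2) that]
    by (rule minus_eq_add_smult)
qed

lemma linear_superop_msum_fun:
  assumes "\<And>a. a \<in> I \<Longrightarrow> linear_superop n (F a)"
  shows "linear_superop n (\<lambda>M. msum n (\<lambda>a. F a M) I)"
proof -
  note F = linear_superopD[OF assms]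
  have "msum n (\<lambda>a. F a (A + B)) I = msum n (\<lambda>a. F a A) I + msum n (\<lambda>a. F a B) I"
    if AB: "A \<in> operators n" "B \<in> operators n" for A B
  proof (rule eq_matI)
    fix i j assume "i < dim_row (msum n (\<lambda>a. F a A) I + msum n (\<lambda>a. F a B) I)"
      "j < dim_col (msum n (\<lambda>a. F a A) I + msum n (\<lambda>a. F a B) I)"
    then have ij: "i < 2 ^ n" "j < 2 ^ n" by auto
    have "F a (A + B) $$ (i, j) = F a A $$ (i, j) + F a B $$ (i, j)" if "a \<in> I" for a
      using F(2)[OF that AB] carrier_matD[OF F(1)[OF that AB(2)]] ij by simp
    then show "msum n (\<lambda>a. F a (A + B)) I $$ (i, j) = (msum n (\<lambda>a. F a A) I + msum n (\<lambda>a. F a B) I) $$ (i, j)"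
      using ij by (simp add: msum_index sum.distrib)
  qed auto
  moreover have "msum n (\<lambda>a. F a (c \<cdot>\<^sub>m A)) I = c \<cdot>\<^sub>m msum n (\<lambda>a. F a A) I"
    if A: "A \<in> operators n" for A c
  proof (rule eq_matI)
    fix i j assume "i < dim_row (c \<cdot>\<^sub>m msum n (\<lambda>a. F a A) I)" "j < dim_col (c \<cdot>\<^sub>m msum n (\<lambda>a. F a A) I)"
    then have ij: "i < 2 ^ n" "j < 2 ^ n" by auto
    have "F a (c \<cdot>\<^sub>m A) $$ (i, j) = c * F a A $$ (i, j)" if "a \<in> I" for a
      using F(3)[OF that A] carrier_matD[OF F(1)[OF that A]] ij by simp
    then show "msum n (\<lambda>a. F a (c \<cdot>\<^sub>m A)) I $$ (i, j) = (c \<cdot>\<^sub>m msum n (\<lambda>a. F a A) I) $$ (i, j)"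
      using ij by (simp add: msum_index sum_distrib_left)
  qed auto
  ultimately show ?thesis by (auto simp: linear_superop_def)
qed

section \<open>Lindbladians and their Heisenberg adjoints\<close>

text \<open>The index set of the jumps is arbitrary so that both the whole generator, with jumps
  indexed by edge and position, and a single local term are instances.\<close>

definition lind :: "nat \<Rightarrow> complex mat \<Rightarrow> 'a set \<Rightarrow> ('a \<Rightarrow> complex mat) \<Rightarrow> superop" where
  "lind n H I K M = ham_part H M + msum n (\<lambda>a. dissipator (K a) M) I"

definition lind_adj :: "nat \<Rightarrow> complex mat \<Rightarrow> 'a set \<Rightarrow> ('a \<Rightarrow> complex mat) \<Rightarrow> superop" where
  "lind_adj n H I K X = \<i> \<cdot>\<^sub>m (H * X - X * H) + msum n (\<lambda>a. mat_adjoint (K a) * X * K a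
     - (1/2) \<cdot>\<^sub>m anticomm (mat_adjoint (K a) * K a) X) I"

lemma mat_adjoint_one [simp]: "mat_adjoint (1\<^sub>m N :: complex mat) = 1\<^sub>m N"
  by (rule eq_matI) (auto simp: mat_adjoint_index[of _ N N])

locale lindbladian =
  fixes n :: nat and H :: "complex mat" and I :: "'a set" and K :: "'a \<Rightarrow> complex mat"
  assumes H [simp]: "H \<in> operators n" and H_adjoint: "mat_adjoint H = H"
    and finite_I [simp]: "finite I" and K [simp]: "a \<in> I \<Longrightarrow> K a \<in> operators n"
begin

abbreviation F where "F \<equiv> lind n H I K"

text \<open>With every term in the form A M B, linearity and the adjoint follow from the rules for a
  single sandwich.\<close>

lemma lind_sandwich:
  assumes "M \<in> operators n"
  shows "F M = (- \<i>) \<cdot>\<^sub>m (H * M * 1\<^sub>m (2 ^ n) - 1\<^sub>m (2 ^ n) * M * H) +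
    msum n (\<lambda>a. K a * M * mat_adjoint (K a) - (1/2) \<cdot>\<^sub>m
      ((mat_adjoint (K a) * K a) * M * 1\<^sub>m (2 ^ n) + 1\<^sub>m (2 ^ n) * M * (mat_adjoint (K a) * K a))) I"
  using assms unfolding lind_def ham_part_def dissipator_def anticomm_def
  by (intro arg_cong2[where f = "(+)"] msum_cong) auto

lemma lind_adj_sandwich:
  assumes "M \<in> operators n"
  shows "lind_adj n H I K M = \<i> \<cdot>\<^sub>m (H * M * 1\<^sub>m (2 ^ n) - 1\<^sub>m (2 ^ n) * M * H) +
    msum n (\<lambda>a. mat_adjoint (K a) * M * K a - (1/2) \<cdot>\<^sub>m
      ((mat_adjoint (K a) * K a) * M * 1\<^sub>m (2 ^ n) + 1\<^sub>m (2 ^ n) * M * (mat_adjoint (K a) * K a))) I"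
  using assms unfolding lind_adj_def anticomm_def
  by (intro arg_cong2[where f = "(+)"] msum_cong) auto

lemma linear_F: "linear_superop n F"
  by (rule linear_superop_cong[OF _ lind_sandwich])
    (intro linear_superop_add linear_superop_minus linear_superop_smult linear_superop_sandwich
      linear_superop_msum_fun; simp)

lemma linear_lind_adj: "linear_superop n (lind_adj n H I K)"
  by (rule linear_superop_cong[OF _ lind_adj_sandwich])
    (intro linear_superop_add linear_superop_minus linear_superop_smult linear_superop_sandwich
      linear_superop_msum_fun; simp)

text \<open>The adjoint of a sandwich is the sandwich by the adjoints. \<open>H\<close> and
  \<open>mat_adjoint (K a) * K a\<close> are self-adjoint, the jumps are exchanged with their
  adjoints, and the factor -i becomes i.\<close>

lemma hs_inner_lind:
  assumes M: "M \<in> operators n" and X: "X \<in> operators n"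
  shows "hs_inner (F M) X = hs_inner M (lind_adj n H I K X)"
proof -
  let ?I = "1\<^sub>m (2 ^ n) :: complex mat"
  let ?A = "\<lambda>a. mat_adjoint (K a) * K a"
  have A: "mat_adjoint (?A a) = ?A a" if "a \<in> I" for a
    using that by (simp add: mat_adjoint_mult[of _ "2 ^ n" "2 ^ n" _ "2 ^ n"])
  have h: "hs_inner ((- \<i>) \<cdot>\<^sub>m (H * M * ?I - ?I * M * H)) X = hs_inner M (\<i> \<cdot>\<^sub>m (H * X * ?I - ?I * X * H))"
    unfolding hs_inner_smult_left[OF operators_closed(3)[OF operators_closed(1)[OF operators_closed(1)[OF H M] one_carrier_mat]
        operators_closed(1)[OF operators_closed(1)[OF one_carrier_mat M] H]] X]
    using M X by (subst hs_inner_smult_right[of _ n])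
      (simp_all add: hs_inner_minus_left[of _ n] hs_inner_minus_right[of _ n] hs_inner_sandwich[of _ n] H_adjoint
        del: right_mult_one_mat left_mult_one_mat right_mult_one_mat' left_mult_one_mat')
  have d: "hs_inner (K a * M * mat_adjoint (K a) - (1/2) \<cdot>\<^sub>m (?A a * M * ?I + ?I * M * ?A a)) X
      = hs_inner M (mat_adjoint (K a) * X * K a - (1/2) \<cdot>\<^sub>m (?A a * X * ?I + ?I * X * ?A a))" if "a \<in> I" for a
    using that M X A[OF that]
    by (simp add: hs_inner_minus_left[of _ n] hs_inner_minus_right[of _ n] hs_inner_smult_left[of _ n]
        hs_inner_smult_right[of _ n] hs_inner_add_left[of _ n] hs_inner_add_right[of _ n] hs_inner_sandwich[of _ n]
        del: right_mult_one_mat left_mult_one_mat right_mult_one_mat' left_mult_one_mat')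
  show ?thesis
    unfolding lind_sandwich[OF M] lind_adj_sandwich[OF X] using M X
    by (subst hs_inner_add_left[of _ n], simp, simp, simp, subst hs_inner_add_right[of _ n], simp, simp, simp)
      (simp only: h, subst hs_inner_msum_left, simp, simp, subst hs_inner_msum_right, simp, simp, intro arg_cong2[where f = "(+)"] refl sum.cong d)
qed

lemma hs_adjoint_lind:
  assumes "X \<in> operators n"
  shows "hs_adjoint n F X = lind_adj n H I K X"
  by (rule hs_adjoint_eqI)
    (use assms linear_superopD(1)[OF linear_lind_adj] hs_inner_lind[of "unit_mat n _"] in auto)

end

section \<open>Locality expressed by commutation\<close>

text \<open>Locality as commutation with all Pauli strings off \<open>S\<close>: this form passes
  through products, sums and adjoints without writing any operator as a tensor product with an
  identity.\<close>

definition acts_within :: "nat \<Rightarrow> nat set \<Rightarrow> complex mat \<Rightarrow> bool" where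
  "acts_within n S X \<longleftrightarrow> X \<in> operators n \<and>
     (\<forall>R\<in>pauli_strings ({..<n} - S). pauli_mat {..<n} R * X = X * pauli_mat {..<n} R)"

lemma acts_within_operators: "acts_within n S X \<Longrightarrow> X \<in> operators n"
  by (simp add: acts_within_def)

lemma acts_within_mono: "acts_within n S X \<Longrightarrow> S \<subseteq> T \<Longrightarrow> acts_within n T X"
  by (auto simp: acts_within_def pauli_strings_def)

lemma acts_within_mult:
  assumes "acts_within n S X" "acts_within n S Y"
  shows "acts_within n S (X * Y)"
proof -
  let ?p = "pauli_mat {..<n}"
  have c: "X \<in> operators n" "Y \<in> operators n" using assms by (auto simp: acts_within_def)
  have "?p R * (X * Y) = X * Y * ?p R" if "R \<in> pauli_strings ({..<n} - S)" for R
  proof -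
    have "?p R * (X * Y) = (?p R * X) * Y" using c by (simp add: mult_assoc_square[of _ "2 ^ n"])
    also have "\<dots> = X * (?p R * Y)" using assms that c by (simp add: acts_within_def mult_assoc_square[of _ "2 ^ n"])
    also have "\<dots> = X * Y * ?p R" using assms that c by (simp add: acts_within_def mult_assoc_square[of _ "2 ^ n"])
    finally show ?thesis .
  qed
  then show ?thesis using c by (simp add: acts_within_def)
qed

lemma acts_within_add:
  "acts_within n S X \<Longrightarrow> acts_within n S Y \<Longrightarrow> acts_within n S (X + Y)"
  by (auto simp: acts_within_def mult_add_distrib_mat[of _ "2 ^ n" "2 ^ n" _ "2 ^ n"]
      add_mult_distrib_mat[of _ "2 ^ n" "2 ^ n" _ _ "2 ^ n"])

lemma acts_within_minus:
  "acts_within n S X \<Longrightarrow> acts_within n S Y \<Longrightarrow> acts_within n S (X - Y)"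
  by (auto simp: acts_within_def mult_minus_distrib_mat[of _ "2 ^ n" "2 ^ n" _ "2 ^ n"]
      minus_mult_distrib_mat[of _ "2 ^ n" "2 ^ n" _ _ "2 ^ n"])

lemma acts_within_smult: "acts_within n S X \<Longrightarrow> acts_within n S (c \<cdot>\<^sub>m X)"
  by (auto simp: acts_within_def mult_smult_distrib[of _ "2 ^ n" "2 ^ n" _ "2 ^ n"]
      mult_smult_assoc_mat[of _ "2 ^ n" "2 ^ n" _ "2 ^ n"])

lemma acts_within_msum:
  assumes "\<And>a. a \<in> I \<Longrightarrow> acts_within n S (f a)"
  shows "acts_within n S (msum n f I)"
proof -
  have "f a \<in> operators n" if "a \<in> I" for a using assms[OF that] by (simp add: acts_within_def)
  then show ?thesis
    using assms by (auto simp: acts_within_def msum_mult_left msum_mult_right intro!: msum_cong)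
qed

lemma acts_within_adjoint:
  assumes "acts_within n S X"
  shows "acts_within n S (mat_adjoint X)"
proof -
  have X: "X \<in> operators n" using assms by (simp add: acts_within_def)
  have "pauli_mat {..<n} R * mat_adjoint X = mat_adjoint X * pauli_mat {..<n} R"
    if "R \<in> pauli_strings ({..<n} - S)" for R
  proof -
    have "mat_adjoint (X * pauli_mat {..<n} R) = mat_adjoint (pauli_mat {..<n} R * X)"
      using assms that by (simp add: acts_within_def)
    then show ?thesis using X by (simp add: mat_adjoint_mult[of _ "2 ^ n" "2 ^ n" _ "2 ^ n"])
  qed
  then show ?thesis using X by (simp add: acts_within_def)
qed

lemma acts_within_pauli:
  assumes "supp P \<subseteq> S"
  shows "acts_within n S (pauli_mat {..<n} P)"
  using assms by (auto simp: acts_within_def supp_def pauli_strings_def intro!: pauli_mat_commute)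

lemma supported_on_acts_within:
  assumes "supported_on n e X"
  shows "acts_within n e X"
proof -
  obtain c where c: "X = msum n (\<lambda>P. c P \<cdot>\<^sub>m pauli_mat {..<n} P) (pauli_strings e)"
    using assms by (auto simp: supported_on_def)
  show ?thesis unfolding c
    by (intro acts_within_msum acts_within_smult acts_within_pauli) (auto simp: pauli_strings_def supp_def)
qed

lemma acts_within_commute:
  assumes "acts_within n S X" "supported_on n e Y" "e \<inter> S = {}" "e \<subseteq> {..<n}"
  shows "Y * X = X * Y"
proof -
  obtain c where c: "Y = msum n (\<lambda>P. c P \<cdot>\<^sub>m pauli_mat {..<n} P) (pauli_strings e)"
    using assms by (auto simp: supported_on_def)
  have X: "X \<in> operators n" using assms by (simp add: acts_within_def)
  have "pauli_mat {..<n} P * X = X * pauli_mat {..<n} P" if "P \<in> pauli_strings e" for P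
  proof -
    have "P \<in> pauli_strings ({..<n} - S)" using that assms(3,4) unfolding pauli_strings_def by blast
    then show ?thesis using assms(1) by (simp add: acts_within_def)
  qed
  then show ?thesis unfolding c using X
    by (auto simp: msum_mult_left msum_mult_right mult_smult_distrib[of _ "2 ^ n" "2 ^ n" _ "2 ^ n"]
      mult_smult_assoc_mat[of _ "2 ^ n" "2 ^ n" _ "2 ^ n"] intro!: msum_cong)
qed

lemma supported_on_adjoint:
  assumes "supported_on n e X"
  shows "supported_on n e (mat_adjoint X)"
proof -
  obtain c where c: "X = msum n (\<lambda>P. c P \<cdot>\<^sub>m pauli_mat {..<n} P) (pauli_strings e)"
    using assms by (auto simp: supported_on_def)
  have "mat_adjoint X = msum n (\<lambda>P. cnj (c P) \<cdot>\<^sub>m pauli_mat {..<n} P) (pauli_strings e)"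
    unfolding c by (simp add: mat_adjoint_msum mat_adjoint_smult)
  then show ?thesis unfolding supported_on_def by (rule exI[of _ "\<lambda>P. cnj (c P)"])
qed

lemma (in lindbladian) lind_adj_acts_within:
  assumes e: "supported_on n e H" "\<And>a. a \<in> I \<Longrightarrow> supported_on n e (K a)" and X: "acts_within n S X"
  shows "acts_within n (S \<union> e) (lind_adj n H I K X)"
proof -
  have "acts_within n (S \<union> e) X" by (rule acts_within_mono[OF X]) auto
  moreover have "acts_within n (S \<union> e) H"
    by (rule acts_within_mono[OF supported_on_acts_within[OF e(1)]]) auto
  moreover have "acts_within n (S \<union> e) (K a)" if "a \<in> I" for a
    by (rule acts_within_mono[OF supported_on_acts_within[OF e(2)[OF that]]]) auto
  ultimately show ?thesis unfolding lind_adj_def anticomm_def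
    by (intro acts_within_add acts_within_minus acts_within_smult acts_within_msum acts_within_mult acts_within_adjoint)
qed

text \<open>All operators of the term commute with \<open>X\<close>, so the jump part and the
  anticommutator part cancel. The Heisenberg picture is essential: there the jump part becomes X
  times K-dagger K, whereas the Schroedinger form would give K K-dagger.\<close>

lemma (in lindbladian) lind_adj_disjoint:
  assumes e: "supported_on n e H" "\<And>a. a \<in> I \<Longrightarrow> supported_on n e (K a)" and X: "acts_within n S X"
    and disj: "e \<inter> S = {}" "e \<subseteq> {..<n}"
  shows "lind_adj n H I K X = 0\<^sub>m (2 ^ n) (2 ^ n)"
proof -
  have Xc: "X \<in> operators n" using X by (rule acts_within_operators)
  have h: "H * X = X * H" by (rule acts_within_commute[OF X e(1) disj])
  have "mat_adjoint (K a) * X * K a - (1/2) \<cdot>\<^sub>m anticomm (mat_adjoint (K a) * K a) X = 0\<^sub>m (2 ^ n) (2 ^ n)"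
    if a: "a \<in> I" for a
  proof -
    let ?A = "mat_adjoint (K a)"
    have k: "K a * X = X * K a" "?A * X = X * ?A"
      using acts_within_commute[OF X e(2)[OF a] disj] acts_within_commute[OF X supported_on_adjoint[OF e(2)[OF a]] disj] by auto
    have 1: "?A * X * K a = X * (?A * K a)" unfolding k using a Xc by (simp add: mult_assoc_square[of _ "2 ^ n"])
    have "?A * K a * X = ?A * (X * K a)" using a Xc k(1) by (simp add: mult_assoc_square[of _ "2 ^ n"])
    also have "\<dots> = ?A * X * K a" using a Xc by (simp add: mult_assoc_square[of _ "2 ^ n"])
    finally have 2: "?A * K a * X = X * (?A * K a)" unfolding 1 .
    have "Z - (1/2) \<cdot>\<^sub>m (Z + Z) = 0\<^sub>m (2 ^ n) (2 ^ n)" if "Z \<in> operators n" for Z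
      using that by (intro eq_matI) auto
    then show ?thesis unfolding anticomm_def 1 2 using a Xc by simp
  qed
  note diss = this
  have zero: "\<i> \<cdot>\<^sub>m (Y - Y) = 0\<^sub>m (2 ^ n) (2 ^ n)" if "Y \<in> operators n" for Y
    using that by (intro eq_matI) auto
  have "\<i> \<cdot>\<^sub>m (X * H - X * H) = 0\<^sub>m (2 ^ n) (2 ^ n)" by (rule zero) (use Xc in simp)
  with diss show ?thesis
    unfolding lind_adj_def h by (intro eq_matI) (auto simp: msum_index)
qed

text \<open>Self-adjointness is preserved, and so the transfer matrix in the Pauli basis is
  real.\<close>

lemma (in lindbladian) F_adjoint:
  assumes M: "M \<in> operators n"
  shows "F (mat_adjoint M) = mat_adjoint (F M)"
proof -
  note assoc = mult_assoc_square[of _ "2 ^ n"] and adj = mat_adjoint_mult[of _ "2 ^ n" "2 ^ n" _ "2 ^ n"]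
  have h: "mat_adjoint (ham_part H M) = ham_part H (mat_adjoint M)"
  proof -
    have "mat_adjoint (ham_part H M) = \<i> \<cdot>\<^sub>m (mat_adjoint M * H - H * mat_adjoint M)"
      unfolding ham_part_def using M
      by (simp add: mat_adjoint_smult mat_adjoint_minus[of _ "2 ^ n" "2 ^ n"] adj H_adjoint)
    also have "\<i> \<cdot>\<^sub>m (A - B) = (- \<i>) \<cdot>\<^sub>m (B - A)" if "A \<in> operators n" "B \<in> operators n" for A B
      using that by (intro eq_matI) (auto simp: algebra_simps)
    then have "\<i> \<cdot>\<^sub>m (mat_adjoint M * H - H * mat_adjoint M) = ham_part H (mat_adjoint M)"
      unfolding ham_part_def using M by simp
    finally show ?thesis .
  qed
  have d: "mat_adjoint (dissipator (K a) M) = dissipator (K a) (mat_adjoint M)" if a: "a \<in> I" for a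
  proof -
    let ?A = "mat_adjoint (K a) * K a"
    have "mat_adjoint (dissipator (K a) M) =
      K a * mat_adjoint M * mat_adjoint (K a) - (1/2) \<cdot>\<^sub>m (mat_adjoint M * ?A + ?A * mat_adjoint M)"
      unfolding dissipator_def anticomm_def using M a
      by (simp add: mat_adjoint_smult mat_adjoint_minus[of _ "2 ^ n" "2 ^ n"] mat_adjoint_add[of _ "2 ^ n" "2 ^ n"] adj assoc)
    also have "mat_adjoint M * ?A + ?A * mat_adjoint M = ?A * mat_adjoint M + mat_adjoint M * ?A"
      using M a by (intro comm_add_mat[of _ "2 ^ n" "2 ^ n"]) auto
    finally show ?thesis by (simp add: dissipator_def anticomm_def)
  qed
  have c: "ham_part H M \<in> operators n" "dissipator (K a) M \<in> operators n" if "a \<in> I" for a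
    using M that by (auto simp: ham_part_def dissipator_def anticomm_def)
  have c1: "ham_part H M \<in> operators n" using M by (simp add: ham_part_def)
  show ?thesis
    unfolding lind_def mat_adjoint_add[OF c1 msum_carrier] h
    using c(2) d by (simp add: mat_adjoint_msum cong: msum_cong)
qed

lemma (in lindbladian) mtrace_F:
  assumes M: "M \<in> operators n"
  shows "mtrace (F M) = 0"
proof -
  have "mtrace (ham_part H M) = 0"
    unfolding ham_part_def using M mtrace_comm[of H "2 ^ n" M]
    by (simp add: mtrace_smult[of _ "2 ^ n"] mtrace_minus[of _ "2 ^ n"])
  moreover have "mtrace (dissipator (K a) M) = 0" if a: "a \<in> I" for a
  proof -
    let ?A = "mat_adjoint (K a) * K a"
    have "mtrace (K a * M * mat_adjoint (K a)) = mtrace (mat_adjoint (K a) * (K a * M))"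
      using a M by (intro mtrace_comm[of _ "2 ^ n"]) auto
    then have 1: "mtrace (K a * M * mat_adjoint (K a)) = mtrace (?A * M)"
      using a M by (simp add: mult_assoc_square[of _ "2 ^ n"])
    have 2: "mtrace (M * ?A) = mtrace (?A * M)" using a M by (intro mtrace_comm[of _ "2 ^ n"]) auto
    show ?thesis
      unfolding dissipator_def anticomm_def using a M
      by (subst mtrace_minus[of _ "2 ^ n"]) (simp_all add: mtrace_smult[of _ "2 ^ n"] mtrace_add[of _ "2 ^ n"] 1 2)
  qed
  moreover have "ham_part H M \<in> operators n" "\<And>a. a \<in> I \<Longrightarrow> dissipator (K a) M \<in> operators n"
    using M by (auto simp: ham_part_def dissipator_def anticomm_def)
  ultimately show ?thesis
    unfolding lind_def by (subst mtrace_add[of _ "2 ^ n"]) (auto simp: mtrace_msum)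
qed

lemma (in lindbladian) hs_inner_F_funpow:
  assumes "M \<in> operators n" "X \<in> operators n"
  shows "hs_inner ((F ^^ m) M) X = hs_inner M ((lind_adj n H I K ^^ m) X)"
  using assms
proof (induction m arbitrary: X)
  case (Suc m)
  have "hs_inner ((F ^^ Suc m) M) X = hs_inner ((F ^^ m) M) (lind_adj n H I K X)"
    using Suc.prems linear_superopD(1)[OF linear_superop_funpow[OF linear_F]] by (simp add: hs_inner_lind)
  also have "\<dots> = hs_inner M ((lind_adj n H I K ^^ m) (lind_adj n H I K X))"
    using Suc linear_superopD(1)[OF linear_lind_adj] by simp
  finally show ?case by (simp add: funpow_swap1)
qed simp

section \<open>Local generators\<close>

lemma finite_edges [simp]: "finite (edges n k)"
  by (rule finite_subset[of _ "Pow {..<n}"]) (auto simp: edges_def)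

definition total_ham :: "nat \<Rightarrow> nat \<Rightarrow> (pstring \<Rightarrow> complex) \<Rightarrow> complex mat" where
  "total_ham n k h = ham_mat n h {P \<in> pauli_strings {..<n}. wt P \<le> k}"

definition jump_index :: "nat \<Rightarrow> nat \<Rightarrow> (nat set \<Rightarrow> complex mat list) \<Rightarrow> (nat set \<times> nat) set" where
  "jump_index n k J = (SIGMA e:edges n k. {..<length (J e)})"

definition jump :: "(nat set \<Rightarrow> complex mat list) \<Rightarrow> nat set \<times> nat \<Rightarrow> complex mat" where
  "jump J u = J (fst u) ! snd u"

definition local_ham :: "nat \<Rightarrow> (pstring \<Rightarrow> complex) \<Rightarrow> nat set \<Rightarrow> complex mat" where
  "local_ham n h e = ham_mat n h {P \<in> pauli_strings {..<n}. supp P = e}"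

lemma generator_eq_lind: "generator n k h J = lind n (total_ham n k h) (jump_index n k J) (jump J)"
proof
  fix M
  have "msum n (\<lambda>e. dissipative_part n (J e) M) (edges n k) = msum n (\<lambda>a. dissipator (jump J a) M) (jump_index n k J)"
    by (rule eq_matI) (auto simp: msum_index dissipative_part_def jump_def jump_index_def sum.Sigma case_prod_unfold)
  then show "generator n k h J M = lind n (total_ham n k h) (jump_index n k J) (jump J) M"
    by (simp add: generator_def lind_def total_ham_def)
qed

lemma local_generator_eq_lind: "local_generator n h J e = lind n (local_ham n h e) {..<length (J e)} ((!) (J e))"
  by (rule ext) (simp add: local_generator_def lind_def local_ham_def dissipative_part_def)

text \<open>Tracing the self-adjoint Hamiltonian against P shows that its coefficients are real;
  hence each local part of it is self-adjoint by itself.\<close>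

lemma local_data_real:
  assumes "local_data n k h J" "P \<in> pauli_strings {..<n}"
  shows "cnj (h P) = h P"
proof -
  let ?H = "ham_mat n h (pauli_strings {..<n})" and ?p = "pauli_mat {..<n} P"
  have "cnj (2 ^ n * h P) = mtrace (mat_adjoint (?p * ?H))"
    using assms by (subst mtrace_adjoint[of _ "2 ^ n"]) (auto simp: mtrace_pauli_ham_mat)
  also have "\<dots> = mtrace (?H * ?p)"
    using assms by (simp add: mat_adjoint_mult[of _ "2 ^ n" "2 ^ n" _ "2 ^ n"] local_data_def)
  also have "\<dots> = 2 ^ n * h P"
    using assms by (subst mtrace_comm[of _ "2 ^ n"]) (auto simp: mtrace_pauli_ham_mat)
  finally show ?thesis by simp
qed

lemma mat_adjoint_ham_mat:
  assumes "local_data n k h J" "A \<subseteq> pauli_strings {..<n}"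
  shows "mat_adjoint (ham_mat n h A) = ham_mat n h A"
  using assms local_data_real[OF assms(1)] unfolding ham_mat_def
  by (auto simp: mat_adjoint_msum mat_adjoint_smult intro!: msum_cong)

lemma
  assumes L: "local_data n k h J"
  shows lindbladian_total: "lindbladian n (total_ham n k h) (jump_index n k J) (jump J)"
    and lindbladian_local: "e \<in> edges n k \<Longrightarrow> lindbladian n (local_ham n h e) {..<length (J e)} ((!) (J e))"
proof -
  have J: "M \<in> operators n" if "e \<in> edges n k" "M \<in> set (J e)" for e M
    using L that by (auto simp: local_data_def)
  note adj = mat_adjoint_ham_mat[OF L]
  show "lindbladian n (total_ham n k h) (jump_index n k J) (jump J)"
    by unfold_locales (auto simp: total_ham_def jump_index_def jump_def intro!: adj J)
  show "lindbladian n (local_ham n h e) {..<length (J e)} ((!) (J e))" if "e \<in> edges n k"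
    by unfold_locales (use that in \<open>auto simp: local_ham_def intro!: adj J\<close>)
qed

text \<open>\<open>supported_on\<close> asks for coefficients on all strings on \<open>e\<close>;
  those of smaller support receive zero.\<close>

lemma local_ham_supported: "e \<subseteq> {..<n} \<Longrightarrow> supported_on n e (local_ham n h e)"
  unfolding supported_on_def
proof (intro exI)
  assume e: "e \<subseteq> {..<n}"
  have "(\<Sum>P\<in>{P \<in> pauli_strings {..<n}. supp P = e}. h P * pauli_mat {..<n} P $$ ij) =
    (\<Sum>P\<in>pauli_strings e. (if supp P = e then h P else 0) * pauli_mat {..<n} P $$ ij)" for ij
    using e finite_pauli_strings[OF finite_subset[OF e finite_lessThan]]
    by (intro sum.mono_neutral_cong_left) (auto simp: pauli_strings_def supp_def)
  then show "local_ham n h e = msum n (\<lambda>P. (if supp P = e then h P else 0) \<cdot>\<^sub>m pauli_mat {..<n} P) (pauli_strings e)"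
    unfolding local_ham_def ham_mat_def by (intro eq_matI) (simp_all add: msum_index)
qed

lemma ham_mat_grouped:
  assumes "finite E" "finite A" "supp ` A \<subseteq> E"
  shows "ham_mat n h A = msum n (\<lambda>e. ham_mat n h {P \<in> A. supp P = e}) E"
  unfolding ham_mat_def
  by (rule eq_matI) (simp_all add: msum_index sum.group[OF assms(2,1,3)])

text \<open>The support of a string of weight at most \<open>k\<close> is an edge, so grouping by
  support splits the Hamiltonian; the jumps are listed per edge from the start.\<close>

lemma generator_eq_sum_local:
  assumes M: "M \<in> operators n"
  shows "generator n k h J M = msum n (\<lambda>e. local_generator n h J e M) (edges n k)"
proof -
  let ?A = "{P \<in> pauli_strings {..<n}. wt P \<le> k}"
  have sub: "supp ` ?A \<subseteq> edges n k"
    by (auto simp: edges_def supp_def wt_def pauli_strings_def)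
  have "local_ham n h e = ham_mat n h {P \<in> ?A. supp P = e}" if "e \<in> edges n k" for e
    using that unfolding local_ham_def by (intro arg_cong[where f = "ham_mat n h"]) (auto simp: edges_def wt_def)
  then have H: "total_ham n k h = msum n (local_ham n h) (edges n k)"
    unfolding total_ham_def by (subst ham_mat_grouped[OF finite_edges _ sub]) (auto intro!: msum_cong)
  have lo: "local_ham n h e \<in> operators n" for e by (simp add: local_ham_def)
  have "ham_part (total_ham n k h) M = msum n (\<lambda>e. ham_part (local_ham n h e) M) (edges n k)"
    unfolding H ham_part_def using M lo
    by (intro eq_matI)
      (auto simp: msum_mult_left msum_mult_right msum_index sum_distrib_left sum_subtractf sum_negf carrier_matD[OF lo] algebra_simps
        simp del: index_mult_mat(1))
  moreover have "ham_part (local_ham n h e) M \<in> operators n" for e using M lo by (auto simp: ham_part_def)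
  moreover have "dissipative_part n (J e) M \<in> operators n" for e by (simp add: dissipative_part_def)
  ultimately show ?thesis
    unfolding generator_def total_ham_def[symmetric]
    by (intro eq_matI) (auto simp: msum_index sum.distrib local_generator_def local_ham_def carrier_matD[of "dissipative_part n _ M" "2 ^ n" "2 ^ n"])
qed

context
  fixes n k :: nat and h :: "pstring \<Rightarrow> complex" and J :: "nat set \<Rightarrow> complex mat list" and \<alpha> :: real
  assumes L: "local_data n k h J" and alpha: "interaction_strength n k h J \<le> \<alpha>" and n: "0 < n"
begin

abbreviation (input) heis where "heis \<equiv> lind_adj n (total_ham n k h) (jump_index n k J) (jump J)"

abbreviation (input) heis_local where
  "heis_local e \<equiv> lind_adj n (local_ham n h e) {..<length (J e)} ((!) (J e))"

abbreviation (input) strength where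
  "strength e \<equiv> superop_norm n (hs_adjoint n (local_generator n h J e))"

lemma heis_eq_sum_local:
  assumes X: "X \<in> operators n"
  shows "heis X = msum n (\<lambda>e. heis_local e X) (edges n k)"
proof -
  interpret tot: lindbladian n "total_ham n k h" "jump_index n k J" "jump J" by (rule lindbladian_total[OF L])
  have "heis X = hs_adjoint n (generator n k h J) X"
    unfolding generator_eq_lind by (rule tot.hs_adjoint_lind[OF X, symmetric])
  also have "\<dots> = msum n (\<lambda>e. heis_local e X) (edges n k)"
  proof (rule hs_adjoint_eqI)
    fix ij assume "ij \<in> grid n"
    let ?E = "unit_mat n ij"
    have loc: "local_generator n h J e ?E \<in> operators n"
      "hs_inner (local_generator n h J e ?E) X = hs_inner ?E (heis_local e X)" "heis_local e X \<in> operators n"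
      if "e \<in> edges n k" for e
    proof -
      interpret l: lindbladian n "local_ham n h e" "{..<length (J e)}" "(!) (J e)" by (rule lindbladian_local[OF L that])
      show "local_generator n h J e ?E \<in> operators n"
        unfolding local_generator_eq_lind by (rule linear_superopD(1)[OF l.linear_F unit_mat_carrier])
      show "hs_inner (local_generator n h J e ?E) X = hs_inner ?E (heis_local e X)"
        unfolding local_generator_eq_lind by (rule l.hs_inner_lind[OF unit_mat_carrier X])
      show "heis_local e X \<in> operators n" by (rule linear_superopD(1)[OF l.linear_lind_adj X])
    qed
    have "hs_inner (generator n k h J ?E) X = (\<Sum>e\<in>edges n k. hs_inner (local_generator n h J e ?E) X)"
      by (subst generator_eq_sum_local[OF unit_mat_carrier], rule hs_inner_msum_left[OF loc(1) X])
    also have "\<dots> = (\<Sum>e\<in>edges n k. hs_inner ?E (heis_local e X))"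
      by (rule sum.cong[OF refl loc(2)])
    also have "\<dots> = hs_inner ?E (msum n (\<lambda>e. heis_local e X) (edges n k))"
      by (rule hs_inner_msum_right[OF loc(3) unit_mat_carrier, symmetric])
    finally show "hs_inner (generator n k h J ?E) X = hs_inner ?E (msum n (\<lambda>e. heis_local e X) (edges n k))" .
  qed simp
  finally show ?thesis .
qed

lemma strength_nonneg:
  assumes e: "e \<in> edges n k"
  shows "0 \<le> strength e"
    and "X \<in> operators n \<Longrightarrow> hs_norm (heis_local e X) \<le> strength e * hs_norm X"
proof -
  interpret l: lindbladian n "local_ham n h e" "{..<length (J e)}" "(!) (J e)" by (rule lindbladian_local[OF L e])
  have adj: "hs_adjoint n (local_generator n h J e) X = heis_local e X" if "X \<in> operators n" for X
    unfolding local_generator_eq_lind by (rule l.hs_adjoint_lind[OF that])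
  have lin: "linear_superop n (hs_adjoint n (local_generator n h J e))"
    by (rule linear_superop_cong[OF l.linear_lind_adj adj])
  show "0 \<le> strength e" using superop_norm_bound(2)[OF lin msum_carrier] .
  show "hs_norm (heis_local e X) \<le> strength e * hs_norm X" if "X \<in> operators n"
    using superop_norm_bound(1)[OF lin that] adj[OF that] by simp
qed

text \<open>A term touching \<open>S\<close> is charged to every qubit of \<open>S\<close> that it
  contains, hence at least once, and the charges to one qubit add up to at most \<alpha>.\<close>

lemma sum_strength_le:
  assumes "S \<subseteq> {..<n}"
  shows "(\<Sum>e\<in>{e \<in> edges n k. e \<inter> S \<noteq> {}}. strength e) \<le> \<alpha> * card S"
proof -
  have fin: "finite S" using assms finite_subset by blast
  have "(\<Sum>e\<in>{e \<in> edges n k. e \<inter> S \<noteq> {}}. strength e) \<le> (\<Sum>e\<in>edges n k. \<Sum>u\<in>S. if u \<in> e then strength e else 0)"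
    unfolding sum.inter_filter[OF finite_edges]
  proof (rule sum_mono)
    fix e assume e: "e \<in> edges n k"
    have nn: "0 \<le> (if u \<in> e then strength e else 0)" for u using strength_nonneg(1)[OF e] by simp
    show "(if e \<inter> S \<noteq> {} then strength e else 0) \<le> (\<Sum>u\<in>S. if u \<in> e then strength e else 0)"
    proof (cases "e \<inter> S = {}")
      case False
      then obtain u where "u \<in> e" "u \<in> S" by auto
      then show ?thesis using member_le_sum[of u S "\<lambda>u. if u \<in> e then strength e else 0"] nn fin by auto
    qed (simp add: sum_nonneg nn)
  qed
  also have "\<dots> = (\<Sum>u\<in>S. \<Sum>e\<in>{e \<in> edges n k. u \<in> e}. strength e)"
    unfolding sum.inter_filter[OF finite_edges] by (rule sum.swap)
  also have "\<dots> \<le> (\<Sum>u\<in>S. \<alpha>)"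
  proof (rule sum_mono)
    fix u assume "u \<in> S"
    then have "(\<Sum>e\<in>{e \<in> edges n k. u \<in> e}. strength e) \<le> interaction_strength n k h J"
      unfolding interaction_strength_def using assms by (intro Max_ge) auto
    with alpha show "(\<Sum>e\<in>{e \<in> edges n k. u \<in> e}. strength e) \<le> \<alpha>" by linarith
  qed
  finally show ?thesis by (simp add: mult.commute)
qed

lemma alpha_nonneg: "0 \<le> \<alpha>"
proof -
  have "0 \<le> (\<Sum>e\<in>{e \<in> edges n k. e \<inter> {0} \<noteq> {}}. strength e)"
    by (intro sum_nonneg strength_nonneg) auto
  also have "\<dots> \<le> \<alpha>" using sum_strength_le[of "{0}"] n by simp
  finally show ?thesis .
qed

text \<open>
  Expanding the powers of the adjoint generator into local terms, the support of an operator
  grows by at most \<open>k\<close> per step and only terms touching the current support survive.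
\<close>

lemma heis_funpow_bound:
  assumes "acts_within n S X" "S \<subseteq> {..<n}"
  shows "hs_norm ((heis ^^ m) X) \<le> \<alpha> ^ m * (\<Prod>i<m. real (card S + i * k)) * hs_norm X"
  using assms
proof (induction m arbitrary: S X)
  case (Suc m)
  interpret tot: lindbladian n "total_ham n k h" "jump_index n k J" "jump J" by (rule lindbladian_total[OF L])
  have X: "X \<in> operators n" using Suc.prems by (simp add: acts_within_def)
  have fin: "finite S" using Suc.prems finite_subset by blast
  have lin: "linear_superop n (heis ^^ m)" by (intro linear_superop_funpow tot.linear_lind_adj)
  let ?E = "{e \<in> edges n k. e \<inter> S \<noteq> {}}"
  let ?c = "\<alpha> ^ m * (\<Prod>i<m. real (card S + Suc i * k)) * hs_norm X"
  have loc: "heis_local e X \<in> operators n" "acts_within n (S \<union> e) (heis_local e X)"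
    "e \<inter> S = {} \<Longrightarrow> heis_local e X = 0\<^sub>m (2 ^ n) (2 ^ n)" if e: "e \<in> edges n k" for e
  proof -
    interpret l: lindbladian n "local_ham n h e" "{..<length (J e)}" "(!) (J e)" by (rule lindbladian_local[OF L e])
    have en: "e \<subseteq> {..<n}" using e by (simp add: edges_def)
    have s: "supported_on n e (local_ham n h e)" "\<And>a. a \<in> {..<length (J e)} \<Longrightarrow> supported_on n e (J e ! a)"
      using local_ham_supported[OF en] L e by (auto simp: local_data_def)
    show "heis_local e X \<in> operators n" using linear_superopD(1)[OF l.linear_lind_adj X] .
    show "acts_within n (S \<union> e) (heis_local e X)" by (rule l.lind_adj_acts_within[OF s Suc.prems(1)])
    show "e \<inter> S = {} \<Longrightarrow> heis_local e X = 0\<^sub>m (2 ^ n) (2 ^ n)" by (rule l.lind_adj_disjoint[OF s Suc.prems(1) _ en])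
  qed
  have step: "hs_norm ((heis ^^ m) (heis_local e X)) \<le> strength e * ?c" if e: "e \<in> edges n k" for e
  proof -
    have en: "e \<subseteq> {..<n}" "card e \<le> k" using e by (auto simp: edges_def)
    \<comment> \<open>A local term adds at most \<open>k\<close> qubits, which replaces
      \<open>i\<close> by \<open>Suc i\<close> in the product; the remaining factor
      \<open>card S\<close> comes from summing the strengths.\<close>
    have "card (S \<union> e) \<le> card S + k" using card_Un_le[of S e] en(2) by linarith
    then have "(\<Prod>i<m. real (card (S \<union> e) + i * k)) \<le> (\<Prod>i<m. real (card S + Suc i * k))"
      by (intro prod_mono conjI of_nat_0_le_iff of_nat_mono) simp
    then have le: "\<alpha> ^ m * (\<Prod>i<m. real (card (S \<union> e) + i * k)) \<le> \<alpha> ^ m * (\<Prod>i<m. real (card S + Suc i * k))"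
      by (rule mult_left_mono) (rule zero_le_power[OF alpha_nonneg])
    have "S \<union> e \<subseteq> {..<n}" using Suc.prems(2) en(1) by blast
    then have "hs_norm ((heis ^^ m) (heis_local e X)) \<le>
        \<alpha> ^ m * (\<Prod>i<m. real (card (S \<union> e) + i * k)) * hs_norm (heis_local e X)"
      by (rule Suc.IH[OF loc(2)[OF e]])
    also have "\<dots> \<le> \<alpha> ^ m * (\<Prod>i<m. real (card S + Suc i * k)) * hs_norm (heis_local e X)"
      by (rule mult_right_mono[OF le hs_norm_nonneg[OF loc(1)[OF e]]])
    also have "\<dots> \<le> \<alpha> ^ m * (\<Prod>i<m. real (card S + Suc i * k)) * (strength e * hs_norm X)"
      using strength_nonneg(2)[OF e X] alpha_nonneg
      by (intro mult_left_mono mult_nonneg_nonneg prod_nonneg zero_le_power) auto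
    finally show ?thesis by (simp only: mult_ac)
  qed
  have z: "(heis ^^ m) (0\<^sub>m (2 ^ n) (2 ^ n)) = 0\<^sub>m (2 ^ n) (2 ^ n)"
    using linear_superop_msum[OF lin, of "{}" "\<lambda>_. 0\<^sub>m (2 ^ n) (2 ^ n)"] by simp
  \<comment> \<open>The innermost application is expanded, so that the induction hypothesis meets
    operators on the enlarged support.\<close>
  have "(heis ^^ Suc m) X = msum n (\<lambda>e. (heis ^^ m) (heis_local e X)) (edges n k)"
    unfolding funpow_Suc_right o_apply heis_eq_sum_local[OF X]
    using loc(1) by (intro linear_superop_msum[OF lin]) auto
  then have "hs_norm ((heis ^^ Suc m) X) \<le> (\<Sum>e\<in>edges n k. hs_norm ((heis ^^ m) (heis_local e X)))"
    using hs_norm_msum_le[of "edges n k" "\<lambda>e. (heis ^^ m) (heis_local e X)" n] linear_superopD(1)[OF lin] loc(1) by simp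
  also have "\<dots> = (\<Sum>e\<in>?E. hs_norm ((heis ^^ m) (heis_local e X)))"
    using loc(3) z by (intro sum.mono_neutral_right) auto
  also have "\<dots> \<le> (\<Sum>e\<in>?E. strength e * ?c)" by (intro sum_mono step) auto
  also have "\<dots> = (\<Sum>e\<in>?E. strength e) * ?c" by (simp add: sum_distrib_right)
  also have "\<dots> \<le> \<alpha> * card S * ?c"
    using sum_strength_le[OF Suc.prems(2)] alpha_nonneg X
    by (intro mult_right_mono mult_nonneg_nonneg prod_nonneg) auto
  also have "\<dots> = \<alpha> ^ Suc m * (\<Prod>i<Suc m. real (card S + i * k)) * hs_norm X"
    by (simp add: prod.lessThan_Suc_shift mult_ac
      del: prod.lessThan_Suc of_nat_add of_nat_mult mult_Suc of_nat_Suc)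
  finally show ?case .
qed simp

text \<open>Moved to the Heisenberg side, the powers act on P, whose support has at most
  \<open>k\<close> qubits, so the i-th factor is at most \<open>k * Suc i\<close>. By Cauchy-Schwarz
  the norms of P and Q, each sqrt (2 ^ n), cancel the normalization.\<close>

lemma ptm_funpow_bound:
  assumes P: "P \<in> pauli_strings {..<n}" "card (supp P) \<le> k"
  shows "cmod (ptm n (generator n k h J ^^ m) (P, Q)) \<le> (\<alpha> * k) ^ m * fact m"
proof -
  interpret tot: lindbladian n "total_ham n k h" "jump_index n k J" "jump J" by (rule lindbladian_total[OF L])
  let ?p = "pauli_mat {..<n}" and ?G = "generator n k h J"
  have lin: "linear_superop n (?G ^^ m)" "linear_superop n (heis ^^ m)"
    unfolding generator_eq_lind by (intro linear_superop_funpow tot.linear_F tot.linear_lind_adj)+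
  have c: "(?G ^^ m) (?p Q) \<in> operators n" "(heis ^^ m) (?p P) \<in> operators n"
    using linear_superopD(1)[OF lin(1)] linear_superopD(1)[OF lin(2)] by auto
  have "mtrace (?p P * (?G ^^ m) (?p Q)) = mtrace (mat_adjoint (mat_adjoint ((?G ^^ m) (?p Q)) * ?p P))"
    using c by (simp add: mat_adjoint_mult[of _ "2 ^ n" "2 ^ n" _ "2 ^ n"])
  also have "\<dots> = cnj (hs_inner ((?G ^^ m) (?p Q)) (?p P))"
    unfolding hs_inner_def using c by (intro mtrace_adjoint[of _ "2 ^ n"]) auto
  also have "\<dots> = cnj (hs_inner (?p Q) ((heis ^^ m) (?p P)))"
    unfolding generator_eq_lind using tot.hs_inner_F_funpow[of "?p Q" "?p P" m] by simp
  finally have "cmod (mtrace (?p P * (?G ^^ m) (?p Q))) = cmod (hs_inner (?p Q) ((heis ^^ m) (?p P)))" by simp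
  also have "\<dots> \<le> hs_norm (?p Q) * hs_norm ((heis ^^ m) (?p P))" using c by (intro cmod_hs_inner_le[of _ n]) auto
  also have "\<dots> \<le> sqrt (2 ^ n) * (\<alpha> ^ m * (\<Prod>i<m. real (card (supp P) + i * k)) * sqrt (2 ^ n))"
    unfolding hs_norm_pauli_mat using heis_funpow_bound[OF acts_within_pauli[OF subset_refl], of P m] P
    by (intro mult_left_mono) (auto simp: hs_norm_pauli_mat supp_def pauli_strings_def)
  also have "\<dots> = 2 ^ n * (\<alpha> ^ m * (\<Prod>i<m. real (card (supp P) + i * k)))"
    by (simp add: mult_ac flip: mult.assoc)
  also have "\<dots> \<le> 2 ^ n * (\<alpha> ^ m * (real k ^ m * fact m))"
  proof -
    have "(\<Prod>i<m. real (card (supp P) + i * k)) \<le> (\<Prod>i<m. real k * real (Suc i))"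
    proof (rule prod_mono)
      fix i
      have "real (card (supp P)) \<le> real k" using P by simp
      then show "0 \<le> real (card (supp P) + i * k) \<and> real (card (supp P) + i * k) \<le> real k * real (Suc i)"
        by (simp add: algebra_simps)
    qed
    also have "\<dots> = real k ^ m * fact m"
      by (induction m) (simp_all add: algebra_simps)
    finally show ?thesis using alpha_nonneg by (intro mult_left_mono) auto
  qed
  finally show ?thesis by (simp add: ptm_def norm_divide norm_power power_mult_distrib field_simps)
qed

end

section \<open>Exponentials of superoperators\<close>

lemma cmod_mtrace_mult_le:
  assumes "A \<in> operators n" "B \<in> operators n"
  shows "cmod (mtrace (A * B)) \<le> hs_norm (mat_adjoint A) * hs_norm B"
  using cmod_hs_inner_le[of "mat_adjoint A" n B] assms by (simp add: hs_inner_def)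

lemma hs_norm_funpow_le:
  assumes F: "linear_superop n F" and c: "0 \<le> c" "\<And>M. M \<in> operators n \<Longrightarrow> hs_norm (F M) \<le> c * hs_norm M"
    and X: "X \<in> operators n"
  shows "hs_norm ((F ^^ m) X) \<le> c ^ m * hs_norm X"
proof (induction m)
  case (Suc m)
  have "hs_norm ((F ^^ Suc m) X) \<le> c * hs_norm ((F ^^ m) X)"
    using c(2)[OF linear_superopD(1)[OF linear_superop_funpow[OF F] X]] by simp
  also have "\<dots> \<le> c * (c ^ m * hs_norm X)" by (rule mult_left_mono[OF Suc c(1)])
  finally show ?case by (simp add: mult.assoc)
qed simp

lemma exp_term_bound:
  assumes "0 \<le> t" "cmod z \<le> c ^ m * b" 
  shows "cmod (of_real (t ^ m / fact m) * z) \<le> (t * c) ^ m / fact m * b"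
proof -
  have "cmod (of_real (t ^ m / fact m) * z) = t ^ m / fact m * cmod z"
    using assms(1) by (simp add: norm_mult norm_divide norm_power)
  also have "\<dots> \<le> t ^ m / fact m * (c ^ m * b)" using assms by (intro mult_left_mono) auto
  finally show ?thesis by (simp add: power_mult_distrib)
qed

lemma summable_exp_term: "summable (\<lambda>m. (x :: real) ^ m / fact m * b)"
  using summable_exp[of x] by (intro summable_mult2) (simp add: field_simps)

lemma exp_superop_operators [simp]: "exp_superop n F t X \<in> operators n"
  by (simp add: exp_superop_def)

text \<open>The exponential is an entrywise \<open>suminf\<close>. Convergence comes from a bound on
  the powers of the superoperator, and a trace is a finite combination of entries.\<close>

lemma mtrace_exp_superop:
  assumes F: "linear_superop n F" and t: "0 \<le> t" and A: "A \<in> operators n" and X: "X \<in> operators n"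
  shows "(\<lambda>m. of_real (t ^ m / fact m) * mtrace (A * (F ^^ m) X)) sums mtrace (A * exp_superop n F t X)"
proof -
  obtain c where c: "0 \<le> c" "\<And>M. M \<in> operators n \<Longrightarrow> hs_norm (F M) \<le> c * hs_norm M"
    using linear_superop_bounded[OF F] by blast
  have o: "(F ^^ m) X \<in> operators n" for m using linear_superopD(1)[OF linear_superop_funpow[OF F] X] .
  have s: "(\<lambda>m. of_real (t ^ m / fact m) * (F ^^ m) X $$ (i, j)) sums exp_superop n F t X $$ (i, j)"
    if ij: "i < 2 ^ n" "j < 2 ^ n" for i j
  proof -
    have "cmod ((F ^^ m) X $$ (i, j)) \<le> c ^ m * hs_norm X" for m
      using cmod_entry_le_hs_norm[OF o, of "(i, j)"] hs_norm_funpow_le[OF F c X, of m] ij by (auto intro: order_trans)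
    then have "summable (\<lambda>m. of_real (t ^ m / fact m) * (F ^^ m) X $$ (i, j))"
      by (intro summable_comparison_test[OF _ summable_exp_term[of "t * c" "hs_norm X"]] exI[of _ 0] allI impI
          exp_term_bound t)
    then show ?thesis using ij by (simp add: exp_superop_def summable_sums)
  qed
  have "(\<lambda>m. \<Sum>i<2 ^ n. \<Sum>j<2 ^ n. A $$ (i, j) * (of_real (t ^ m / fact m) * (F ^^ m) X $$ (j, i))) sums
    (\<Sum>i<2 ^ n. \<Sum>j<2 ^ n. A $$ (i, j) * exp_superop n F t X $$ (j, i))"
    by (intro sums_sum sums_mult s) auto
  also have "(\<Sum>i<2 ^ n. \<Sum>j<2 ^ n. A $$ (i, j) * exp_superop n F t X $$ (j, i)) = mtrace (A * exp_superop n F t X)"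
    by (rule mtrace_mult[OF A exp_superop_operators, symmetric])
  also have "(\<lambda>m. \<Sum>i<2 ^ n. \<Sum>j<2 ^ n. A $$ (i, j) * (of_real (t ^ m / fact m) * (F ^^ m) X $$ (j, i))) =
      (\<lambda>m. of_real (t ^ m / fact m) * mtrace (A * (F ^^ m) X))"
    unfolding mtrace_mult[OF A o] sum_distrib_left by (simp only: mult_ac)
  finally show ?thesis .
qed

section \<open>The Euler scheme for the exponential\<close>

lemma sum_binomial_Suc:
  fixes f :: "nat \<Rightarrow> complex"
  shows "(\<Sum>m\<le>Suc N. of_nat (Suc N choose m) * f m) = (\<Sum>m\<le>N. of_nat (N choose m) * (f m + f (Suc m)))"
proof -
  have "(\<Sum>m\<le>Suc N. of_nat (Suc N choose m) * f m)
      = f 0 + (\<Sum>m\<le>N. (of_nat (N choose m) + of_nat (N choose Suc m)) * f (Suc m))"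
    by (subst sum.atMost_Suc_shift) (simp add: algebra_simps)
  also have "\<dots> = (\<Sum>m\<le>N. of_nat (N choose m) * f (Suc m)) + (f 0 + (\<Sum>m\<le>N. of_nat (N choose Suc m) * f (Suc m)))"
    by (simp add: distrib_right sum.distrib)
  also have "f 0 + (\<Sum>m\<le>N. of_nat (N choose Suc m) * f (Suc m)) = (\<Sum>m\<le>Suc N. of_nat (N choose m) * f m)"
    by (subst sum.atMost_Suc_shift) simp
  also have "\<dots> = (\<Sum>m\<le>N. of_nat (N choose m) * f m)" by simp
  finally show ?thesis by (simp add: distrib_left sum.distrib add.commute)
qed

lemma mtrace_mult_add:
  assumes "A \<in> operators n" "B \<in> operators n" "C \<in> operators n"
  shows "mtrace (A * (B + c \<cdot>\<^sub>m C)) = mtrace (A * B) + c * mtrace (A * C)"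
  using hs_inner_add_right[of B n "c \<cdot>\<^sub>m C" "mat_adjoint A"] hs_inner_smult_right[of C n "mat_adjoint A" c] assms
  by (simp add: hs_inner_def)

text \<open>The binomial theorem for powers of 1 + c G, tested against a fixed matrix because
  superoperators here are plain functions and not elements of a ring.\<close>

lemma mtrace_binomial:
  assumes G: "linear_superop n G" and A: "A \<in> operators n" and X: "X \<in> operators n"
  shows "mtrace (A * ((\<lambda>M. M + c \<cdot>\<^sub>m G M) ^^ N) X) = (\<Sum>m\<le>N. of_nat (N choose m) * (c ^ m * mtrace (A * (G ^^ m) X)))"
  using X
proof (induction N arbitrary: X)
  case (Suc N)
  have o: "G X \<in> operators n" "X + c \<cdot>\<^sub>m G X \<in> operators n" using Suc.prems linear_superopD(1)[OF G] by auto
  have lin: "linear_superop n (G ^^ m)" for m by (rule linear_superop_funpow[OF G])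
  have "mtrace (A * ((\<lambda>M. M + c \<cdot>\<^sub>m G M) ^^ Suc N) X) =
      (\<Sum>m\<le>N. of_nat (N choose m) * (c ^ m * mtrace (A * (G ^^ m) (X + c \<cdot>\<^sub>m G X))))"
    unfolding funpow_Suc_right o_apply using Suc.IH[OF o(2)] .
  also have "\<dots> = (\<Sum>m\<le>N. of_nat (N choose m) * (c ^ m * mtrace (A * (G ^^ m) X) + c ^ Suc m * mtrace (A * (G ^^ Suc m) X)))"
  proof (rule sum.cong[OF refl])
    fix m
    have "(G ^^ m) (X + c \<cdot>\<^sub>m G X) = (G ^^ m) X + c \<cdot>\<^sub>m (G ^^ Suc m) X"
      using linear_superopD(2)[OF lin Suc.prems, of "c \<cdot>\<^sub>m G X" m] linear_superopD(3)[OF lin o(1), of m c] o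
      by (simp add: funpow_swap1)
    then have "mtrace (A * (G ^^ m) (X + c \<cdot>\<^sub>m G X)) = mtrace (A * (G ^^ m) X) + c * mtrace (A * (G ^^ Suc m) X)"
      using mtrace_mult_add[OF A linear_superopD(1)[OF lin Suc.prems] linear_superopD(1)[OF lin Suc.prems], of m c "Suc m"]
      by (simp only:)
    then show "of_nat (N choose m) * (c ^ m * mtrace (A * (G ^^ m) (X + c \<cdot>\<^sub>m G X))) =
      of_nat (N choose m) * (c ^ m * mtrace (A * (G ^^ m) X) + c ^ Suc m * mtrace (A * (G ^^ Suc m) X))"
      by (simp only: power_Suc distrib_left mult_ac)
  qed
  also have "\<dots> = (\<Sum>m\<le>Suc N. of_nat (Suc N choose m) * (c ^ m * mtrace (A * (G ^^ m) X)))"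
    by (rule sum_binomial_Suc[symmetric])
  finally show ?case .
qed simp

lemma tendsto_choose_over_power: "(\<lambda>N. real (N choose m) * (t / real N) ^ m) \<longlonglongrightarrow> t ^ m / fact m"
proof -
  have "(\<lambda>N. (\<Prod>i<m. 1 - real i * (1 / real N)) * (t ^ m / fact m)) \<longlonglongrightarrow> (\<Prod>i<m. 1 - real i * 0) * (t ^ m / fact m)"
    by (intro tendsto_intros lim_1_over_n)
  moreover have "eventually (\<lambda>N. (\<Prod>i<m. 1 - real i * (1 / real N)) * (t ^ m / fact m) = real (N choose m) * (t / real N) ^ m) sequentially"
    using eventually_gt_at_top[of 0]
  proof eventually_elim
    case (elim N)
    have "(\<Prod>i<m. 1 - real i * (1 / real N)) = (\<Prod>i<m. (real N - real i) / real N)"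
      using elim by (intro prod.cong) (auto simp: field_simps)
    also have "\<dots> = (\<Prod>i<m. real N - real i) / real N ^ m" by (simp add: prod_dividef)
    also have "(\<Prod>i<m. real N - real i) = real (N choose m) * fact m"
      by (simp add: binomial_gbinomial gbinomial_prod_rev atLeast0LessThan)
    finally show ?case by (simp add: power_divide)
  qed
  ultimately show ?thesis using tendsto_cong by force
qed

text \<open>Uniform in \<open>N\<close>, so the terms of the exponential series dominate the
  binomial expansion.\<close>

lemma choose_over_power_le:
  assumes "0 \<le> t"
  shows "real (N choose m) * (t / real N) ^ m \<le> t ^ m / fact m"
proof (cases "N = 0")
  case False
  have "real (N choose m) * fact m \<le> real N ^ m"
    using binomial_fact_pow[of N m] by (metis of_nat_fact of_nat_le_iff of_nat_mult of_nat_power)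
  then have "real (N choose m) / real N ^ m \<le> 1 / fact m"
    using False by (simp add: field_simps)
  then have "real (N choose m) / real N ^ m * t ^ m \<le> 1 / fact m * t ^ m"
    using assms by (intro mult_right_mono) auto
  then show ?thesis by (simp add: power_divide)
qed (use assms in \<open>cases m; auto\<close>)

lemma tendsto_perturbed_funpow:
  assumes F: "linear_superop n F" and V: "linear_superop n V" and z: "z \<longlonglongrightarrow> 0"
    and A: "A \<in> operators n" and X: "X \<in> operators n"
  shows "(\<lambda>N :: nat. mtrace (A * ((\<lambda>M. F M + z N \<cdot>\<^sub>m V M) ^^ m) X)) \<longlonglongrightarrow> mtrace (A * (F ^^ m) X)"
  using X
proof (induction m arbitrary: X)
  case (Suc m)
  let ?G = "\<lambda>N M. F M + z N \<cdot>\<^sub>m V M"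
  have lin: "linear_superop n (?G N ^^ m)" for N
    by (intro linear_superop_funpow linear_superop_add linear_superop_smult F V)
  have o: "F X \<in> operators n" "V X \<in> operators n"
    using linear_superopD(1)[OF F Suc.prems] linear_superopD(1)[OF V Suc.prems] by auto
  have "(\<lambda>N. mtrace (A * (?G N ^^ m) (F X)) + z N * mtrace (A * (?G N ^^ m) (V X))) \<longlonglongrightarrow>
      mtrace (A * (F ^^ m) (F X)) + 0 * mtrace (A * (F ^^ m) (V X))"
    by (intro tendsto_intros Suc.IH o z)
  moreover have "mtrace (A * (?G N ^^ m) (F X)) + z N * mtrace (A * (?G N ^^ m) (V X)) = mtrace (A * (?G N ^^ Suc m) X)" for N
  proof -
    have "(?G N ^^ Suc m) X = (?G N ^^ m) (F X) + z N \<cdot>\<^sub>m (?G N ^^ m) (V X)"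
      unfolding funpow_Suc_right o_apply
      using linear_superopD(2)[OF lin o(1), of "z N \<cdot>\<^sub>m V X" N] linear_superopD(3)[OF lin o(2), of N "z N"] o by simp
    then show ?thesis
      using mtrace_mult_add[OF A linear_superopD(1)[OF lin o(1)] linear_superopD(1)[OF lin o(2)], of N "z N" N] by (simp only:)
  qed
  ultimately show ?case by (simp add: funpow_swap1)
qed simp

text \<open>
  A quadratic perturbation of the Euler scheme does not affect its limit; for a Lindbladian the
  perturbation makes every Euler step manifestly positive.
\<close>

lemma euler_scheme_tendsto_exp:
  assumes F: "linear_superop n F" and V: "linear_superop n V" and t: "0 \<le> t"
    and A: "A \<in> operators n" and X: "X \<in> operators n"
  shows "(\<lambda>N. mtrace (A * ((\<lambda>M. M + of_real (t / real N) \<cdot>\<^sub>m (F M + of_real (t / real N) \<cdot>\<^sub>m V M)) ^^ N) X))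
    \<longlonglongrightarrow> mtrace (A * exp_superop n F t X)"
proof -
  obtain c where c: "0 \<le> c" "\<And>M. M \<in> operators n \<Longrightarrow> hs_norm (F M) \<le> c * hs_norm M"
    using linear_superop_bounded[OF F] by blast
  obtain d where d: "0 \<le> d" "\<And>M. M \<in> operators n \<Longrightarrow> hs_norm (V M) \<le> d * hs_norm M"
    using linear_superop_bounded[OF V] by blast
  define z where "z = (\<lambda>N. complex_of_real (t / real N))"
  \<comment> \<open>One step is 1 + z N times \<open>G N\<close>, where \<open>G N\<close> tends to
    \<open>F\<close>; its N-th power expands binomially in powers of \<open>G N\<close>.\<close>
  define G where "G = (\<lambda>N M. F M + z N \<cdot>\<^sub>m V M)"
  define b where "b = hs_norm (mat_adjoint A) * hs_norm X"
  define a where "a = (\<lambda>m N. complex_of_real (real (N choose m) * (t / real N) ^ m) * mtrace (A * (G N ^^ m) X))"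
  have linG: "linear_superop n (G N)" for N
    unfolding G_def by (intro linear_superop_add linear_superop_smult F V)
  have z0: "z \<longlonglongrightarrow> 0"
  proof -
    have "(\<lambda>N. complex_of_real (t * (1 / real N))) \<longlonglongrightarrow> of_real (t * 0)"
      by (intro tendsto_intros lim_1_over_n)
    then show ?thesis by (simp add: z_def)
  qed
  have lim: "(\<lambda>N. a m N) \<longlonglongrightarrow> of_real (t ^ m / fact m) * mtrace (A * (F ^^ m) X)" for m
    unfolding a_def G_def
    by (intro tendsto_mult tendsto_of_real tendsto_choose_over_power tendsto_perturbed_funpow[OF F V z0 A X])
  \<comment> \<open>Domination is needed for large \<open>N\<close> only; there the perturbation has
    coefficient at most 1, and \<open>c + d\<close> bounds all \<open>G N\<close> at once.\<close>
  have zle: "cmod (z N) \<le> 1" if "real N \<ge> t" for N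
    using that t by (cases "N = 0") (auto simp: z_def norm_divide field_simps)
  have abound: "norm (a m N) \<le> (t * (c + d)) ^ m / fact m * b" if N: "real N \<ge> t" for m N
  proof -
    have G: "hs_norm (G N M) \<le> (c + d) * hs_norm M" if M: "M \<in> operators n" for M
    proof -
      have o: "F M \<in> operators n" "V M \<in> operators n"
        using linear_superopD(1)[OF F M] linear_superopD(1)[OF V M] by auto
      have "hs_norm (G N M) \<le> hs_norm (F M) + cmod (z N) * hs_norm (V M)"
        unfolding G_def hs_norm_smult[OF o(2), symmetric] using o by (intro hs_norm_triangle[of _ n]) auto
      also have "\<dots> \<le> c * hs_norm M + 1 * (d * hs_norm M)"
        using zle[OF N] c(2)[OF M] d(2)[OF M] hs_norm_nonneg[OF o(2)] by (intro add_mono mult_mono) auto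
      finally show ?thesis by (simp add: algebra_simps)
    qed
    have o: "(G N ^^ m) X \<in> operators n" by (rule linear_superopD(1)[OF linear_superop_funpow[OF linG] X])
    have nn: "0 \<le> c + d" using c d by simp
    have "cmod (mtrace (A * (G N ^^ m) X)) \<le> hs_norm (mat_adjoint A) * hs_norm ((G N ^^ m) X)"
      by (rule cmod_mtrace_mult_le[OF A o])
    also have "\<dots> \<le> hs_norm (mat_adjoint A) * ((c + d) ^ m * hs_norm X)"
      using hs_norm_funpow_le[OF linG nn G X, of m] A by (intro mult_left_mono hs_norm_nonneg[of _ n]) auto
    also have "\<dots> = (c + d) ^ m * b" by (simp add: b_def)
    finally have 1: "cmod (mtrace (A * (G N ^^ m) X)) \<le> (c + d) ^ m * b" .
    have nnc: "0 \<le> real (N choose m) * (t / real N) ^ m" using t by simp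
    have "norm (a m N) = (real (N choose m) * (t / real N) ^ m) * cmod (mtrace (A * (G N ^^ m) X))"
      unfolding a_def norm_mult norm_of_real using nnc by (simp only: abs_of_nonneg)
    also have "\<dots> \<le> t ^ m / fact m * ((c + d) ^ m * b)"
      using t by (intro mult_mono choose_over_power_le 1) auto
    finally show ?thesis by (simp add: power_mult_distrib)
  qed
  have ev: "eventually (\<lambda>(m, N). norm (a m N) \<le> (t * (c + d)) ^ m / fact m * b) (at_top \<times>\<^sub>F at_top)"
  proof -
    have "eventually (\<lambda>N. real N \<ge> t) at_top"
      using filterlim_real_sequentially by (simp add: filterlim_at_top)
    then have "eventually (\<lambda>x. True \<and> real (snd x) \<ge> t) (at_top \<times>\<^sub>F at_top :: (nat \<times> nat) filter)"
      by (intro eventually_prodI[where P = "\<lambda>_. True"]) auto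
    then show ?thesis by (rule eventually_mono) (simp only: case_prod_unfold abound)
  qed
  have "(\<lambda>N. \<Sum>m. a m N) \<longlonglongrightarrow> (\<Sum>m. of_real (t ^ m / fact m) * mtrace (A * (F ^^ m) X))"
    using tannerys_theorem[OF lim ev summable_exp_term sequentially_bot] by blast
  also have "(\<Sum>m. of_real (t ^ m / fact m) * mtrace (A * (F ^^ m) X)) = mtrace (A * exp_superop n F t X)"
    using mtrace_exp_superop[OF F t A X] by (simp add: sums_iff)
  also have "(\<lambda>N. \<Sum>m. a m N) = (\<lambda>N. mtrace (A * ((\<lambda>M. M + z N \<cdot>\<^sub>m G N M) ^^ N) X))"
  proof
    fix N
    have "(\<Sum>m. a m N) = (\<Sum>m\<le>N. a m N)"
      by (rule suminf_finite) (auto simp: a_def)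
    also have "\<dots> = (\<Sum>m\<le>N. of_nat (N choose m) * (z N ^ m * mtrace (A * (G N ^^ m) X)))"
      by (intro sum.cong refl) (simp add: a_def z_def mult.assoc)
    also have "\<dots> = mtrace (A * ((\<lambda>M. M + z N \<cdot>\<^sub>m G N M) ^^ N) X)"
      by (rule mtrace_binomial[OF linG A X, symmetric])
    finally show "(\<Sum>m. a m N) = mtrace (A * ((\<lambda>M. M + z N \<cdot>\<^sub>m G N M) ^^ N) X)" .
  qed
  finally show ?thesis by (simp add: G_def z_def)
qed

section \<open>Positivity and trace preservation\<close>

text \<open>Positivity is tested on traces against whole matrices \<open>B\<close>, a form that
  passes through sandwiches, sums and limits. The real part is what Born's rule in
  \<open>measure_signs\<close> reads.\<close>

definition psd :: "nat \<Rightarrow> complex mat \<Rightarrow> bool" where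
  "psd n M \<longleftrightarrow> M \<in> operators n \<and> (\<forall>B\<in>operators n. 0 \<le> Re (mtrace (mat_adjoint B * M * B)))"

lemma psd_sandwich:
  assumes "psd n M" "A \<in> operators n"
  shows "psd n (A * M * mat_adjoint A)"
  unfolding psd_def
proof (intro conjI ballI)
  have M: "M \<in> operators n" using assms by (simp add: psd_def)
  show "A * M * mat_adjoint A \<in> operators n" using M assms by simp
  fix B assume B: "B \<in> operators n"
  have "mat_adjoint B * (A * M * mat_adjoint A) * B = mat_adjoint (mat_adjoint A * B) * M * (mat_adjoint A * B)"
    using B M assms by (simp add: mat_adjoint_mult[of _ "2 ^ n" "2 ^ n" _ "2 ^ n"] mult_assoc_square[of _ "2 ^ n"])
  then show "0 \<le> Re (mtrace (mat_adjoint B * (A * M * mat_adjoint A) * B))"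
    using assms B by (simp add: psd_def)
qed

lemma psd_square: "A \<in> operators n \<Longrightarrow> psd n (A * mat_adjoint A)"
  unfolding psd_def
proof (intro conjI ballI)
  assume A: "A \<in> operators n"
  then show "A * mat_adjoint A \<in> operators n" by simp
  fix B assume B: "B \<in> operators n"
  let ?C = "mat_adjoint A * B"
  have C: "?C \<in> operators n" using A B by simp
  have "mat_adjoint B * (A * mat_adjoint A) * B = mat_adjoint ?C * ?C"
    using A B by (simp add: mat_adjoint_mult[of _ "2 ^ n" "2 ^ n" _ "2 ^ n"] mult_assoc_square[of _ "2 ^ n"])
  then have "mtrace (mat_adjoint B * (A * mat_adjoint A) * B) = (\<Sum>ij\<in>grid n. cnj (?C $$ ij) * ?C $$ ij)"
    using hs_inner_eq[OF C C] by (simp add: hs_inner_def)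
  then show "0 \<le> Re (mtrace (mat_adjoint B * (A * mat_adjoint A) * B))"
    by (simp add: sum_nonneg del: index_mult_mat(1))
qed

lemma psd_add:
  assumes "psd n M" "psd n M'"
  shows "psd n (M + M')"
proof -
  have c: "M \<in> operators n" "M' \<in> operators n" using assms by (auto simp: psd_def)
  have "mtrace (mat_adjoint B * (M + M') * B) = mtrace (mat_adjoint B * M * B) + mtrace (mat_adjoint B * M' * B)"
    if "B \<in> operators n" for B
    using that c by (simp add: mult_add_distrib_mat[of _ "2 ^ n" "2 ^ n" _ "2 ^ n"]
      add_mult_distrib_mat[of _ "2 ^ n" "2 ^ n" _ _ "2 ^ n"] mtrace_add[of _ "2 ^ n"])
  then show ?thesis using assms c by (auto simp: psd_def)
qed

lemma psd_smult:
  assumes "psd n M" "0 \<le> r"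
  shows "psd n (of_real r \<cdot>\<^sub>m M)"
proof -
  have c: "M \<in> operators n" using assms by (auto simp: psd_def)
  have "mtrace (mat_adjoint B * (of_real r \<cdot>\<^sub>m M) * B) = of_real r * mtrace (mat_adjoint B * M * B)"
    if "B \<in> operators n" for B
    using that c by (simp add: mult_smult_distrib[of _ "2 ^ n" "2 ^ n" _ "2 ^ n"]
      mult_smult_assoc_mat[of _ "2 ^ n" "2 ^ n" _ "2 ^ n"] mtrace_smult[of _ "2 ^ n"])
  then show ?thesis using assms c by (auto simp: psd_def)
qed

lemma psd_zero: "psd n (0\<^sub>m (2 ^ n) (2 ^ n))"
proof -
  have "psd n (0\<^sub>m (2 ^ n) (2 ^ n) * mat_adjoint (0\<^sub>m (2 ^ n) (2 ^ n)))" by (rule psd_square) simp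
  then show ?thesis by simp
qed

lemma psd_msum:
  assumes "finite I" "\<And>a. a \<in> I \<Longrightarrow> psd n (f a)"
  shows "psd n (msum n f I)"
  using assms
proof (induction I rule: finite_induct)
  case (insert a I)
  have "f a \<in> operators n" using insert.prems by (simp add: psd_def)
  then show ?case using insert by (simp add: msum_insert psd_add)
qed (simp add: psd_zero)

text \<open>The perturbed Euler step equals the sandwich of M by 1 + r Kt plus r times the jump
  sandwiches, hence is positive for r \<ge> 0. Its only deviation from M + r F M is r^2 V M, which
  disappears in the limit.\<close>

lemma (in lindbladian) psd_exp:
  assumes t: "0 \<le> t" and X: "psd n X"
  shows "psd n (exp_superop n F t X)"
proof -
  let ?J = "msum n (\<lambda>a. mat_adjoint (K a) * K a) I"
  \<comment> \<open>The effective non-Hermitian Hamiltonian: commutator and anticommutators together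
    are \<open>Kt * M + M * mat_adjoint Kt\<close>.\<close>
  define Kt where "Kt = (- \<i>) \<cdot>\<^sub>m H - (1/2) \<cdot>\<^sub>m ?J"
  define V where "V = (\<lambda>M. Kt * M * mat_adjoint Kt)"
  have Xc: "X \<in> operators n" using X by (simp add: psd_def)
  have Ktc: "Kt \<in> operators n" by (simp add: Kt_def)
  have linV: "linear_superop n V" unfolding V_def using Ktc by (intro linear_superop_sandwich) auto
  have adjKt: "mat_adjoint Kt = \<i> \<cdot>\<^sub>m H - (1/2) \<cdot>\<^sub>m ?J"
  proof -
    have "mat_adjoint ?J = ?J"
      by (subst mat_adjoint_msum) (auto simp: mat_adjoint_mult[of _ "2 ^ n" "2 ^ n" _ "2 ^ n"] intro!: msum_cong)
    then show ?thesis unfolding Kt_def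
      by (simp add: mat_adjoint_minus[of _ "2 ^ n" "2 ^ n"] mat_adjoint_smult H_adjoint)
  qed
  have F_eq: "F M = Kt * M + M * mat_adjoint Kt + msum n (\<lambda>a. K a * M * mat_adjoint (K a)) I"
    if M: "M \<in> operators n" for M
  proof -
    let ?A = "\<lambda>a. mat_adjoint (K a) * K a"
    have 1: "Kt * M = (- \<i>) \<cdot>\<^sub>m (H * M) - (1/2) \<cdot>\<^sub>m msum n (\<lambda>a. ?A a * M) I"
      unfolding Kt_def using M
      by (simp add: minus_mult_distrib_mat[of _ "2 ^ n" "2 ^ n" _ _ "2 ^ n"] mult_smult_assoc_mat[of _ "2 ^ n" "2 ^ n" _ "2 ^ n"] msum_mult_right)
    have 2: "M * mat_adjoint Kt = \<i> \<cdot>\<^sub>m (M * H) - (1/2) \<cdot>\<^sub>m msum n (\<lambda>a. M * ?A a) I"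
      unfolding adjKt using M
      by (simp add: mult_minus_distrib_mat[of _ "2 ^ n" "2 ^ n" _ "2 ^ n"] mult_smult_distrib[of _ "2 ^ n" "2 ^ n" _ "2 ^ n"] msum_mult_left)
    show ?thesis
    proof (rule eq_matI)
      let ?R = "Kt * M + M * mat_adjoint Kt + msum n (\<lambda>a. K a * M * mat_adjoint (K a)) I"
      fix i j assume "i < dim_row ?R" "j < dim_col ?R"
      then have ij: "i < 2 ^ n" "j < 2 ^ n" by auto
      define x y where "x = (\<lambda>a. (?A a * M) $$ (i, j))" and "y = (\<lambda>a. (M * ?A a) $$ (i, j))"
      define w where "w = (\<lambda>a. (K a * M * mat_adjoint (K a)) $$ (i, j))"
      have c: "?A a * M \<in> operators n" "M * ?A a \<in> operators n" "K a * M * mat_adjoint (K a) \<in> operators n" if "a \<in> I" for a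
        using that M by auto
      have "dissipator (K a) M $$ (i, j) = w a - (1/2) * (x a + y a)" if "a \<in> I" for a
        unfolding dissipator_def anticomm_def x_def y_def w_def using carrier_matD[OF c(1)[OF that]] carrier_matD[OF c(2)[OF that]]
          carrier_matD[OF c(3)[OF that]] ij by (simp del: index_mult_mat)
      then have "F M $$ (i, j) = - \<i> * ((H * M) $$ (i, j) - (M * H) $$ (i, j)) + (\<Sum>a\<in>I. w a - (1/2) * (x a + y a))"
        unfolding lind_def ham_part_def using M ij carrier_matD[of "H * M" "2 ^ n" "2 ^ n"] carrier_matD[of "M * H" "2 ^ n" "2 ^ n"]
        by (simp add: msum_index del: index_mult_mat)
      also have "\<dots> = - \<i> * ((H * M) $$ (i, j) - (M * H) $$ (i, j)) + ((\<Sum>a\<in>I. w a) - (1/2) * ((\<Sum>a\<in>I. x a) + (\<Sum>a\<in>I. y a)))"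
        by (simp only: sum_subtractf sum_distrib_left[symmetric] sum.distrib)
      also have "\<dots> = ?R $$ (i, j)"
        unfolding 1 2 x_def y_def w_def using M ij carrier_matD[of "H * M" "2 ^ n" "2 ^ n"] carrier_matD[of "M * H" "2 ^ n" "2 ^ n"]
        by (simp add: msum_index algebra_simps del: index_mult_mat)
      finally show "F M $$ (i, j) = ?R $$ (i, j)" .
    qed (use M linear_superopD(1)[OF linear_F M] in auto)
  qed
  have step: "M + of_real r \<cdot>\<^sub>m (F M + of_real r \<cdot>\<^sub>m V M) =
      (1\<^sub>m (2 ^ n) + of_real r \<cdot>\<^sub>m Kt) * M * mat_adjoint (1\<^sub>m (2 ^ n) + of_real r \<cdot>\<^sub>m Kt)
      + of_real r \<cdot>\<^sub>m msum n (\<lambda>a. K a * M * mat_adjoint (K a)) I" if M: "M \<in> operators n" for M r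
  proof -
    let ?r = "complex_of_real r" and ?S = "msum n (\<lambda>a. K a * M * mat_adjoint (K a)) I"
    have "(1\<^sub>m (2 ^ n) + ?r \<cdot>\<^sub>m Kt) * M * mat_adjoint (1\<^sub>m (2 ^ n) + ?r \<cdot>\<^sub>m Kt) =
        (M + ?r \<cdot>\<^sub>m (Kt * M)) * (1\<^sub>m (2 ^ n) + ?r \<cdot>\<^sub>m mat_adjoint Kt)"
      using M Ktc by (simp add: mat_adjoint_add[of _ "2 ^ n" "2 ^ n"] mat_adjoint_smult
          add_mult_distrib_mat[of _ "2 ^ n" "2 ^ n" _ _ "2 ^ n"] mult_smult_assoc_mat[of _ "2 ^ n" "2 ^ n" _ "2 ^ n"])
    also have "\<dots> = (M + ?r \<cdot>\<^sub>m (Kt * M)) + ?r \<cdot>\<^sub>m (M * mat_adjoint Kt + ?r \<cdot>\<^sub>m V M)"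
      using M Ktc by (simp add: mult_add_distrib_mat[of _ "2 ^ n" "2 ^ n" _ "2 ^ n"] V_def
          add_mult_distrib_mat[of _ "2 ^ n" "2 ^ n" _ _ "2 ^ n"] mult_smult_assoc_mat[of _ "2 ^ n" "2 ^ n" _ "2 ^ n"]
          mult_smult_distrib[of _ "2 ^ n" "2 ^ n" _ "2 ^ n"])
    finally have e: "(1\<^sub>m (2 ^ n) + ?r \<cdot>\<^sub>m Kt) * M * mat_adjoint (1\<^sub>m (2 ^ n) + ?r \<cdot>\<^sub>m Kt) =
      (M + ?r \<cdot>\<^sub>m (Kt * M)) + ?r \<cdot>\<^sub>m (M * mat_adjoint Kt + ?r \<cdot>\<^sub>m V M)" .
    have "Kt * M \<in> operators n" "M * mat_adjoint Kt \<in> operators n" "V M \<in> operators n"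
      using M Ktc by (auto simp: V_def)
    then show ?thesis unfolding e F_eq[OF M] using M
      by (intro eq_matI) (auto simp: algebra_simps simp del: index_mult_mat dest!: carrier_matD)
  qed
  have psd_step: "psd n (M + of_real r \<cdot>\<^sub>m (F M + of_real r \<cdot>\<^sub>m V M))" if "psd n M" "0 \<le> r" for M r
  proof -
    have M: "M \<in> operators n" using that by (simp add: psd_def)
    show ?thesis unfolding step[OF M] using that Ktc
      by (intro psd_add psd_sandwich psd_smult psd_msum) auto
  qed
  have iter: "psd n (((\<lambda>M. M + of_real r \<cdot>\<^sub>m (F M + of_real r \<cdot>\<^sub>m V M)) ^^ N) X)" if "0 \<le> r" for N r
    by (induction N) (use X that psd_step in auto)
  show ?thesis unfolding psd_def
  proof (intro conjI ballI)
    fix B assume B: "B \<in> operators n"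
    \<comment> \<open>Cyclicity turns the test into a trace against one fixed matrix, the form in
      which the Euler scheme converges.\<close>
    have swap: "mtrace (mat_adjoint B * M * B) = mtrace ((B * mat_adjoint B) * M)" if "M \<in> operators n" for M
      using mtrace_comm[of "mat_adjoint B * M" "2 ^ n" B] B that by (simp add: mult_assoc_square[of _ "2 ^ n"])
    let ?S = "\<lambda>N. ((\<lambda>M. M + of_real (t / real N) \<cdot>\<^sub>m (F M + of_real (t / real N) \<cdot>\<^sub>m V M)) ^^ N) X"
    have "(\<lambda>N. Re (mtrace ((B * mat_adjoint B) * ?S N))) \<longlonglongrightarrow> Re (mtrace ((B * mat_adjoint B) * exp_superop n F t X))"
      using B by (intro tendsto_Re euler_scheme_tendsto_exp linear_F linV t Xc) auto
    moreover have "0 \<le> Re (mtrace ((B * mat_adjoint B) * ?S N))" for N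
    proof -
      have p: "psd n (?S N)" by (rule iter) (use t in simp)
      then have o: "?S N \<in> operators n" unfolding psd_def by blast
      show ?thesis unfolding swap[OF o, symmetric] using p B unfolding psd_def by blast
    qed
    ultimately have "0 \<le> Re (mtrace ((B * mat_adjoint B) * exp_superop n F t X))"
      by (intro LIMSEQ_le_const) auto
    then show "0 \<le> Re (mtrace (mat_adjoint B * exp_superop n F t X * B))" using swap by simp
  qed simp
qed

lemma (in lindbladian) mtrace_exp:
  assumes t: "0 \<le> t" and X: "X \<in> operators n"
  shows "mtrace (exp_superop n F t X) = mtrace X"
proof -
  have c: "(F ^^ m) X \<in> operators n" for m
    by (rule linear_superopD(1)[OF linear_superop_funpow[OF linear_F] X])
  have "(\<lambda>m. of_real (t ^ m / fact m) * mtrace (1\<^sub>m (2 ^ n) * (F ^^ m) X)) sums mtrace (1\<^sub>m (2 ^ n) * exp_superop n F t X)"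
    by (rule mtrace_exp_superop[OF linear_F t _ X]) simp
  moreover have "of_real (t ^ m / fact m) * mtrace (1\<^sub>m (2 ^ n) * (F ^^ m) X) = (if m = 0 then mtrace X else 0)" for m
  proof (cases m)
    case (Suc l)
    then show ?thesis using mtrace_F[OF c[of l]] left_mult_one_mat[OF c[of m]] by simp
  qed (use X in simp)
  ultimately have "(\<lambda>m. if m = 0 then mtrace X else 0) sums mtrace (exp_superop n F t X)"
    using left_mult_one_mat[OF exp_superop_operators] by simp
  moreover have "(\<lambda>m. if m = 0 then mtrace X else 0) sums mtrace X"
    using sums_single[of 0 "\<lambda>_. mtrace X"] by simp
  ultimately show ?thesis by (rule sums_unique2)
qed

lemma (in lindbladian) ptm_funpow_real: "Im (ptm n (F ^^ m) (P, Q)) = 0"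
proof -
  let ?p = "pauli_mat {..<n}"
  have c: "(F ^^ m) (?p Q) \<in> operators n" for m
    by (rule linear_superopD(1)[OF linear_superop_funpow[OF linear_F]]) simp
  have "mat_adjoint ((F ^^ m) (?p Q)) = (F ^^ m) (?p Q)"
    by (induction m) (simp_all add: F_adjoint[OF c, symmetric])
  then have "mtrace (?p P * (F ^^ m) (?p Q)) = mtrace (mat_adjoint ((F ^^ m) (?p Q) * ?p P))"
    using c by (simp add: mat_adjoint_mult[of _ "2 ^ n" "2 ^ n" _ "2 ^ n"])
  also have "\<dots> = cnj (mtrace ((F ^^ m) (?p Q) * ?p P))" using c by (intro mtrace_adjoint[of _ "2 ^ n"]) auto
  also have "mtrace ((F ^^ m) (?p Q) * ?p P) = mtrace (?p P * (F ^^ m) (?p Q))"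
    using c by (intro mtrace_comm[of _ "2 ^ n"]) auto
  finally have "Im (mtrace (?p P * (F ^^ m) (?p Q))) = 0" by (metis cnj.simps(2) equal_neg_zero)
  moreover have "2 ^ n = complex_of_real (2 ^ n)" by simp
  ultimately show ?thesis unfolding ptm_def by (simp only: fst_conv snd_conv Im_divide_of_real div_0)
qed

section \<open>The distribution of one sample\<close>

definition lproj :: "pauli \<times> bool \<Rightarrow> bool \<Rightarrow> bool \<Rightarrow> complex" where
  "lproj c x y = (pauli_entry PI x y + of_real (pm_one (snd c)) * pauli_entry (fst c) x y) / 2"

lemma eigen_proj_eq: "eigen_proj n a = tensor_mat {..<n} (\<lambda>q. lproj (a q))"
  unfolding eigen_proj_def lproj_def ..

lemma eigen_proj_operators [simp]: "eigen_proj n a \<in> operators n"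
  by (simp add: eigen_proj_eq)

lemma psd_eigen_proj:
  assumes "\<And>q. q < n \<Longrightarrow> fst (a q) \<noteq> PI"
  shows "psd n (eigen_proj n a)" "mat_adjoint (eigen_proj n a) = eigen_proj n a"
    "eigen_proj n a * eigen_proj n a = eigen_proj n a"
proof -
  have "cnj (lproj c x y) = lproj c y x" for c x y
    by (simp add: lproj_def cnj_pauli_entry)
  then show adj: "mat_adjoint (eigen_proj n a) = eigen_proj n a"
    by (simp add: eigen_proj_eq mat_adjoint_tensor_mat)
  have "lmul (lproj c) (lproj c) = lproj c" if "fst c \<noteq> PI" for c
  proof (intro ext)
    fix x y
    show "lmul (lproj c) (lproj c) x y = lproj c x y"
      using that by (cases c; cases "fst c"; cases x; cases y; cases "snd c")
        (auto simp: lmul_def lproj_def pm_one_def field_simps)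
  qed
  then show sq: "eigen_proj n a * eigen_proj n a = eigen_proj n a"
    unfolding eigen_proj_eq tensor_mat_mult using assms by (intro tensor_mat_cong) auto
  show "psd n (eigen_proj n a)" using psd_square[of "eigen_proj n a" n] by (simp add: adj sq)
qed

lemma sum_tensor_mat_entry:
  assumes ij: "i < 2 ^ n" "j < 2 ^ n" and fin: "\<And>q. q < n \<Longrightarrow> finite (B q)"
  shows "(\<Sum>g\<in>PiE_dflt {..<n} d B. (\<Prod>q<n. w q (g q)) * tensor_mat {..<n} (\<lambda>q. f q (g q)) $$ (i, j)) =
    tensor_mat {..<n} (\<lambda>q x y. \<Sum>c\<in>B q. w q c * f q c x y) $$ (i, j)"
proof -
  have s: "sorted_list_of_set {..<n} ! m = m" if "m < n" for m
    using that by (simp add: lessThan_atLeast0)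
  have "(\<Sum>g\<in>PiE_dflt {..<n} d B. (\<Prod>q<n. w q (g q)) * tensor_mat {..<n} (\<lambda>q. f q (g q)) $$ (i, j)) =
    (\<Sum>g\<in>PiE_dflt {..<n} d B. \<Prod>q<n. w q (g q) * f q (g q) (bit i q) (bit j q))"
    using ij by (simp add: tensor_mat_def prod.distrib s)
  also have "\<dots> = (\<Prod>q<n. \<Sum>c\<in>B q. w q c * f q c (bit i q) (bit j q))"
    using fin by (intro sum_prod_PiE_dflt) auto
  also have "\<dots> = tensor_mat {..<n} (\<lambda>q x y. \<Sum>c\<in>B q. w q c * f q c x y) $$ (i, j)"
    using ij by (simp add: tensor_mat_def s)
  finally show ?thesis .
qed

text \<open>Entries of tensor products are products over the qubits, so sums over independent labels
  distribute. Averages over random letters and signs thereby become tensor products.\<close>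

lemma msum_tensor_mat:
  assumes "\<And>q. q < n \<Longrightarrow> finite (B q)"
  shows "msum n (\<lambda>g. (\<Prod>q<n. w q (g q)) \<cdot>\<^sub>m tensor_mat {..<n} (\<lambda>q. f q (g q))) (PiE_dflt {..<n} d B) =
    tensor_mat {..<n} (\<lambda>q x y. \<Sum>c\<in>B q. w q c * f q c x y)"
  using sum_tensor_mat_entry[where w = w and f = f and d = d, OF _ _ assms]
  by (intro eq_matI) (simp_all add: msum_index)

lemma smult_one_mat [simp]: "1 \<cdot>\<^sub>m A = (A :: complex mat)"
  by (rule eq_matI) auto

abbreviation signs :: "nat \<Rightarrow> (nat \<Rightarrow> bool) set" where
  "signs n \<equiv> PiE_dflt {..<n} True (\<lambda>_. UNIV)"

lemma finite_signs [simp]: "finite (signs n)"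
  by (intro finite_PiE_dflt) auto

definition letters :: "pauli set" where "letters = {PX, PY, PZ}"

lemma card_letters [simp]: "card letters = 3"
  by (simp add: letters_def)

lemma sum_letters: "(\<Sum>c\<in>letters. f c) = f PX + f PY + (f PZ :: 'a :: comm_monoid_add)"
  by (simp add: letters_def add.assoc)

lemma sum_eigen_proj_signs: "msum n (\<lambda>s. eigen_proj n (\<lambda>q. (b q, s q))) (signs n) = 1\<^sub>m (2 ^ n)"
proof -
  have "msum n (\<lambda>s. eigen_proj n (\<lambda>q. (b q, s q))) (signs n) =
    tensor_mat {..<n} (\<lambda>q x y. \<Sum>c\<in>UNIV. 1 * lproj (b q, c) x y)"
    using msum_tensor_mat[of n "\<lambda>_. UNIV" "\<lambda>_ _. 1" "\<lambda>q c. lproj (b q, c)" True]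
    by (simp add: eigen_proj_eq)
  also have "(\<lambda>q x y. \<Sum>c\<in>UNIV. 1 * lproj (b q, c) x y) = (\<lambda>q. pauli_entry (id_string q))"
    by (intro ext) (simp add: UNIV_bool lproj_def pm_one_def id_string_def field_simps)
  finally show ?thesis using pauli_mat_id_string[of "{..<n}"] by (simp add: pauli_mat_def)
qed

text \<open>\<open>embed_pmf\<close> has the intended values only for a genuine distribution:
  nonnegativity comes from positivity of the state, total mass one from the projectors summing to
  the identity.\<close>

lemma pmf_measure_signs:
  assumes rho: "psd n \<rho>" "mtrace \<rho> = 1" and b: "\<And>q. q < n \<Longrightarrow> b q \<noteq> PI"
  shows "pmf (measure_signs n \<rho> b) s =
    (if s \<in> signs n then Re (mtrace (eigen_proj n (\<lambda>q. (b q, s q)) * \<rho>)) else 0)"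
proof -
  let ?E = "\<lambda>s. eigen_proj n (\<lambda>q. (b q, s q))"
  let ?f = "\<lambda>s. if s \<in> signs n then Re (mtrace (?E s * \<rho>)) else 0"
  have rc: "\<rho> \<in> operators n" using rho by (simp add: psd_def)
  have nn: "0 \<le> Re (mtrace (?E s * \<rho>))" for s
  proof -
    \<comment> \<open>For a self-adjoint idempotent E, cyclicity rewrites Tr (E \<rho>) as the
      sandwich trace that \<open>psd\<close> controls.\<close>
    have E: "mat_adjoint (?E s) = ?E s" "?E s * ?E s = ?E s" using psd_eigen_proj(2,3)[of n "\<lambda>q. (b q, s q)"] b by auto
    have "mtrace (mat_adjoint (?E s) * \<rho> * ?E s) = mtrace (?E s * (?E s * \<rho>))"
      unfolding E(1) using rc by (intro mtrace_comm[of _ "2 ^ n"]) auto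
    also have "\<dots> = mtrace (?E s * \<rho>)" using rc E(2) by (simp flip: mult_assoc_square[of _ "2 ^ n"])
    finally show ?thesis using rho by (metis eigen_proj_operators psd_def)
  qed
  have "(\<Sum>s\<in>signs n. mtrace (?E s * \<rho>)) = mtrace (msum n ?E (signs n) * \<rho>)"
    using rc by (simp add: msum_mult_right mtrace_msum)
  also have "\<dots> = 1" unfolding sum_eigen_proj_signs using rc rho by simp
  finally have one: "(\<Sum>s\<in>signs n. Re (mtrace (?E s * \<rho>))) = 1" by (simp flip: Re_sum)
  have "(\<integral>\<^sup>+ s. ennreal (?f s) \<partial>count_space UNIV) = (\<Sum>s\<in>signs n. ennreal (?f s))"
    by (intro nn_integral_count_space') auto
  also have "\<dots> = ennreal (\<Sum>s\<in>signs n. Re (mtrace (?E s * \<rho>)))"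
    using nn by (subst sum_ennreal[symmetric]) (auto intro!: sum.cong)
  finally have "(\<integral>\<^sup>+ s. ennreal (?f s) \<partial>count_space UNIV) = 1" by (simp add: one)
  then show ?thesis
    unfolding measure_signs_def using nn by (subst pmf_embed_pmf) auto
qed

section \<open>Unbiasedness of the overlap estimator\<close>

text \<open>One-qubit factor of \<open>overlap_sample\<close>, equal to 1 off the support, so that
  the estimator is a product over all qubits just like the product states. It serves preparation and
  measurement alike.\<close>

definition prep_weight :: "pstring \<Rightarrow> nat \<Rightarrow> pauli \<times> bool \<Rightarrow> real" where
  "prep_weight Q q c = (if Q q = PI then 1 else if fst c = Q q then 3 * pm_one (snd c) else 0)"

lemma prod_supp_eq_prep_weight:
  assumes "Q \<in> pauli_strings {..<n}"
  shows "(\<Prod>q\<in>supp Q. if fst (a q) = Q q then 3 * pm_one (snd (a q)) else 0) = (\<Prod>q<n. prep_weight Q q (a q))"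
  using assms by (intro prod.mono_neutral_cong_left) (auto simp: supp_def prep_weight_def pauli_strings_def)

lemma sum_letters_pair: "(\<Sum>c\<in>letters \<times> (UNIV :: bool set). f c) = (\<Sum>p\<in>letters. \<Sum>s\<in>UNIV. f (p, s))"
  by (simp add: sum.cartesian_product)

text \<open>Two of the six eigenstates match a nontrivial letter; their difference with weight 3/6
  is half the Pauli matrix. For a trivial letter the six projectors sum to three times the
  identity.\<close>

lemma prep_average:
  "(\<Sum>c\<in>letters \<times> UNIV. complex_of_real (1 / 6 * prep_weight Q q c) * lproj c x y) = pauli_entry (Q q) x y / 2"
  unfolding sum_letters_pair
  by (cases "Q q") (simp_all add: sum_letters UNIV_bool prep_weight_def lproj_def pm_one_def field_simps)

text \<open>The basis matches a nontrivial letter with probability 1/3, which the weight 3 cancels;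
  the difference of the two projectors is the Pauli matrix.\<close>

lemma measure_average:
  "(\<Sum>b\<in>letters. 1 / 3 * (\<Sum>s\<in>UNIV. complex_of_real (prep_weight P q (b, s)) * lproj (b, s) x y)) = pauli_entry (P q) x y"
  by (cases "P q") (simp_all add: sum_letters UNIV_bool prep_weight_def lproj_def pm_one_def field_simps)

abbreviation preparations :: "nat \<Rightarrow> eigen_labels set" where
  "preparations n \<equiv> PiE_dflt {..<n} (PI, True) (\<lambda>_. letters \<times> UNIV)"

abbreviation bases :: "nat \<Rightarrow> pstring set" where
  "bases n \<equiv> PiE_dflt {..<n} PI (\<lambda>_. letters)"

lemma finite_letters [simp]: "finite letters" "letters \<noteq> {}"
  by (simp_all add: letters_def)

lemma finite_preparations [simp]: "finite (preparations n)" and finite_bases [simp]: "finite (bases n)"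
  by (intro finite_PiE_dflt; simp)+

lemma sum_prep_eigen_proj:
  "msum n (\<lambda>a. complex_of_real ((1 / 6) ^ n * (\<Prod>q<n. prep_weight Q q (a q))) \<cdot>\<^sub>m eigen_proj n a) (preparations n) =
    (1 / 2 ^ n) \<cdot>\<^sub>m pauli_mat {..<n} Q"
proof -
  have "msum n (\<lambda>a. complex_of_real ((1 / 6) ^ n * (\<Prod>q<n. prep_weight Q q (a q))) \<cdot>\<^sub>m eigen_proj n a) (preparations n) =
    msum n (\<lambda>a. (\<Prod>q<n. complex_of_real (1 / 6 * prep_weight Q q (a q))) \<cdot>\<^sub>m tensor_mat {..<n} (\<lambda>q. lproj (a q))) (preparations n)"
    unfolding eigen_proj_eq of_real_prod[symmetric] prod.distrib by simp
  also have "\<dots> = tensor_mat {..<n} (\<lambda>q x y. \<Sum>c\<in>letters \<times> UNIV. complex_of_real (1 / 6 * prep_weight Q q c) * lproj c x y)"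
    by (rule msum_tensor_mat) simp
  also have "\<dots> = tensor_mat {..<n} (\<lambda>q x y. pauli_entry (Q q) x y / 2)" unfolding prep_average ..
  also have "\<dots> = (1 / 2 ^ n) \<cdot>\<^sub>m pauli_mat {..<n} Q"
    by (rule eq_matI) (auto simp: tensor_mat_def pauli_mat_def prod_dividef)
  finally show ?thesis .
qed

lemma sum_measure_eigen_proj:
  "msum n (\<lambda>b. complex_of_real ((1 / 3) ^ n) \<cdot>\<^sub>m
      msum n (\<lambda>s. complex_of_real (\<Prod>q<n. prep_weight P q (b q, s q)) \<cdot>\<^sub>m eigen_proj n (\<lambda>q. (b q, s q))) (signs n)) (bases n) =
    pauli_mat {..<n} P"
proof -
  have "msum n (\<lambda>s. complex_of_real (\<Prod>q<n. prep_weight P q (b q, s q)) \<cdot>\<^sub>m eigen_proj n (\<lambda>q. (b q, s q))) (signs n) =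
    tensor_mat {..<n} (\<lambda>q x y. \<Sum>s\<in>UNIV. complex_of_real (prep_weight P q (b q, s)) * lproj (b q, s) x y)" for b
    unfolding eigen_proj_eq of_real_prod
    by (rule msum_tensor_mat[of n "\<lambda>_. UNIV" "\<lambda>q s. complex_of_real (prep_weight P q (b q, s))" "\<lambda>q s. lproj (b q, s)"]) simp
  moreover have "complex_of_real ((1 / 3) ^ n) = (\<Prod>q<n. 1 / 3)" by (simp add: power_divide)
  ultimately have "msum n (\<lambda>b. complex_of_real ((1 / 3) ^ n) \<cdot>\<^sub>m
      msum n (\<lambda>s. complex_of_real (\<Prod>q<n. prep_weight P q (b q, s q)) \<cdot>\<^sub>m eigen_proj n (\<lambda>q. (b q, s q))) (signs n)) (bases n) =
    msum n (\<lambda>b. (\<Prod>q<n. 1 / 3) \<cdot>\<^sub>m tensor_mat {..<n} (\<lambda>q x y. \<Sum>s\<in>UNIV. complex_of_real (prep_weight P q (b q, s)) * lproj (b q, s) x y)) (bases n)"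
    by (simp only:)
  also have "\<dots> = tensor_mat {..<n} (\<lambda>q x y. \<Sum>b\<in>letters. 1 / 3 * (\<Sum>s\<in>UNIV. complex_of_real (prep_weight P q (b, s)) * lproj (b, s) x y))"
    by (rule msum_tensor_mat[of n "\<lambda>_. letters" "\<lambda>_ _. 1 / 3" "\<lambda>q b x y. \<Sum>s\<in>UNIV. complex_of_real (prep_weight P q (b, s)) * lproj (b, s) x y"]) simp
  also have "\<dots> = pauli_mat {..<n} P" unfolding measure_average pauli_mat_def ..
  finally show ?thesis .
qed

lemma mtrace_exp_superop_msum:
  assumes F: "linear_superop n F" and t: "0 \<le> t" and A: "A \<in> operators n"
    and I: "finite I" "\<And>a. a \<in> I \<Longrightarrow> X a \<in> operators n"
  shows "mtrace (A * exp_superop n F t (msum n (\<lambda>a. c a \<cdot>\<^sub>m X a) I)) = (\<Sum>a\<in>I. c a * mtrace (A * exp_superop n F t (X a)))"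
proof -
  have lin: "linear_superop n (F ^^ m)" for m by (rule linear_superop_funpow[OF F])
  have "(\<lambda>m. \<Sum>a\<in>I. c a * (of_real (t ^ m / fact m) * mtrace (A * (F ^^ m) (X a)))) sums
      (\<Sum>a\<in>I. c a * mtrace (A * exp_superop n F t (X a)))"
    by (intro sums_sum sums_mult mtrace_exp_superop F t A I)
  moreover have "(\<Sum>a\<in>I. c a * (of_real (t ^ m / fact m) * mtrace (A * (F ^^ m) (X a)))) =
      of_real (t ^ m / fact m) * mtrace (A * (F ^^ m) (msum n (\<lambda>a. c a \<cdot>\<^sub>m X a) I))" for m
  proof -
    have o: "(F ^^ m) (X a) \<in> operators n" if "a \<in> I" for a using linear_superopD(1)[OF lin I(2)[OF that]] .
    have "(F ^^ m) (msum n (\<lambda>a. c a \<cdot>\<^sub>m X a) I) = msum n (\<lambda>a. (F ^^ m) (c a \<cdot>\<^sub>m X a)) I"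
      using I by (intro linear_superop_msum[OF lin]) auto
    also have "\<dots> = msum n (\<lambda>a. c a \<cdot>\<^sub>m (F ^^ m) (X a)) I"
      by (intro msum_cong linear_superopD(3)[OF lin] I)
    finally have e: "(F ^^ m) (msum n (\<lambda>a. c a \<cdot>\<^sub>m X a) I) = msum n (\<lambda>a. c a \<cdot>\<^sub>m (F ^^ m) (X a)) I" .
    have "A * msum n (\<lambda>a. c a \<cdot>\<^sub>m (F ^^ m) (X a)) I = msum n (\<lambda>a. c a \<cdot>\<^sub>m (A * (F ^^ m) (X a))) I"
      using A o by (subst msum_mult_left) (auto intro!: msum_cong mult_smult_distrib)
    then have "mtrace (A * msum n (\<lambda>a. c a \<cdot>\<^sub>m (F ^^ m) (X a)) I) = (\<Sum>a\<in>I. c a * mtrace (A * (F ^^ m) (X a)))"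
      using A o by (simp add: mtrace_msum mtrace_smult[of _ "2 ^ n"])
    then show ?thesis unfolding e by (simp add: sum_distrib_left mult_ac)
  qed
  moreover have "(\<lambda>m. of_real (t ^ m / fact m) * mtrace (A * (F ^^ m) (msum n (\<lambda>a. c a \<cdot>\<^sub>m X a) I))) sums
      mtrace (A * exp_superop n F t (msum n (\<lambda>a. c a \<cdot>\<^sub>m X a) I))"
    by (intro mtrace_exp_superop F t A) simp
  ultimately show ?thesis by (simp add: sums_unique2)
qed

lemma mtrace_eigen_proj:
  assumes "\<And>q. q < n \<Longrightarrow> fst (a q) \<noteq> PI"
  shows "mtrace (eigen_proj n a) = 1"
proof -
  have "ltr (lproj c) = 1" if "fst c \<noteq> PI" for c
    using that by (cases c; cases "fst c") (auto simp: ltr_def lproj_def field_simps)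
  then have "ltr (lproj (a q)) = 1" if "q < n" for q using assms that by blast
  then show ?thesis by (simp add: eigen_proj_eq mtrace_tensor_mat)
qed

text \<open>The weighted average of the prepared states is Q / 2^n, that of the measured projectors
  is P, and linearity of the evolution joins them. Positivity and unit trace of the evolved state
  make Born's rule available.\<close>

lemma (in lindbladian) expectation_overlap_sample:
  assumes t: "0 \<le> t" and PQ: "P \<in> pauli_strings {..<n}" "Q \<in> pauli_strings {..<n}"
  shows "measure_pmf.expectation (sample_pmf n F t) (overlap_sample (P, Q)) =
    Re (mtrace (pauli_mat {..<n} P * exp_superop n F t (pauli_mat {..<n} Q)) / 2 ^ n)"
    and "finite (set_pmf (sample_pmf n F t))"
proof -
  let ?E = "exp_superop n F t" and ?w = "\<lambda>P a. \<Prod>q<n. prep_weight P q (a q)"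
  let ?e = "\<lambda>b s. eigen_proj n (\<lambda>q. (b q, s q))"
  define M where "M = (\<lambda>a b. measure_signs n (?E (eigen_proj n a)) b)"
  define A where "A = Pi_pmf {..<n} (PI, True) (\<lambda>_. pmf_of_set (letters \<times> (UNIV :: bool set)))"
  define B where "B = Pi_pmf {..<n} PI (\<lambda>_. pmf_of_set letters)"
  have sp: "sample_pmf n F t = bind_pmf A (\<lambda>a. bind_pmf B (\<lambda>b. bind_pmf (M a b) (\<lambda>s. return_pmf (a, (\<lambda>q. (b q, s q))))))"
    by (simp add: sample_pmf_def A_def B_def M_def letters_def)
  have setA: "set_pmf A = preparations n" and setB: "set_pmf B = bases n"
    by (simp_all add: A_def B_def set_Pi_pmf)
  have a_ne: "fst (a q) \<noteq> PI" if "a \<in> preparations n" "q < n" for a q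
    using that by (force simp: PiE_dflt_def letters_def)
  have b_ne: "b q \<noteq> PI" if "b \<in> bases n" "q < n" for b q
    using that by (force simp: PiE_dflt_def letters_def)
  have pA: "pmf A a = (1 / 6) ^ n" if "a \<in> preparations n" for a
    using that by (simp add: A_def pmf_Pi PiE_dflt_def letters_def power_divide)
  have pB: "pmf B b = (1 / 3) ^ n" if "b \<in> bases n" for b
    using that by (simp add: B_def pmf_Pi PiE_dflt_def letters_def power_divide)
  have pM: "pmf (M a b) s = (if s \<in> signs n then Re (mtrace (?e b s * ?E (eigen_proj n a))) else 0)"
    if "a \<in> preparations n" "b \<in> bases n" for a b s
    unfolding M_def
    using psd_exp[OF t psd_eigen_proj(1)[of n a]] mtrace_exp[OF t eigen_proj_operators, of a] mtrace_eigen_proj[of n a] a_ne[OF that(1)] b_ne[OF that(2)]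
    by (intro pmf_measure_signs) auto
  have finM: "set_pmf (M a b) \<subseteq> signs n" if "a \<in> preparations n" "b \<in> bases n" for a b
    using pM[OF that] by (auto simp: set_pmf_eq split: if_splits)
  have finM': "finite (set_pmf (M a b))" if "a \<in> preparations n" "b \<in> bases n" for a b
    using finite_subset[OF finM[OF that]] by simp
  show "finite (set_pmf (sample_pmf n F t))"
    unfolding sp using finM' by (simp add: setA setB)
  have ov: "overlap_sample (P, Q) (a, c) = ?w Q a * ?w P c" for a c
    using prod_supp_eq_prep_weight[OF PQ(1)] prod_supp_eq_prep_weight[OF PQ(2)] by (simp add: overlap_sample_def)
  have "measure_pmf.expectation (sample_pmf n F t) (overlap_sample (P, Q)) =
    (\<Sum>a\<in>preparations n. pmf A a * (\<Sum>b\<in>bases n. pmf B b * (\<Sum>s\<in>signs n. pmf (M a b) s * (?w Q a * ?w P (\<lambda>q. (b q, s q))))))"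
    unfolding sp
    using finM finM'
    by (subst pmf_expectation_bind[of "preparations n"], simp, simp add: setB setA, simp add: setA, intro sum.cong refl,
        subst pmf_expectation_bind[of "bases n"], simp, simp add: setB setA, simp add: setB,
        unfold real_scaleR_def, intro arg_cong2[where f = "(*)"] refl sum.cong,
        subst pmf_expectation_bind[of "signs n"]) (simp_all add: ov)
  also have "\<dots> = (\<Sum>a\<in>preparations n. (1 / 6) ^ n * (\<Sum>b\<in>bases n. (1 / 3) ^ n * (\<Sum>s\<in>signs n. Re (mtrace (?e b s * ?E (eigen_proj n a))) * (?w Q a * ?w P (\<lambda>q. (b q, s q))))))"
    by (intro sum.cong refl arg_cong2[where f = "(*)"] pA pB; (assumption | subst pM, assumption+, simp only: if_True))
  also have "\<dots> = Re (\<Sum>a\<in>preparations n. of_real ((1 / 6) ^ n * ?w Q a) * (\<Sum>b\<in>bases n. of_real ((1 / 3) ^ n) * (\<Sum>s\<in>signs n. of_real (?w P (\<lambda>q. (b q, s q))) * mtrace (?e b s * ?E (eigen_proj n a)))))"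
    unfolding Re_sum sum_distrib_left
    by (intro sum.cong refl) (simp add: mult_ac flip: of_real_prod of_real_mult of_real_power of_real_divide)
  also have "(\<Sum>a\<in>preparations n. of_real ((1 / 6) ^ n * ?w Q a) * (\<Sum>b\<in>bases n. of_real ((1 / 3) ^ n) * (\<Sum>s\<in>signs n. of_real (?w P (\<lambda>q. (b q, s q))) * mtrace (?e b s * ?E (eigen_proj n a))))) =
    (\<Sum>a\<in>preparations n. of_real ((1 / 6) ^ n * ?w Q a) * mtrace (pauli_mat {..<n} P * ?E (eigen_proj n a)))"
  proof (intro sum.cong refl arg_cong2[where f = "(*)"])
    fix a
    let ?r = "?E (eigen_proj n a)"
    have "mtrace (pauli_mat {..<n} P * ?r) = (\<Sum>b\<in>bases n. mtrace ((of_real ((1 / 3) ^ n) \<cdot>\<^sub>m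
        msum n (\<lambda>s. of_real (?w P (\<lambda>q. (b q, s q))) \<cdot>\<^sub>m ?e b s) (signs n)) * ?r))"
      unfolding sum_measure_eigen_proj[of n P, symmetric]
      by (subst msum_mult_right, simp, simp, subst mtrace_msum) simp_all
    also have "\<dots> = (\<Sum>b\<in>bases n. of_real ((1 / 3) ^ n) * (\<Sum>s\<in>signs n. of_real (?w P (\<lambda>q. (b q, s q))) * mtrace (?e b s * ?r)))"
      by (intro sum.cong refl)
        (simp add: mult_smult_assoc_mat[of _ "2 ^ n" "2 ^ n" _ "2 ^ n"] mtrace_smult[of _ "2 ^ n"] msum_mult_right mtrace_msum)
    finally show "(\<Sum>b\<in>bases n. of_real ((1 / 3) ^ n) * (\<Sum>s\<in>signs n. of_real (?w P (\<lambda>q. (b q, s q))) * mtrace (?e b s * ?r)))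
      = mtrace (pauli_mat {..<n} P * ?r)" ..
  qed
  also have "\<dots> = mtrace (pauli_mat {..<n} P * ?E ((1 / 2 ^ n) \<cdot>\<^sub>m pauli_mat {..<n} Q))"
    unfolding sum_prep_eigen_proj[symmetric]
    by (rule mtrace_exp_superop_msum[OF linear_F t, symmetric]) simp_all
  \<comment> \<open>The scalar is pulled out as a linear combination over a one-point index
    set.\<close>
  also have "\<dots> = 1 / 2 ^ n * mtrace (pauli_mat {..<n} P * ?E (pauli_mat {..<n} Q))"
    using mtrace_exp_superop_msum[OF linear_F t pauli_mat_operators, of "{()}" "\<lambda>_. pauli_mat {..<n} Q" P "\<lambda>_. 1 / 2 ^ n"]
    by (simp add: msum_insert)
  finally show "measure_pmf.expectation (sample_pmf n F t) (overlap_sample (P, Q)) =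
    Re (mtrace (pauli_mat {..<n} P * ?E (pauli_mat {..<n} Q)) / 2 ^ n)" by simp
qed

section \<open>Concentration of the empirical overlaps\<close>

lemma abs_prod_le_power:
  fixes f :: "'a \<Rightarrow> real"
  assumes "\<And>x. x \<in> A \<Longrightarrow> \<bar>f x\<bar> \<le> 3" "card A \<le> k"
  shows "\<bar>\<Prod>x\<in>A. f x\<bar> \<le> 3 ^ k"
proof -
  have "\<bar>\<Prod>x\<in>A. f x\<bar> = (\<Prod>x\<in>A. \<bar>f x\<bar>)" by (rule abs_prod)
  also have "\<dots> \<le> (\<Prod>x\<in>A. 3)" using assms by (intro prod_mono) auto
  also have "\<dots> \<le> 3 ^ k" using assms by (simp add: power_increasing)
  finally show ?thesis .
qed

text \<open>Each of the two strings contributes at most \<open>k\<close> factors of modulus at most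
  3, whatever \<open>n\<close> is.\<close>

lemma abs_overlap_sample_le:
  assumes "card (supp P) \<le> k" "card (supp Q) \<le> k"
  shows "\<bar>overlap_sample (P, Q) c\<bar> \<le> 9 ^ k"
proof -
  obtain a b where c: "c = (a, b)" by fastforce
  have "\<bar>overlap_sample (P, Q) c\<bar> \<le> 3 ^ k * 3 ^ k"
    unfolding c overlap_sample_def prod.case abs_mult
    by (intro mult_mono abs_prod_le_power assms) (auto simp: pm_one_def)
  then show ?thesis by (simp flip: power_mult_distrib)
qed

lemma overlap_estimate_cheb_design:
  "overlap_estimate (cheb_design d B) \<omega> u i = (\<Sum>l<B. overlap_sample u (\<omega> (i, 0, l))) / real B"
  by (simp add: overlap_estimate_def cheb_design_def)

text \<open>With a single batch the estimate is the mean of \<open>B\<close> independent values in a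
  range of width \<open>2 * 9 ^ k\<close>. Hoeffding's exponent 2 (B \<eta>)^2 / (4 B 81^k) is the
  one stated.\<close>

lemma overlap_estimate_concentration:
  fixes d B k :: nat
  assumes B: "0 < B" and i: "i \<le> d" and PQ: "card (supp P) \<le> k" "card (supp Q) \<le> k" and eta: "0 \<le> \<eta>"
    and fin: "finite (set_pmf (sample_pmf n F (sample_time T (cheb_design d B) i)))"
  defines "D \<equiv> data_pmf n F T (cheb_design d B)"
    and "\<mu> \<equiv> measure_pmf.expectation (sample_pmf n F (sample_time T (cheb_design d B) i)) (overlap_sample (P, Q))"
  shows "measure_pmf.prob D {\<omega>. \<eta> \<le> \<bar>overlap_estimate (cheb_design d B) \<omega> (P, Q) i - \<mu>\<bar>} \<le> 2 * exp (- (real B * \<eta>\<^sup>2 / (2 * 81 ^ k)))"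
proof -
  \<comment> \<open>Of all the data only the samples at time \<open>i\<close>, all in batch 0, enter
    this estimate.\<close>
  let ?I = "{..<Suc d} \<times> {..<1 :: nat} \<times> {..<B}" and ?J = "{i} \<times> {0 :: nat} \<times> {..<B}"
  let ?p = "\<lambda>(i, _, _). sample_pmf n F (sample_time T (cheb_design d B) i)"
  have D: "D = Pi_pmf ?I ((\<lambda>_. (PI, True)), (\<lambda>_. (PI, True))) ?p"
    unfolding D_def data_pmf_def by (simp add: cheb_design_def)
  let ?X = "\<lambda>j \<omega>. overlap_sample (P, Q) (\<omega> j)"
  have J: "?J \<subseteq> ?I" using i by auto
  have indep: "prob_space.indep_vars D (\<lambda>_. borel) ?X ?J"
    unfolding D
    by (rule prob_space.indep_vars_compose2[OF measure_pmf.prob_space_axioms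
        prob_space.indep_vars_subset[OF measure_pmf.prob_space_axioms indep_vars_Pi_pmf J]]) auto
  note mu_def = \<mu>_def
  interpret Hoeffding_ineq "measure_pmf D" ?J ?X "\<lambda>_. - (9 ^ k)" "\<lambda>_. 9 ^ k" "\<Sum>j\<in>?J. measure_pmf.expectation D (?X j)"
  proof (unfold_locales)
    show "prob_space.indep_vars D (\<lambda>_. borel) ?X ?J" by (rule indep)
    fix j show "AE x in D. ?X j x \<in> {- (9 ^ k)..9 ^ k}"
      using abs_overlap_sample_le[OF PQ] by (intro AE_I2) (auto simp: abs_le_iff minus_le_iff)
  qed simp_all
  have EX: "measure_pmf.expectation D (?X j) = \<mu>" if "j \<in> ?J" for j
  proof -
    have "measure_pmf.expectation D (?X j) = measure_pmf.expectation (map_pmf (\<lambda>f. f j) D) (overlap_sample (P, Q))" by simp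
    also have "map_pmf (\<lambda>f. f j) D = sample_pmf n F (sample_time T (cheb_design d B) i)"
      unfolding D using that J by (subst Pi_pmf_component) auto
    finally show ?thesis by (simp add: mu_def)
  qed
  have sumE: "(\<Sum>j\<in>?J. measure_pmf.expectation D (?X j)) = real B * \<mu>"
    using EX by (simp add: card_cartesian_product)
  have sumX: "(\<Sum>j\<in>?J. ?X j \<omega>) = (\<Sum>l<B. overlap_sample (P, Q) (\<omega> (i, 0, l)))" for \<omega>
    by (rule sum.reindex_bij_witness[of _ "\<lambda>l. (i, 0, l)" "\<lambda>j. snd (snd j)"]) auto
  have var: "(\<Sum>j\<in>?J. ((9 :: real) ^ k - - (9 ^ k))\<^sup>2) = real B * (4 * 81 ^ k)"
  proof -
    have "(81 :: real) ^ k = 9 ^ k * 9 ^ k" by (simp flip: power_mult_distrib)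
    then show ?thesis by (simp add: card_cartesian_product power2_eq_square)
  qed
  have "measure_pmf.prob D {\<omega> \<in> space D. real B * \<eta> \<le> \<bar>(\<Sum>j\<in>?J. ?X j \<omega>) - (\<Sum>j\<in>?J. measure_pmf.expectation D (?X j))\<bar>}
    \<le> 2 * exp (-2 * (real B * \<eta>)\<^sup>2 / (\<Sum>j\<in>?J. ((9 :: real) ^ k - - (9 ^ k))\<^sup>2))"
    by (rule Hoeffding_ineq_abs_ge) (use eta B var in auto)
  also have "{\<omega> \<in> space D. real B * \<eta> \<le> \<bar>(\<Sum>j\<in>?J. ?X j \<omega>) - (\<Sum>j\<in>?J. measure_pmf.expectation D (?X j))\<bar>} =
    {\<omega>. \<eta> \<le> \<bar>overlap_estimate (cheb_design d B) \<omega> (P, Q) i - \<mu>\<bar>}"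
  proof -
    have "\<eta> \<le> \<bar>S / real B - \<mu>\<bar> \<longleftrightarrow> real B * \<eta> \<le> \<bar>S - real B * \<mu>\<bar>" for S
    proof -
      have "\<bar>S - real B * \<mu>\<bar> = real B * \<bar>S / real B - \<mu>\<bar>"
        using B abs_mult[of "real B" "S / real B - \<mu>"] by (simp add: right_diff_distrib)
      then show ?thesis using B by simp
    qed
    then show ?thesis unfolding sumX sumE overlap_estimate_cheb_design by simp
  qed
  also have "-2 * (real B * \<eta>)\<^sup>2 / (\<Sum>j\<in>?J. ((9 :: real) ^ k - - (9 ^ k))\<^sup>2) = - (real B * \<eta>\<^sup>2 / (2 * 81 ^ k))"
    unfolding var using B by (simp add: power2_eq_square field_simps)
  finally show ?thesis .
qed

section \<open>Estimating the derivative at time zero\<close>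

text \<open>Chain rule: time 0 is the node -1, and the substitution has slope
  \<open>2 / T\<close>.\<close>

lemma ptm_estimate_eq:
  "ptm_estimate T (cheb_design d B) \<omega> u =
    2 / T * poly (pderiv (robust_fit (cheb_design d B) (overlap_estimate (cheb_design d B) \<omega> u))) (-1)"
  by (simp add: ptm_estimate_def pderiv_pcompose poly_pcompose pderiv_pCons)

text \<open>The fit interpolates the data, so its difference from the Taylor polynomial has degree
  at most d and is small at all nodes; the derivative bound from node values applies to it.\<close>

lemma derivative_estimate:
  fixes c :: "nat \<Rightarrow> real" and d B :: nat
  assumes c: "\<And>m. \<bar>c m\<bar> \<le> a ^ m * fact m" and a: "0 < a" and T: "T = 1 / (4 * a)" and d: "1 \<le> d"
    and f: "\<And>i. i \<le> d \<Longrightarrow> (\<lambda>m. (sample_time T (cheb_design d B) i) ^ m / fact m * c m) sums f i"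
    and y: "\<And>i. i \<le> d \<Longrightarrow> \<bar>y i - f i\<bar> \<le> \<eta>"
  shows "\<bar>2 / T * poly (pderiv (robust_fit (cheb_design d B) y)) (-1) - c 1\<bar> \<le> 16 * a * ((real d + 1) ^ 3 * (\<eta> + 1 / 4 ^ d))"
proof -
  let ?x = "\<lambda>i. cos (cheb_angle (Suc d) i)" and ?p = "robust_fit (cheb_design d B) y"
  let ?t = "\<lambda>i. sample_time T (cheb_design d B) i"
  have Tpos: "0 < T" using T a by simp
  have t_eq: "?t i = T / 2 + T / 2 * ?x i" for i
    by (simp add: sample_time_def cheb_design_def field_simps)
  have t0: "0 \<le> ?t i" and tT: "?t i \<le> T" for i
  proof -
    have "-1 \<le> ?x i" by (rule cos_ge_minus_one)
    then have "0 \<le> 1 + ?x i" "1 + ?x i \<le> 2" by (linarith, simp)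
    then have "0 \<le> T * (1 + ?x i)" "T * (1 + ?x i) \<le> T * 2" using Tpos by simp_all
    then show "0 \<le> ?t i" "?t i \<le> T" by (simp_all add: sample_time_def cheb_design_def)
  qed
  \<comment> \<open>The Taylor polynomial at time 0, written in the node variable x through t = T /
    2 + T / 2 x.\<close>
  define q where "q = (\<Sum>m\<le>d. Polynomial.smult (c m / fact m) ([:T / 2, T / 2:] ^ m))"
  have deg_q: "Polynomial.degree q \<le> d"
    unfolding q_def
  proof (rule degree_sum_le)
    fix m assume "m \<in> {..d}"
    have "Polynomial.degree ([:T / 2, T / 2:] ^ m) \<le> Polynomial.degree [:T / 2, T / 2:] * m" by (rule degree_power_le)
    also have "\<dots> \<le> d" using \<open>m \<in> {..d}\<close> Tpos by simp
    finally show "Polynomial.degree (Polynomial.smult (c m / fact m) ([:T / 2, T / 2:] ^ m)) \<le> d"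
      using degree_smult_le order_trans by blast
  qed simp
  have q_val: "poly q (?x i) = (\<Sum>m\<le>d. ?t i ^ m / fact m * c m)" for i
    unfolding q_def poly_sum by (intro sum.cong refl) (simp add: t_eq mult_ac)
  have "poly (pderiv q) (-1) = (\<Sum>m\<le>d. c m / fact m * poly (pderiv ([:T / 2, T / 2:] ^ m)) (-1))"
    unfolding q_def by (simp add: higher_pderiv_sum[of 1, simplified] pderiv_smult poly_sum)
  \<comment> \<open>At x = -1 the time is 0, so only the linear term has a derivative there.\<close>
  also have "\<dots> = (\<Sum>m\<le>d. if m = 1 then c 1 * (T / 2) else 0)"
  proof (intro sum.cong refl)
    fix m
    show "c m / fact m * poly (pderiv ([:T / 2, T / 2:] ^ m)) (-1) = (if m = 1 then c 1 * (T / 2) else 0)"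
    proof (cases m)
      case (Suc l)
      have "poly [:T / 2, T / 2:] (-1) = 0" "poly (pderiv [:T / 2, T / 2:]) (-1) = T / 2"
        by (simp_all add: pderiv_pCons)
      then have "poly (pderiv ([:T / 2, T / 2:] ^ m)) (-1) = real (Suc l) * 0 ^ l * (T / 2)"
        by (simp only: Suc pderiv_power_Suc poly_mult poly_smult poly_power)
      then show ?thesis using Suc by (cases l) simp_all
    qed simp
  qed
  also have "\<dots> = c 1 * (T / 2)" using d by simp
  finally have q': "poly (pderiv q) (-1) = c 1 * (T / 2)" .
  \<comment> \<open>Since T a = 1/4, the terms are bounded by powers of 1/4; the geometric tail is
    4/3 of its first term and thus below \<open>1 / 4 ^ d\<close>.\<close>
  have tail: "\<bar>f i - poly q (?x i)\<bar> \<le> 1 / 4 ^ d" if i: "i \<le> d" for i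
  proof -
    have tm: "norm (?t i ^ m / fact m * c m) \<le> (1 / 4) ^ m" for m
    proof -
      have "norm (?t i ^ m / fact m * c m) = ?t i ^ m / fact m * \<bar>c m\<bar>" using t0[of i] by (simp add: abs_mult)
      also have "\<dots> \<le> T ^ m / fact m * (a ^ m * fact m)"
        using t0[of i] tT[of i] c[of m] Tpos by (intro mult_mono divide_right_mono power_mono) auto
      also have "\<dots> = (T * a) ^ m" by (simp add: power_mult_distrib)
      also have "T * a = 1 / 4" using a T by simp
      finally show ?thesis .
    qed
    have "(\<lambda>m. (1 / 4) ^ Suc d * (1 / 4 :: real) ^ m) sums ((1 / 4) ^ Suc d * (1 / (1 - 1 / 4)))"
      by (intro sums_mult geometric_sums) simp
    moreover have "(1 / 4) ^ Suc d * (1 / 4 :: real) ^ m = (1 / 4) ^ (m + Suc d)" for m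
      by (simp only: power_add mult.commute)
    moreover have "1 / (1 - 1 / 4) = (4 / 3 :: real)" by simp
    ultimately have "(\<lambda>m. (1 / 4 :: real) ^ (m + Suc d)) sums ((1 / 4) ^ Suc d * (4 / 3))" by (simp only:)
    then have g: "summable (\<lambda>m. (1 / 4 :: real) ^ (m + Suc d))" "(\<Sum>m. (1 / 4 :: real) ^ (m + Suc d)) = (1 / 4) ^ Suc d * (4 / 3)"
      by (simp_all only: sums_iff)
    have "(\<lambda>m. ?t i ^ (m + Suc d) / fact (m + Suc d) * c (m + Suc d)) sums (f i - (\<Sum>m<Suc d. ?t i ^ m / fact m * c m))"
      using sums_split_initial_segment[OF f[OF i], of "Suc d"] .
    then have "f i - poly q (?x i) = (\<Sum>m. ?t i ^ (m + Suc d) / fact (m + Suc d) * c (m + Suc d))"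
      by (simp add: sums_iff q_val lessThan_Suc_atMost)
    moreover have "norm (\<Sum>m. ?t i ^ (m + Suc d) / fact (m + Suc d) * c (m + Suc d)) \<le> (\<Sum>m. (1 / 4) ^ (m + Suc d))"
      by (rule norm_suminf_le[OF tm g(1)])
    ultimately have "\<bar>f i - poly q (?x i)\<bar> \<le> (1 / 4) ^ Suc d * (4 / 3)" by (simp only: g(2) real_norm_def)
    also have "\<dots> \<le> 1 / 4 ^ d" by (simp add: power_divide divide_simps)
    finally show ?thesis .
  qed
  have "\<bar>poly (pderiv (?p - q)) (-1)\<bar> \<le> 2 * (real d + 1) ^ 3 * (\<eta> + 1 / 4 ^ d)"
  proof (rule pderiv_bound_cheb_nodes)
    show "Polynomial.degree (?p - q) \<le> d" using robust_fit_interpolates(1) deg_q by (rule degree_diff_le)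
    fix i assume i: "i \<le> d"
    have "poly (?p - q) (?x i) = (y i - f i) + (f i - poly q (?x i))"
      using robust_fit_interpolates(2)[OF i] by simp
    then show "\<bar>poly (?p - q) (?x i)\<bar> \<le> \<eta> + 1 / 4 ^ d" using y[OF i] tail[OF i] by linarith
  qed
  then have "2 / T * \<bar>poly (pderiv (?p - q)) (-1)\<bar> \<le> 2 / T * (2 * (real d + 1) ^ 3 * (\<eta> + 1 / 4 ^ d))"
    using Tpos by (intro mult_left_mono) auto
  moreover have "2 / T * poly (pderiv ?p) (-1) - c 1 = 2 / T * poly (pderiv (?p - q)) (-1)"
    using Tpos q' by (simp add: pderiv_diff field_simps)
  moreover have "2 / T * (2 * (real d + 1) ^ 3 * (\<eta> + 1 / 4 ^ d)) = 16 * a * ((real d + 1) ^ 3 * (\<eta> + 1 / 4 ^ d))"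
    unfolding T using a by simp
  ultimately show ?thesis using Tpos by (simp only: abs_mult) simp
qed

section \<open>Error propagation through the peeling\<close>

text \<open>Cauchy-Schwarz for the products P A and B Q, each of Hilbert-Schmidt norm sqrt (2 ^ card
  S) because Pauli matrices are unitary.\<close>

lemma cmod_mtrace_four_paulis_le:
  "cmod (mtrace (pauli_mat S A * pauli_mat S P * pauli_mat S B * pauli_mat S Q)) \<le> 2 ^ card S"
proof -
  let ?n = "card S"
  have o: "pauli_mat S R \<in> operators ?n" for R by simp
  have nrm: "hs_norm (pauli_mat S R * pauli_mat S R') = sqrt (2 ^ ?n)" for R R'
  proof -
    have "mat_adjoint (pauli_mat S R * pauli_mat S R') * (pauli_mat S R * pauli_mat S R') =
      pauli_mat S R' * (pauli_mat S R * pauli_mat S R) * pauli_mat S R'"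
      by (simp add: mat_adjoint_mult[OF o o] mult_assoc_square[OF o o operators_closed(1)[OF o o]] mult_assoc_square[OF o operators_closed(1)[OF o o] o] mult_assoc_square[OF o o o])
    also have "\<dots> = 1\<^sub>m (2 ^ ?n)" by (simp add: pauli_mat_square right_mult_one_mat[OF o])
    finally show ?thesis by (simp add: hs_norm_def mtrace_def)
  qed
  have "pauli_mat S A * pauli_mat S P * pauli_mat S B * pauli_mat S Q =
      mat_adjoint (pauli_mat S P * pauli_mat S A) * (pauli_mat S B * pauli_mat S Q)"
    by (simp add: mat_adjoint_mult[OF o o] mult_assoc_square[OF operators_closed(1)[OF o o] o o])
  then have "cmod (mtrace (pauli_mat S A * pauli_mat S P * pauli_mat S B * pauli_mat S Q)) \<le>
      hs_norm (pauli_mat S P * pauli_mat S A) * hs_norm (pauli_mat S B * pauli_mat S Q)"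
    using cmod_hs_inner_le[OF operators_closed(1)[OF o o] operators_closed(1)[OF o o], of P A B Q] by (simp add: hs_inner_def)
  then show ?thesis unfolding nrm by simp
qed

text \<open>There are 16^s terms, each at most e 2^s, divided by 8^s, where s is the size of
  \<open>S\<close>.\<close>

lemma local_inverse_error:
  assumes fin: "finite S" and e: "\<And>A B. A \<in> pauli_strings S \<Longrightarrow> B \<in> pauli_strings S \<Longrightarrow> cmod (L (A, B) - L' (A, B)) \<le> e"
  shows "cmod (local_inverse L S u - local_inverse L' S u) \<le> 4 ^ card S * e"
proof -
  let ?p = "pauli_mat S" and ?ps = "pauli_strings S" and ?s = "card S"
  let ?m = "\<lambda>A B. mtrace (?p A * ?p (snd u) * ?p B * ?p (fst u))"
  have e0: "0 \<le> e" using e[of id_string id_string] by (auto intro: order_trans[OF norm_ge_zero])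
  have "local_inverse L S u - local_inverse L' S u = (\<Sum>A\<in>?ps. \<Sum>B\<in>?ps. (L (A, B) - L' (A, B)) * ?m A B) / 2 ^ (3 * ?s)"
    by (simp add: local_inverse_def left_diff_distrib sum_subtractf diff_divide_distrib)
  then have "cmod (local_inverse L S u - local_inverse L' S u) = cmod (\<Sum>A\<in>?ps. \<Sum>B\<in>?ps. (L (A, B) - L' (A, B)) * ?m A B) / 2 ^ (3 * ?s)"
    by (simp add: norm_divide norm_power)
  also have "cmod (\<Sum>A\<in>?ps. \<Sum>B\<in>?ps. (L (A, B) - L' (A, B)) * ?m A B) \<le> (\<Sum>A\<in>?ps. \<Sum>B\<in>?ps. e * 2 ^ ?s)"
    by (intro sum_norm_le order_trans[OF norm_sum] sum_mono)
      (auto simp: norm_mult intro!: mult_mono e cmod_mtrace_four_paulis_le e0)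
  also have "\<dots> = 4 ^ ?s * (4 ^ ?s * (e * 2 ^ ?s))" using fin by (simp add: card_pauli_strings)
  finally have "cmod (local_inverse L S u - local_inverse L' S u) \<le> 4 ^ ?s * (4 ^ ?s * (e * 2 ^ ?s)) / 2 ^ (3 * ?s)"
    by (simp add: divide_right_mono)
  also have "\<dots> = 4 ^ ?s * e"
  proof -
    have "(2 :: real) ^ (3 * ?s) = 4 ^ ?s * 2 ^ ?s" by (simp add: power_mult flip: power_mult_distrib)
    then show ?thesis by (simp add: field_simps)
  qed
  finally show ?thesis .
qed

text \<open>A projecting v lies in an edge that contains the support of u and so meets a fixed edge
  around u: at most \<Delta> + 1 edges, that one included. Inside an edge v is determined by the
  nontrivial string that it applies on both sides off the support of u.\<close>

lemma card_projects_le: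
  assumes E: "E \<subseteq> edges n k" and deg: "\<forall>e\<in>E. card {e' \<in> E. e' \<noteq> e \<and> e' \<inter> e \<noteq> {}} \<le> \<Delta>"
    and us: "U = Omega n k E - {(id_string, id_string)}" and u: "u \<in> U"
  shows "real (card {v \<in> U. projects v u}) \<le> (real \<Delta> + 1) * (4 ^ k - 1)"
proof -
  let ?S = "union_supp u"
  have finE: "finite E" using E finite_subset by fastforce
  obtain e0 where e0: "e0 \<in> E" "?S \<subseteq> e0" using u us by (auto simp: Omega_def)
  \<comment> \<open>Here the removal of the pair of identities counts: every edge contains the empty
    support, so that pair would have projecting indices in all edges.\<close>
  have S: "?S \<noteq> {}"
  proof
    assume "?S = {}"
    then have "fst u = id_string" "snd u = id_string" by (auto simp: union_supp_eq supp_def id_string_def)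
    then have "u = (id_string, id_string)" by (rule prod_eqI[of u "(id_string, id_string)", simplified])
    then show False using u us by auto
  qed
  define N where "N = insert e0 {e' \<in> E. e' \<noteq> e0 \<and> e' \<inter> e0 \<noteq> {}}"
  have finN: "finite N" using finE by (simp add: N_def)
  have cardN: "card N \<le> \<Delta> + 1"
    using deg e0 finE by (auto simp: N_def)
  define W where "W = (\<lambda>e'. {v \<in> U. projects v u \<and> union_supp v \<subseteq> e'})"
  have cover: "{v \<in> U. projects v u} \<subseteq> (\<Union>e'\<in>N. W e')"
  proof
    fix v assume v: "v \<in> {v \<in> U. projects v u}"
    then obtain e' where e': "e' \<in> E" "union_supp v \<subseteq> e'" using us by (auto simp: Omega_def)
    have "?S \<subseteq> e'" using v e'(2) unfolding projects_def by blast
    then have "e' \<in> N" using S e0 e' by (auto simp: N_def)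
    then show "v \<in> (\<Union>e'\<in>N. W e')" using v e' by (auto simp: W_def)
  qed
  have W: "card (W e') \<le> 4 ^ k - 1" and finW: "finite (W e')" if e': "e' \<in> N" for e'
  proof -
    have "e' \<in> edges n k" using e' e0 E by (auto simp: N_def)
    then have "e' \<subseteq> {..<n}" and en2: "card e' \<le> k" by (auto simp: edges_def)
    then have en1: "finite e'" using finite_subset by blast
    note en = en1 en2
    \<comment> \<open>On the support of u the index equals u, and elsewhere its second component
      repeats the first, so these letters encode it.\<close>
    define \<phi> where "\<phi> = (\<lambda>v :: pair_index. restrict_string (fst v) (e' - ?S))"
    have on: "fst v q = fst u q" "snd v q = snd u q" if "v \<in> W e'" "q \<in> ?S" for v q
    proof -
      have "u = (restrict_string (fst v) ?S, restrict_string (snd v) ?S)"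
        using that(1) unfolding W_def projects_def by blast
      note this[THEN arg_cong[where f = fst]] this[THEN arg_cong[where f = snd]]
      from this[THEN fun_cong[of _ _ q]] that(2) show "fst v q = fst u q" "snd v q = snd u q"
        by (simp_all only: fst_conv snd_conv restrict_string_def if_True)
    qed
    have off: "fst v q = snd v q" if "v \<in> W e'" "q \<notin> ?S" for v q
    proof (cases "q \<in> union_supp v")
      case True
      then show ?thesis using that unfolding W_def projects_def by blast
    qed (auto simp: union_supp_eq supp_def)
    have out: "fst v q = PI" if "v \<in> W e'" "q \<notin> e'" for v q
    proof -
      have "q \<notin> union_supp v" using that by (auto simp: W_def)
      then show ?thesis by (auto simp: union_supp_eq supp_def)
    qed
    have inj: "inj_on \<phi> (W e')"
    proof (rule inj_onI)
      fix v w assume v: "v \<in> W e'" and w: "w \<in> W e'" and eq: "\<phi> v = \<phi> w"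
      have f: "fst v q = fst w q" for q
      proof (cases "q \<in> ?S")
        case True
        then show ?thesis using on(1)[OF v] on(1)[OF w] by simp
      next
        case False
        show ?thesis
        proof (cases "q \<in> e'")
          case True
          with False fun_cong[OF eq, of q] show ?thesis by (simp add: \<phi>_def restrict_string_def)
        qed (use out v w in simp)
      qed
      have "snd v q = snd w q" for q
        using on(2)[OF v, of q] on(2)[OF w, of q] off[OF v, of q] off[OF w, of q] f[of q] by (cases "q \<in> ?S") auto
      with f show "v = w" by (intro prod_eqI ext)
    qed
    \<comment> \<open>A projecting index has strictly larger support than u, so its code is not the
      trivial string: this is the minus one.\<close>
    have im: "\<phi> ` W e' \<subseteq> pauli_strings (e' - ?S) - {id_string}"
    proof
      fix r assume "r \<in> \<phi> ` W e'"
      then obtain v where v: "v \<in> W e'" "r = \<phi> v" by auto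
      obtain q where q: "q \<in> union_supp v" "q \<notin> ?S" "q \<in> e'" using v(1) unfolding W_def projects_def by blast
      have "fst v q \<noteq> PI" using q(1) off[OF v(1) q(2)] by (auto simp: union_supp_eq supp_def)
      then have "r q \<noteq> id_string q" using q v(2) by (simp add: \<phi>_def restrict_string_def id_string_def)
      then have "r \<noteq> id_string" by auto
      then show "r \<in> pauli_strings (e' - ?S) - {id_string}"
        using v(2) by (auto simp: \<phi>_def restrict_string_def pauli_strings_def)
    qed
    have fin: "finite (pauli_strings (e' - ?S) - {id_string})" using en by simp
    show "finite (W e')" using finite_imageD[OF finite_subset[OF im fin] inj] .
    have "card (W e') = card (\<phi> ` W e')" using card_image[OF inj] by simp
    also have "\<dots> \<le> card (pauli_strings (e' - ?S) - {id_string})" by (rule card_mono[OF fin im])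
    also have "\<dots> = 4 ^ card (e' - ?S) - 1" using en by (simp add: card_pauli_strings)
    also have "\<dots> \<le> 4 ^ k - 1"
    proof -
      have "card (e' - ?S) \<le> k" using card_mono[OF en(1), of "e' - ?S"] en(2) by auto
      then show ?thesis by (intro diff_le_mono power_increasing) auto
    qed
    finally show "card (W e') \<le> 4 ^ k - 1" .
  qed
  have "card {v \<in> U. projects v u} \<le> card (\<Union>e'\<in>N. W e')"
    using finN finW by (intro card_mono cover) auto
  also have "\<dots> \<le> (\<Sum>e'\<in>N. card (W e'))" by (rule card_UN_le[OF finN])
  also have "\<dots> \<le> (\<Sum>e'\<in>N. 4 ^ k - 1)" by (intro sum_mono W)
  also have "\<dots> \<le> (\<Delta> + 1) * (4 ^ k - 1)" using cardN by (simp add: mult_right_mono del: mult_Suc)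
  finally have "real (card {v \<in> U. projects v u}) \<le> real ((\<Delta> + 1) * (4 ^ k - 1))" by (rule of_nat_mono)
  moreover have "real (4 ^ k - 1) = 4 ^ k - 1" by (simp add: of_nat_diff)
  ultimately show ?thesis by (simp only: of_nat_mult of_nat_add of_nat_1)
qed

lemma projects_card_less:
  "projects v u \<Longrightarrow> finite (union_supp v) \<Longrightarrow> card (union_supp u) < card (union_supp v)"
  by (rule psubset_card_mono) (auto simp only: projects_def)

text \<open>
  Every index projecting onto \<open>u\<close> has strictly larger support, so the errors satisfy a recursion
  of depth at most \<open>k\<close> with branching \<open>r\<close>.
\<close>

lemma recursion_error:
  fixes err :: "pair_index \<Rightarrow> real"
  assumes fin: "finite U" and supp: "\<And>u. u \<in> U \<Longrightarrow> finite (union_supp u) \<and> card (union_supp u) \<le> k"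
    and rec: "\<And>u. u \<in> U \<Longrightarrow> err u \<le> b + (\<Sum>v\<in>{v \<in> U. projects v u}. err v)"
    and card: "\<And>u. u \<in> U \<Longrightarrow> real (card {v \<in> U. projects v u}) \<le> r" and b: "0 \<le> b" "0 \<le> r"
    and u: "u \<in> U"
  shows "err u \<le> b * (\<Sum>l=0..k. r ^ l)"
proof -
  \<comment> \<open>\<open>j\<close> bounds how far the support of u can still grow up to size
    \<open>k\<close>; passing to a projecting index uses up at least one unit of it.\<close>
  have "err u \<le> b * (\<Sum>l\<le>j. r ^ l)" if "u \<in> U" "k \<le> card (union_supp u) + j" for u j
    using that
  proof (induction j arbitrary: u)
    case 0
    then have none: "{v \<in> U. projects v u} = {}"
      using supp projects_card_less[of _ u] by fastforce
    show ?case using rec[OF 0(1)] unfolding none by simp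
  next
    case (Suc j)
    have "err u \<le> b + (\<Sum>v\<in>{v \<in> U. projects v u}. err v)" by (rule rec[OF Suc.prems(1)])
    also have "(\<Sum>v\<in>{v \<in> U. projects v u}. err v) \<le> (\<Sum>v\<in>{v \<in> U. projects v u}. b * (\<Sum>l\<le>j. r ^ l))"
    proof (rule sum_mono)
      fix v assume "v \<in> {v \<in> U. projects v u}"
      then have v: "v \<in> U" "projects v u" by auto
      have "card (union_supp u) < card (union_supp v)" using projects_card_less[OF v(2)] supp[OF v(1)] by blast
      then show "err v \<le> b * (\<Sum>l\<le>j. r ^ l)" using Suc.prems(2) by (intro Suc.IH v) auto
    qed
    also have "\<dots> \<le> r * (b * (\<Sum>l\<le>j. r ^ l))"
      using card[OF Suc.prems(1)] b by (simp add: mult_right_mono sum_nonneg)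
    finally show ?case
      by (simp add: sum.atMost_Suc_shift sum_distrib_left algebra_simps del: sum.atMost_Suc)
  qed
  from this[OF u, of k] show ?thesis by (simp add: atMost_atLeast0)
qed

lemma degree_factor_ge_1: "1 \<le> degree_factor k \<Delta>"
proof -
  have r: "0 \<le> (real \<Delta> + 1) * (4 ^ k - 1)" by simp
  have "(\<Sum>l\<in>{0::nat}. ((real \<Delta> + 1) * (4 ^ k - 1)) ^ l) \<le> degree_factor k \<Delta>"
    unfolding degree_factor_def using r by (intro sum_mono2) auto
  then show ?thesis by simp
qed

lemma degree_factor_mono: "\<Delta> \<le> \<Delta>' \<Longrightarrow> degree_factor k \<Delta> \<le> degree_factor k \<Delta>'"
  unfolding degree_factor_def by (intro sum_mono power_mono mult_right_mono) auto

lemma Omega_props: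
  assumes "u \<in> Omega n k E"
  shows "u \<in> pauli_strings {..<n} \<times> pauli_strings {..<n}" "finite (union_supp u)" "card (union_supp u) \<le> k"
    "card (supp (fst u)) \<le> k" "card (supp (snd u)) \<le> k"
proof -
  show V: "u \<in> pauli_strings {..<n} \<times> pauli_strings {..<n}" and c: "card (union_supp u) \<le> k"
    using assms by (auto simp: Omega_def local_pairs_def mem_Times_iff)
  have "union_supp u \<subseteq> {..<n}" using V by (auto simp: union_supp_eq supp_def pauli_strings_def mem_Times_iff)
  then show f: "finite (union_supp u)" using finite_subset by blast
  have "card (supp (fst u)) \<le> card (union_supp u)" "card (supp (snd u)) \<le> card (union_supp u)"
    using f by (auto simp only: union_supp_eq intro!: card_mono)
  with c show "card (supp (fst u)) \<le> k" "card (supp (snd u)) \<le> k" by auto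
qed

lemma finite_Omega [simp]: "finite (Omega n k E)"
  by (rule finite_subset[of _ "pauli_strings {..<n} \<times> pauli_strings {..<n}"]) (use Omega_props(1) in auto)

text \<open>The deterministic half: accurate transfer matrix entries give accurate coefficients.
  Their accuracy is demanded only for nonempty \<open>us\<close>; with nothing supplied there may be
  no samples, and then the zero output is exact.\<close>

lemma postprocess_accurate:
  fixes Lhat :: "pair_index \<Rightarrow> real"
  assumes L: "local_data n k h J"
    and chi: "chi_expansion n (generator n k h J) chi" and lin: "lindblad_expansion n (generator n k h J) h G"
    and E: "E \<subseteq> edges n k"
    and exact: "\<forall>P\<in>pauli_strings {..<n}. \<forall>Q\<in>pauli_strings {..<n}. (P, Q) \<notin> Omega n k E \<longrightarrow> chi (P, Q) = 0"
    and deg: "\<forall>e\<in>E. card {e' \<in> E. e' \<noteq> e \<and> e' \<inter> e \<noteq> {}} \<le> \<Delta>"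
    and us: "distinct us" "set us = Omega n k E - {(id_string, id_string)}"
    and e: "us \<noteq> [] \<Longrightarrow> 0 \<le> e" "\<And>u. us \<noteq> [] \<Longrightarrow> u \<in> Omega n k E \<Longrightarrow> \<bar>Lhat u - Re (ptm n (generator n k h J) u)\<bar> \<le> e"
    and \<eta>: "0 \<le> \<eta>" "us \<noteq> [] \<Longrightarrow> 4 ^ k * e * degree_factor k \<Delta> \<le> \<eta>"
  shows "accurate n \<eta> G h (fst (postprocess k us Lhat))"
proof -
  let ?F = "generator n k h J" and ?V = "pauli_strings {..<n} \<times> pauli_strings {..<n}"
  interpret tot: lindbladian n "total_ham n k h" "jump_index n k J" "jump J" by (rule lindbladian_total[OF L])
  define est where "est = fst (peeling k us Lhat)"
  have supp: "finite (union_supp u) \<and> card (union_supp u) \<le> k" if "u \<in> set us" for u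
    using that us(2) Omega_props[of u n k E] by blast
  have est_rec: "est u = local_inverse (\<lambda>v. of_real (Lhat v)) (union_supp u) u - (\<Sum>v\<in>{v \<in> set us. projects v u}. est v)"
    if "u \<in> set us" for u
    unfolding est_def by (rule fst_peeling_recursion(1)[OF _ us(1) that]) (rule supp)
  have est_zero: "est u = 0" if "u \<notin> set us" for u
    unfolding est_def by (rule fst_peeling_recursion(2)[OF _ us(1) that]) (rule supp)
  \<comment> \<open>The exact transfer matrix is real, so a bound on real parts controls the complex
    entries.\<close>
  have real: "complex_of_real (Re (ptm n ?F u)) = ptm n ?F u" for u
    using tot.ptm_funpow_real[of 1 "fst u" "snd u"] by (simp add: complex_eq_iff generator_eq_lind)
  have chi_rec: "chi u = local_inverse (ptm n ?F) (union_supp u) u - (\<Sum>v\<in>{v \<in> set us. projects v u}. chi v)"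
    if u: "u \<in> set us" for u
  proof -
    have uV: "u \<in> ?V" using u us(2) Omega_props(1)[of u n k E] by blast
    \<comment> \<open>Exact support enters here: \<open>chi\<close> vanishes at projecting indices
      outside \<open>Omega n k E\<close>, and the discarded pair projects onto nothing since its
      support is empty.\<close>
    have "(\<Sum>v\<in>{v \<in> ?V. projects v u}. chi v) = (\<Sum>v\<in>{v \<in> set us. projects v u}. chi v)"
    proof (rule sum.mono_neutral_right)
      show "finite {v \<in> ?V. projects v u}" by (rule finite_subset[of _ ?V]) auto
      show "{v \<in> set us. projects v u} \<subseteq> {v \<in> ?V. projects v u}" using us(2) Omega_props(1) by blast
      show "\<forall>v\<in>{v \<in> ?V. projects v u} - {v \<in> set us. projects v u}. chi v = 0"
      proof
        fix v assume v: "v \<in> {v \<in> ?V. projects v u} - {v \<in> set us. projects v u}"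
        then have "union_supp v \<noteq> {}" by (auto simp only: projects_def)
        then have "v \<noteq> (id_string, id_string)" by (auto simp: supp_def id_string_def)
        then have "(fst v, snd v) \<notin> Omega n k E" using v us(2) by auto
        then show "chi v = 0" using exact v by (cases v) auto
      qed
    qed
    then show ?thesis using local_inverse_ptm_projects[OF chi uV] by simp
  qed
  let ?r = "(real \<Delta> + 1) * (4 ^ k - 1)"
  have err: "cmod (est u - chi u) \<le> \<eta>" if u: "u \<in> set us" for u
  proof -
    have ne: "us \<noteq> []" using u by auto
    have loc: "cmod (local_inverse (\<lambda>v. of_real (Lhat v)) (union_supp u) u - local_inverse (ptm n ?F) (union_supp u) u) \<le> 4 ^ k * e"
      if u: "u \<in> set us" for u
    proof -
      obtain e' where e': "e' \<in> E" "union_supp u \<subseteq> e'" using u us(2) by (auto simp: Omega_def)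
      have c: "e' \<subseteq> {..<n}" "card e' \<le> k" using e' E by (auto simp: edges_def)
      have "cmod (local_inverse (\<lambda>v. of_real (Lhat v)) (union_supp u) u - local_inverse (ptm n ?F) (union_supp u) u)
          \<le> 4 ^ card (union_supp u) * e"
      proof (rule local_inverse_error)
        show "finite (union_supp u)" using supp[OF u] by blast
        fix A B assume AB: "A \<in> pauli_strings (union_supp u)" "B \<in> pauli_strings (union_supp u)"
        then have sub: "union_supp (A, B) \<subseteq> union_supp u" by (auto simp: supp_def pauli_strings_def)
        have "card (union_supp (A, B)) \<le> card (union_supp u)" using sub supp[OF u] by (intro card_mono) auto
        \<comment> \<open>The entries needed at u are indexed by \<open>Omega n k E\<close>
          themselves, the pair of identities included; this is why the union bound runs over that
          set and not over \<open>us\<close>.\<close>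
        then have "(A, B) \<in> Omega n k E"
          using sub e' c supp[OF u] AB unfolding Omega_def local_pairs_def
          by (auto simp del: union_supp.simps simp: pauli_strings_def intro!: bexI[of _ e'])
        from e(2)[OF ne this] have "\<bar>Lhat (A, B) - Re (ptm n ?F (A, B))\<bar> \<le> e" .
        moreover have "complex_of_real (Lhat (A, B)) - ptm n ?F (A, B) = of_real (Lhat (A, B) - Re (ptm n ?F (A, B)))"
          using real[of "(A, B)"] by simp
        ultimately show "cmod (complex_of_real (Lhat (A, B)) - ptm n ?F (A, B)) \<le> e" by (simp only: norm_of_real)
      qed
      also have "\<dots> \<le> 4 ^ k * e" using supp[OF u] e(1)[OF ne] by (intro mult_right_mono power_increasing) auto
      finally show ?thesis .
    qed
    have "cmod (est u - chi u) \<le> 4 ^ k * e * (\<Sum>l=0..k. ?r ^ l)"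
    proof (rule recursion_error[where U = "set us" and err = "\<lambda>u. cmod (est u - chi u)"])
      show "real (card {v \<in> set us. projects v u}) \<le> ?r" if "u \<in> set us" for u
        by (rule card_projects_le[OF E deg us(2) that])
      fix u assume u: "u \<in> set us"
      have "est u - chi u = (local_inverse (\<lambda>v. of_real (Lhat v)) (union_supp u) u - local_inverse (ptm n ?F) (union_supp u) u)
        - (\<Sum>v\<in>{v \<in> set us. projects v u}. est v - chi v)"
        unfolding sum_subtractf by (subst est_rec[OF u], subst chi_rec[OF u]) simp
      also have "cmod \<dots> \<le> 4 ^ k * e + (\<Sum>v\<in>{v \<in> set us. projects v u}. cmod (est v - chi v))"
        by (rule order_trans[OF norm_triangle_ineq4 add_mono[OF loc[OF u] norm_sum]])
      finally show "cmod (est u - chi u) \<le> 4 ^ k * e + (\<Sum>v\<in>{v \<in> set us. projects v u}. cmod (est v - chi v))" .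
    qed (use u supp e(1)[OF ne] in auto)
    then show ?thesis using \<eta>(2)[OF ne] by (simp add: degree_factor_def)
  qed
  have err': "cmod (est (P, Q) - chi (P, Q)) \<le> \<eta>"
    if "P \<in> pauli_strings {..<n}" "Q \<in> pauli_strings {..<n}" "(P, Q) \<noteq> (id_string, id_string)" for P Q
  proof (cases "(P, Q) \<in> set us")
    case False
    then have "(P, Q) \<notin> Omega n k E" using that us(2) by auto
    then show ?thesis using exact that est_zero[OF False] \<eta>(1) by simp
  qed (rule err)
  have out: "fst (postprocess k us Lhat) =
    ((\<lambda>(P, Q). if P \<noteq> id_string \<and> Q \<noteq> id_string then est (P, Q) else 0),
     (\<lambda>P. \<i> / 2 * (est (P, id_string) - est (id_string, P))))"
    unfolding fst_postprocess est_def[symmetric] by (rule fst_read_off) (rule est_zero)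
  have G: "cmod (est (P, Q) - G (P, Q)) \<le> \<eta>" if "P \<in> pauli_strings {..<n} - {id_string}" "Q \<in> pauli_strings {..<n} - {id_string}" for P Q
    using lindblad_coeff_eq_chi(1)[OF chi lin, of P Q] err'[of P Q] that by simp
  have H: "cmod (\<i> / 2 * (est (P, id_string) - est (id_string, P)) - h P) \<le> \<eta>" if P: "P \<in> pauli_strings {..<n}" for P
  \<comment> \<open>At the identity the output is a difference of equal terms, and the Hamiltonian
    has no such component because it is traceless.\<close>
  proof (cases "P = id_string")
    case True
    have "2 ^ n * h id_string = mtrace (ham_mat n h (pauli_strings {..<n}))"
      using mtrace_pauli_ham_mat[of id_string n h] by simp
    also have "\<dots> = 0" using L by (simp add: local_data_def)
    finally show ?thesis using True \<eta>(1) by simp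
  next
    case False
    have "\<i> / 2 * (est (P, id_string) - est (id_string, P)) - h P =
      \<i> / 2 * ((est (P, id_string) - chi (P, id_string)) - (est (id_string, P) - chi (id_string, P)))"
      using lindblad_coeff_eq_chi(2)[OF chi lin P False] by (simp add: algebra_simps)
    also have "cmod \<dots> \<le> 1 / 2 * (cmod (est (P, id_string) - chi (P, id_string)) + cmod (est (id_string, P) - chi (id_string, P)))"
      unfolding norm_mult by (intro mult_mono norm_triangle_ineq4) (simp_all add: norm_divide)
    also have "\<dots> \<le> 1 / 2 * (\<eta> + \<eta>)"
      using False P by (intro mult_left_mono add_mono err') auto
    finally show ?thesis by simp
  qed
  show ?thesis unfolding out accurate_def using G H by simp
qed

text \<open>The Taylor coefficients of the expected overlap are the transfer matrix entries of the
  powers of the generator. Locality bounds them with a = \<alpha> k, and \<open>max_time\<close> is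
  1 / (4 a).\<close>

lemma ptm_estimate_error:
  assumes L: "local_data n k h J" and \<alpha>: "interaction_strength n k h J \<le> \<alpha>" "0 < \<alpha>" and n: "0 < n" and k: "1 \<le> k"
    and P: "P \<in> pauli_strings {..<n}" "card (supp P) \<le> k" and Q: "Q \<in> pauli_strings {..<n}" and d: "1 \<le> d"
    and y: "\<And>i. i \<le> d \<Longrightarrow> \<bar>overlap_estimate (cheb_design d B) \<omega> (P, Q) i - measure_pmf.expectation
       (sample_pmf n (generator n k h J) (sample_time (max_time k \<alpha>) (cheb_design d B) i)) (overlap_sample (P, Q))\<bar> \<le> \<eta>"
  shows "\<bar>ptm_estimate (max_time k \<alpha>) (cheb_design d B) \<omega> (P, Q) - Re (ptm n (generator n k h J) (P, Q))\<bar>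
    \<le> 16 * (\<alpha> * k) * ((real d + 1) ^ 3 * (\<eta> + 1 / 4 ^ d))"
proof -
  interpret tot: lindbladian n "total_ham n k h" "jump_index n k J" "jump J" by (rule lindbladian_total[OF L])
  let ?F = "generator n k h J" and ?p = "pauli_mat {..<n}"
  define c where "c = (\<lambda>m. Re (ptm n (?F ^^ m) (P, Q)))"
  have c_bound: "\<bar>c m\<bar> \<le> (\<alpha> * k) ^ m * fact m" for m
    using ptm_funpow_bound[OF L \<alpha>(1) n P, of m Q] abs_Re_le_cmod[of "ptm n (?F ^^ m) (P, Q)"] by (simp add: c_def)
  have sums: "(\<lambda>m. t ^ m / fact m * c m) sums measure_pmf.expectation (sample_pmf n ?F t) (overlap_sample (P, Q))" if "0 \<le> t" for t
  proof -
    have "(\<lambda>m. of_real (t ^ m / fact m) * mtrace (?p P * (?F ^^ m) (?p Q)) / 2 ^ n) sums (mtrace (?p P * exp_superop n ?F t (?p Q)) / 2 ^ n)"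
      unfolding generator_eq_lind by (intro sums_divide mtrace_exp_superop tot.linear_F that) auto
    then have "(\<lambda>m. Re (of_real (t ^ m / fact m) * mtrace (?p P * (?F ^^ m) (?p Q)) / 2 ^ n)) sums Re (mtrace (?p P * exp_superop n ?F t (?p Q)) / 2 ^ n)"
      by (rule sums_Re)
    also have "Re (mtrace (?p P * exp_superop n ?F t (?p Q)) / 2 ^ n) = measure_pmf.expectation (sample_pmf n ?F t) (overlap_sample (P, Q))"
      unfolding generator_eq_lind using tot.expectation_overlap_sample(1)[OF that P(1) Q] by simp
    also have "(\<lambda>m. Re (of_real (t ^ m / fact m) * mtrace (?p P * (?F ^^ m) (?p Q)) / 2 ^ n)) = (\<lambda>m. t ^ m / fact m * c m)"
      unfolding c_def ptm_def fst_conv snd_conv times_divide_eq_right[symmetric] by (simp only: Re_complex_of_real times_complex.sel(1) Im_complex_of_real mult_zero_left diff_zero)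
    finally show ?thesis .
  qed
  have t0: "0 \<le> sample_time (max_time k \<alpha>) (cheb_design d B) i" for i
  proof -
    have "-1 \<le> cos (cheb_angle (Suc d) i)" by (rule cos_ge_minus_one)
    then have "0 \<le> 1 + cos (cheb_angle (Suc d) i)" by linarith
    then show ?thesis using \<alpha>(2) by (simp add: sample_time_def cheb_design_def max_time_def)
  qed
  have "\<bar>2 / max_time k \<alpha> * poly (pderiv (robust_fit (cheb_design d B) (overlap_estimate (cheb_design d B) \<omega> (P, Q)))) (-1) - c 1\<bar>
    \<le> 16 * (\<alpha> * k) * ((real d + 1) ^ 3 * (\<eta> + 1 / 4 ^ d))"
    by (rule derivative_estimate[OF c_bound _ _ d sums[OF t0] y]) (use \<alpha>(2) k in \<open>auto simp: max_time_def\<close>)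
  moreover have "c 1 = Re (ptm n ?F (P, Q))" by (simp add: c_def)
  ultimately show ?thesis unfolding ptm_estimate_eq by simp
qed

section \<open>Choice of the design\<close>

text \<open>The factor 2 ensures \<open>2 ^ d \<ge> D / \<epsilon>\<close>, as ln 2 is at least 1/2.
  Half of the decay \<open>1 / 4 ^ d\<close> then pays for the loss \<open>(d + 1) ^ 3\<close>, and
  the other half makes the Taylor error of order \<epsilon> / D.\<close>

definition fit_deg :: "nat \<Rightarrow> nat \<Rightarrow> real \<Rightarrow> nat" where
  "fit_deg k \<Delta> \<epsilon> = nat \<lceil>2 * ln (2 + degree_factor k \<Delta> / \<epsilon>)\<rceil>"

text \<open>Chosen to cancel both amplifications of an overlap error: \<open>(d + 1) ^ 3\<close> by
  differentiation and the degree factor by peeling.\<close>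

definition overlap_accuracy :: "nat \<Rightarrow> nat \<Rightarrow> real \<Rightarrow> real" where
  "overlap_accuracy k \<Delta> \<epsilon> = \<epsilon> / (degree_factor k \<Delta> * (real (fit_deg k \<Delta> \<epsilon>) + 1) ^ 3)"

text \<open>
  The bound on the sample number is \<open>ln (1 / \<delta>)\<close> up to factors if \<open>N = 1\<close>, hence arbitrarily small,
  so that no sample may be taken; then only the pair of identities is supplied and nothing has to be learnt.
\<close>

definition cheb_batch :: "nat \<Rightarrow> nat \<Rightarrow> real \<Rightarrow> real \<Rightarrow> nat \<Rightarrow> nat" where
  "cheb_batch k \<Delta> \<epsilon> \<delta> N = (if N \<le> 1 then 0 else
     nat \<lceil>2 * 81 ^ k * ln (2 * real N * (real (fit_deg k \<Delta> \<epsilon>) + 1) / \<delta>) / (overlap_accuracy k \<Delta> \<epsilon>)\<^sup>2\<rceil>)"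

definition learning_design :: "nat \<Rightarrow> nat \<Rightarrow> real \<Rightarrow> real \<Rightarrow> nat \<Rightarrow> design" where
  "learning_design k \<Delta> \<epsilon> \<delta> N = cheb_design (fit_deg k \<Delta> \<epsilon>) (cheb_batch k \<Delta> \<epsilon> \<delta> N)"

lemma ln_ge_1: "1 \<le> ln x" if "3 \<le> x" for x :: real
proof -
  have "exp 1 \<le> x" using exp_le that by linarith
  then show ?thesis using that by (subst ln_ge_iff) auto
qed

lemma fit_deg_bounds:
  assumes "0 < \<epsilon>" "\<epsilon> < 1"
  shows "1 \<le> fit_deg k \<Delta> \<epsilon>" "2 * ln (2 + degree_factor k \<Delta> / \<epsilon>) \<le> fit_deg k \<Delta> \<epsilon>"
    "real (fit_deg k \<Delta> \<epsilon>) \<le> 3 * ln (2 + degree_factor k \<Delta> / \<epsilon>)" "1 \<le> degree_factor k \<Delta> / \<epsilon>"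
proof -
  let ?x = "degree_factor k \<Delta> / \<epsilon>"
  show x: "1 \<le> ?x" using assms degree_factor_ge_1[of k \<Delta>] by (simp add: pos_le_divide_eq)
  then have l: "1 \<le> ln (2 + ?x)" by (intro ln_ge_1) simp
  show 2: "2 * ln (2 + ?x) \<le> fit_deg k \<Delta> \<epsilon>" unfolding fit_deg_def by linarith
  then show "1 \<le> fit_deg k \<Delta> \<epsilon>" using l by linarith
  show "real (fit_deg k \<Delta> \<epsilon>) \<le> 3 * ln (2 + ?x)" unfolding fit_deg_def using l by linarith
qed

lemma cube_le_8_power: "(real d + 1) ^ 3 \<le> 8 * 2 ^ d"
proof (induction d)
  case (Suc d)
  show ?case
  proof (cases "d \<le> 3")
    case True
    then consider "d = 0" | "d = 1" | "d = 2" | "d = 3" by linarith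
    then show ?thesis by cases simp_all
  next
    case False
    then have "4 * 1 \<le> real d * 1" by simp
    have "(real (Suc d) + 1) ^ 3 \<le> 2 * (real d + 1) ^ 3"
    proof -
      \<comment> \<open>The shift by 4 gives the difference nonnegative coefficients; the smaller
        degrees are checked one by one.\<close>
      define y where "y = real d - 4"
      have y: "y \<ge> 0" "real d = y + 4" using False by (auto simp: y_def)
      have "2 * (real d + 1) ^ 3 - (real (Suc d) + 1) ^ 3 = y ^ 3 + 12 * y ^ 2 + 42 * y + 34"
        unfolding of_nat_Suc y(2) by (simp add: power3_eq_cube power2_eq_square algebra_simps)
      also have "\<dots> \<ge> 0" using y(1) by simp
      finally show ?thesis by simp
    qed
    then show ?thesis using Suc by simp
  qed
qed simp

text \<open>9 = 1 + 8: the overlap part is exactly \<epsilon> / D, and the Taylor part at most 8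
  times that.\<close>

lemma fit_deg_error:
  assumes "0 < \<epsilon>" "\<epsilon> < 1"
  shows "(real (fit_deg k \<Delta> \<epsilon>) + 1) ^ 3 * (overlap_accuracy k \<Delta> \<epsilon> + 1 / 4 ^ fit_deg k \<Delta> \<epsilon>) \<le> 9 * (\<epsilon> / degree_factor k \<Delta>)"
proof -
  let ?d = "fit_deg k \<Delta> \<epsilon>" and ?D = "degree_factor k \<Delta>"
  have D: "?D > 0" using degree_factor_ge_1[of k \<Delta>] by linarith
  have "0 < ?D / \<epsilon>" using D assms by simp
  then have "?D / \<epsilon> \<le> exp (ln (2 + ?D / \<epsilon>))" by (subst exp_ln) linarith+
  also have "\<dots> \<le> exp (real ?d * ln 2)"
  proof -
    have "1 / 2 \<le> ln (2 :: real)" using ln2_ge_two_thirds by simp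
    then have "real ?d * (1 / 2) \<le> real ?d * ln 2" by (intro mult_left_mono) auto
    then show ?thesis using fit_deg_bounds(2)[OF assms, of k \<Delta>] by simp
  qed
  also have "\<dots> = 2 ^ ?d" by (simp add: exp_of_nat_mult)
  finally have "1 / 2 ^ ?d \<le> \<epsilon> / ?D" using D assms by (simp add: field_simps)
  moreover have "(real ?d + 1) ^ 3 * (1 / 4 ^ ?d) \<le> 8 * 2 ^ ?d * (1 / 4 ^ ?d)"
    by (intro mult_right_mono cube_le_8_power) simp
  moreover have "8 * 2 ^ ?d * (1 / 4 ^ ?d :: real) = 8 * (1 / 2 ^ ?d)"
    by (simp add: field_simps flip: power_mult_distrib)
  moreover have "(real ?d + 1) ^ 3 * overlap_accuracy k \<Delta> \<epsilon> = \<epsilon> / ?D"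
    using D by (simp add: overlap_accuracy_def add_nonneg_eq_0_iff)
  ultimately show ?thesis by (simp add: distrib_left)
qed

text \<open>The batch carries \<open>w ^ 6\<close> from the squared accuracy and one
  \<open>w\<close> from bounding the logarithm of the union bound; the number of times supplies the
  eighth. Each \<open>w\<close> is at most four times the logarithm, whence
  \<open>4 ^ 8\<close>.\<close>

lemma n_samples_learning_design:
  assumes "0 < \<epsilon>" "\<epsilon> < 1" "0 < \<delta>" "\<delta> < 1"
  shows "real (n_samples (learning_design k \<Delta> \<epsilon> \<delta> N)) \<le>
    12 * 81 ^ k * 4 ^ 8 * ((degree_factor k \<Delta>)\<^sup>2 / \<epsilon>\<^sup>2 * ln (real N / \<delta>)) * ln (2 + degree_factor k \<Delta> / \<epsilon> + real N) ^ 8"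
proof -
  let ?D = "degree_factor k \<Delta>" and ?d = "fit_deg k \<Delta> \<epsilon>" and ?B = "cheb_batch k \<Delta> \<epsilon> \<delta> N"
  define x where "x = ?D / \<epsilon>"
  define \<Lambda> where "\<Lambda> = ln (real N / \<delta>)"
  define l where "l = ln (2 + x + real N)"
  define w where "w = real ?d + 1"
  have x: "1 \<le> x" unfolding x_def using fit_deg_bounds(4)[OF assms(1,2)] .
  have n: "real (n_samples (learning_design k \<Delta> \<epsilon> \<delta> N)) = w * real ?B"
    by (simp add: n_samples_def learning_design_def cheb_design_def w_def distrib_right)
  have l1: "1 \<le> l" unfolding l_def using x by (intro ln_ge_1) simp
  have wl: "w \<le> 4 * l"
  proof -
    have "ln (2 + x) \<le> l" unfolding l_def using x by simp
    then show ?thesis using fit_deg_bounds(3)[OF assms(1,2), of k \<Delta>] l1 by (simp add: w_def x_def)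
  qed
  have w1: "1 \<le> w" by (simp add: w_def)
  have "w * real ?B \<le> 12 * 81 ^ k * 4 ^ 8 * (x\<^sup>2 * \<Lambda>) * l ^ 8"
  proof (cases "N \<le> 1")
    case True
    have "0 \<le> \<Lambda>"
    proof (cases "N = 0")
      case False
      then show ?thesis using True assms by (simp add: \<Lambda>_def)
    qed (simp add: \<Lambda>_def)
    then show ?thesis using True l1 by (simp add: cheb_batch_def)
  next
    case False
    then have N: "2 \<le> real N" by simp
    have "2 \<le> real N / \<delta>" using N assms by (simp add: pos_le_divide_eq)
    then have "ln 2 \<le> \<Lambda>" unfolding \<Lambda>_def by simp
    \<comment> \<open>From two pairs on, this logarithm stays away from zero and can absorb additive
      terms.\<close>
    then have \<Lambda>: "1 \<le> 2 * \<Lambda>" using ln2_ge_two_thirds by linarith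
    have "ln (2 * real N * w / \<delta>) = \<Lambda> + ln (2 * w)"
      using N assms w1 by (simp add: \<Lambda>_def ln_mult ln_div)
    also have "ln (2 * w) \<le> 2 * w" using ln_bound[of "2 * w"] w1 by simp
    also have "\<Lambda> + 2 * w \<le> 5 * w * \<Lambda>"
    proof -
      have "1 * \<Lambda> \<le> w * \<Lambda>" "2 * w * 1 \<le> 2 * w * (2 * \<Lambda>)" using w1 \<Lambda> by (intro mult_right_mono mult_left_mono; linarith)+
      then show ?thesis by linarith
    qed
    finally have ln_le: "ln (2 * real N * w / \<delta>) \<le> 5 * w * \<Lambda>" by simp
    have acc: "1 / (overlap_accuracy k \<Delta> \<epsilon>)\<^sup>2 = x\<^sup>2 * w ^ 6"
      using assms by (simp add: overlap_accuracy_def x_def w_def power_divide power_mult_distrib flip: power_mult)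
    let ?Y = "81 ^ k * (x\<^sup>2 * \<Lambda>) * w ^ 7"
    have "2 * 81 ^ k * ln (2 * real N * w / \<delta>) / (overlap_accuracy k \<Delta> \<epsilon>)\<^sup>2 = 2 * 81 ^ k * ln (2 * real N * w / \<delta>) * (x\<^sup>2 * w ^ 6)"
      by (simp flip: acc)
    also have "\<dots> \<le> 2 * 81 ^ k * (5 * w * \<Lambda>) * (x\<^sup>2 * w ^ 6)"
      using w1 by (intro mult_right_mono mult_left_mono ln_le) auto
    also have "\<dots> = 10 * ?Y" by (simp add: power_numeral_reduce algebra_simps)
    finally have le: "2 * 81 ^ k * ln (2 * real N * w / \<delta>) / (overlap_accuracy k \<Delta> \<epsilon>)\<^sup>2 \<le> 10 * ?Y" .
    \<comment> \<open>The unit lost in rounding up is at most \<open>2 * ?Y\<close>, which raises 10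
      to 12.\<close>
    have Y: "1 \<le> 2 * ?Y"
    proof -
      have "(1 :: real) * (1 * 1) * 1 \<le> 81 ^ k * (x\<^sup>2 * (2 * \<Lambda>)) * w ^ 7"
        using x w1 \<Lambda> by (intro mult_mono one_le_power) (auto intro: mult_mono)
      then show ?thesis by simp
    qed
    have "real ?B \<le> 10 * ?Y + 1"
    proof -
      have "real ?B = real (nat \<lceil>2 * 81 ^ k * ln (2 * real N * w / \<delta>) / (overlap_accuracy k \<Delta> \<epsilon>)\<^sup>2\<rceil>)"
        using False by (simp add: cheb_batch_def w_def)
      also have "\<dots> \<le> 10 * ?Y + 1" using le Y by linarith
      finally show ?thesis .
    qed
    with Y have "real ?B \<le> 12 * ?Y" by linarith
    then have "w * real ?B \<le> w * (12 * ?Y)" using w1 by (intro mult_left_mono) auto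
    also have "\<dots> = 12 * 81 ^ k * (x\<^sup>2 * \<Lambda>) * w ^ 8" by (simp add: power_numeral_reduce algebra_simps)
    also have "\<dots> \<le> 12 * 81 ^ k * (x\<^sup>2 * \<Lambda>) * (4 * l) ^ 8"
      using wl w1 \<Lambda> by (intro mult_left_mono power_mono) auto
    also have "\<dots> = 12 * 81 ^ k * 4 ^ 8 * (x\<^sup>2 * \<Lambda>) * l ^ 8" by (simp add: power_mult_distrib)
    finally show ?thesis .
  qed
  then show ?thesis unfolding n by (simp add: x_def \<Lambda>_def l_def power_divide)
qed

text \<open>The degree factor is now a constant. It leaves the logarithm by ln (D' y) = ln D' + ln y
  \<le> (ln D' + 1) ln y, valid since ln y \<ge> 1.\<close>

lemma n_samples_bounded_degree:
  assumes "0 < \<epsilon>" "\<epsilon> < 1" "0 < \<delta>" "\<delta> < 1" "\<Delta> \<le> \<Delta>'"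
  shows "real (n_samples (learning_design k \<Delta> \<epsilon> \<delta> N)) \<le>
    12 * 81 ^ k * 4 ^ 8 * (degree_factor k \<Delta>')\<^sup>2 * (ln (degree_factor k \<Delta>') + 1) ^ 8 * (1 / \<epsilon>\<^sup>2 * ln (real N / \<delta>))
      * ln (2 + 1 / \<epsilon> + real N) ^ 8"
proof -
  let ?D = "degree_factor k \<Delta>" and ?D' = "degree_factor k \<Delta>'"
  define \<Lambda> where "\<Lambda> = ln (real N / \<delta>)"
  define m where "m = ln (2 + 1 / \<epsilon> + real N)"
  have D: "1 \<le> ?D" "?D \<le> ?D'" using degree_factor_ge_1 degree_factor_mono[OF assms(5)] by auto
  have \<Lambda>: "0 \<le> \<Lambda>"
  proof (cases "N = 0")
    case False
    then have "1 \<le> real N / \<delta>" using assms by (simp add: pos_le_divide_eq)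
    then show ?thesis by (simp add: \<Lambda>_def)
  qed (simp add: \<Lambda>_def)
  have m1: "1 \<le> m"
    unfolding m_def using assms by (intro ln_ge_1) (simp add: add_increasing2)
  have "ln (2 + ?D / \<epsilon> + real N) \<le> ln (?D' * (2 + 1 / \<epsilon> + real N))"
  proof -
    have "2 * 1 \<le> 2 * ?D'" "?D / \<epsilon> \<le> ?D' / \<epsilon>" "real N * 1 \<le> real N * ?D'"
      using D assms by (intro mult_left_mono divide_right_mono; linarith)+
    then have "2 + ?D / \<epsilon> + real N \<le> ?D' * (2 + 1 / \<epsilon> + real N)" by (simp add: algebra_simps)
    moreover have "0 < 2 + ?D / \<epsilon> + real N" using D assms by (simp add: add_pos_nonneg)
    ultimately show ?thesis by simp
  qed
  also have "\<dots> = ln ?D' + m"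
  proof -
    have "0 < 2 + 1 / \<epsilon> + real N" using assms by (simp add: add_pos_nonneg)
    then show ?thesis unfolding m_def using D by (simp add: ln_mult)
  qed
  also have "\<dots> \<le> (ln ?D' + 1) * m"
    using mult_left_mono[OF m1, of "ln ?D'"] D by (simp add: distrib_right)
  finally have "ln (2 + ?D / \<epsilon> + real N) \<le> (ln ?D' + 1) * m" .
  moreover have "0 \<le> ln (2 + ?D / \<epsilon> + real N)" using D assms by (intro ln_ge_zero) (simp add: add_increasing2)
  ultimately have p: "ln (2 + ?D / \<epsilon> + real N) ^ 8 \<le> ((ln ?D' + 1) * m) ^ 8" by (intro power_mono)
  have q: "?D\<^sup>2 / \<epsilon>\<^sup>2 * \<Lambda> \<le> ?D'\<^sup>2 / \<epsilon>\<^sup>2 * \<Lambda>"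
    using D \<Lambda> assms by (intro mult_right_mono divide_right_mono power_mono) auto
  have "real (n_samples (learning_design k \<Delta> \<epsilon> \<delta> N)) \<le> 12 * 81 ^ k * 4 ^ 8 * (?D\<^sup>2 / \<epsilon>\<^sup>2 * \<Lambda>) * ln (2 + ?D / \<epsilon> + real N) ^ 8"
    unfolding \<Lambda>_def by (rule n_samples_learning_design[OF assms(1-4)])
  also have "\<dots> \<le> 12 * 81 ^ k * 4 ^ 8 * (?D'\<^sup>2 / \<epsilon>\<^sup>2 * \<Lambda>) * ((ln ?D' + 1) * m) ^ 8"
    using \<Lambda> by (intro mult_mono[OF mult_left_mono[OF q] p]) auto
  also have "\<dots> = 12 * 81 ^ k * 4 ^ 8 * ?D'\<^sup>2 * (ln ?D' + 1) ^ 8 * (1 / \<epsilon>\<^sup>2 * \<Lambda>) * m ^ 8"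
    by (simp add: power_mult_distrib)
  finally show ?thesis by (simp add: \<Lambda>_def m_def)
qed

text \<open>The batch size solves Hoeffding's bound for a failure probability \<delta> / (N (d + 1))
  per pair and time, so that the union bound adds up to \<delta>.\<close>

lemma cheb_batch_failure:
  assumes "0 < \<epsilon>" "\<epsilon> < 1" "0 < \<delta>" "\<delta> < 1" and N: "2 \<le> N"
  shows "0 < cheb_batch k \<Delta> \<epsilon> \<delta> N"
    and "real N * (real (fit_deg k \<Delta> \<epsilon>) + 1) * (2 * exp (- (real (cheb_batch k \<Delta> \<epsilon> \<delta> N) * (overlap_accuracy k \<Delta> \<epsilon>)\<^sup>2 / (2 * 81 ^ k)))) \<le> \<delta>"
proof -
  let ?B = "cheb_batch k \<Delta> \<epsilon> \<delta> N" and ?\<eta> = "overlap_accuracy k \<Delta> \<epsilon>"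
  define w where "w = real (fit_deg k \<Delta> \<epsilon>) + 1"
  define y where "y = 2 * real N * w / \<delta>"
  have w: "1 \<le> w" by (simp add: w_def)
  have \<eta>: "0 < ?\<eta>" using assms degree_factor_ge_1[of k \<Delta>] by (simp add: overlap_accuracy_def)
  have "\<delta> * 1 < 2 * (real N * w)"
  proof -
    have "2 * 1 \<le> real N * w" using N w by (intro mult_mono) auto
    then show ?thesis using assms by linarith
  qed
  then have y: "1 < y" using assms by (simp add: y_def field_simps)
  have B: "2 * 81 ^ k * ln y / ?\<eta>\<^sup>2 \<le> real ?B"
    using N unfolding cheb_batch_def y_def w_def by (simp add: real_nat_ceiling_ge)
  moreover have "0 < 2 * 81 ^ k * ln y / ?\<eta>\<^sup>2" using y \<eta> by simp
  ultimately show "0 < ?B" by (metis less_le_trans of_nat_0_less_iff)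
  have "ln y \<le> real ?B * ?\<eta>\<^sup>2 / (2 * 81 ^ k)" using B \<eta> by (simp add: field_simps)
  then have "exp (- (real ?B * ?\<eta>\<^sup>2 / (2 * 81 ^ k))) \<le> exp (- ln y)" by simp
  also have "\<dots> = 1 / y" using y by (simp add: exp_minus inverse_eq_divide)
  finally have "real N * w * (2 * exp (- (real ?B * ?\<eta>\<^sup>2 / (2 * 81 ^ k)))) \<le> real N * w * (2 * (1 / y))"
    using w by (intro mult_left_mono) auto
  also have "\<dots> = \<delta>" using w N assms by (simp add: y_def)
  finally show "real N * (real (fit_deg k \<Delta> \<epsilon>) + 1) * (2 * exp (- (real ?B * ?\<eta>\<^sup>2 / (2 * 81 ^ k)))) \<le> \<delta>"
    by (simp add: w_def)
qed

text \<open>The probabilistic half: a union bound over \<open>Omega n k E\<close> and the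
  \<open>d + 1\<close> times. The constant 144 is 16 from the derivative estimate times 9 from
  \<open>fit_deg_error\<close>; \<open>4 ^ k\<close> is the cost of the local inversion.\<close>

lemma learning_design_succeeds:
  fixes n k :: nat and \<alpha> :: real
  assumes k: "1 \<le> k" and \<alpha>: "0 < \<alpha>" "interaction_strength n k h J \<le> \<alpha>" and n: "0 < n" and L: "local_data n k h J"
    and chi: "chi_expansion n (generator n k h J) chi" and lin: "lindblad_expansion n (generator n k h J) h G"
    and E: "E \<subseteq> edges n k"
    and exact: "\<forall>P\<in>pauli_strings {..<n}. \<forall>Q\<in>pauli_strings {..<n}. (P, Q) \<notin> Omega n k E \<longrightarrow> chi (P, Q) = 0"
    and deg: "\<forall>e\<in>E. card {e' \<in> E. e' \<noteq> e \<and> e' \<inter> e \<noteq> {}} \<le> \<Delta>"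
    and eps: "0 < \<epsilon>" "\<epsilon> < 1" "0 < \<delta>" "\<delta> < 1"
    and us: "distinct us" "set us = Omega n k E - {(id_string, id_string)}"
    and C: "144 * 4 ^ k * \<alpha> * k \<le> C"
  defines "N \<equiv> card (Omega n k E)"
  shows "1 - \<delta> \<le> measure_pmf.prob (data_pmf n (generator n k h J) (max_time k \<alpha>) (learning_design k \<Delta> \<epsilon> \<delta> N))
    {\<omega>. accurate n (C * \<epsilon>) G h (fst (supplied_support_run k \<alpha> (learning_design k \<Delta> \<epsilon> \<delta> N) us \<omega>))}"
proof -
  let ?F = "generator n k h J" and ?T = "max_time k \<alpha>" and ?D = "degree_factor k \<Delta>" and ?d = "fit_deg k \<Delta> \<epsilon>"
  let ?B = "cheb_batch k \<Delta> \<epsilon> \<delta> N" and ?\<eta> = "overlap_accuracy k \<Delta> \<epsilon>" and ?O = "Omega n k E"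
  let ?des = "cheb_design ?d ?B"
  interpret tot: lindbladian n "total_ham n k h" "jump_index n k J" "jump J" by (rule lindbladian_total[OF L])
  define D where "D = data_pmf n ?F ?T ?des"
  define \<mu> where "\<mu> = (\<lambda>u i. measure_pmf.expectation (sample_pmf n ?F (sample_time ?T ?des i)) (overlap_sample u))"
  define e where "e = 16 * (\<alpha> * k) * ((real ?d + 1) ^ 3 * (?\<eta> + 1 / 4 ^ ?d))"
  define good where "good = {\<omega>. accurate n (C * \<epsilon>) G h (fst (postprocess k us (ptm_estimate ?T ?des \<omega>)))}"
  have D1: "1 \<le> ?D" by (rule degree_factor_ge_1)
  have \<eta>0: "0 \<le> ?\<eta>" using eps D1 by (simp add: overlap_accuracy_def)
  have e0: "0 \<le> e" unfolding e_def using \<alpha> \<eta>0 by (intro mult_nonneg_nonneg add_nonneg_nonneg) auto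
  have C0: "0 \<le> C" using C \<alpha> by (intro order_trans[OF _ C] mult_nonneg_nonneg) auto
  have e_le: "4 ^ k * e * ?D \<le> C * \<epsilon>"
  proof -
    have "e \<le> 16 * (\<alpha> * k) * (9 * (\<epsilon> / ?D))"
      unfolding e_def using \<alpha> by (intro mult_left_mono fit_deg_error eps) auto
    then have "4 ^ k * e * ?D \<le> 4 ^ k * (16 * (\<alpha> * k) * (9 * (\<epsilon> / ?D))) * ?D"
      using D1 by (intro mult_right_mono mult_left_mono) auto
    also have "\<dots> = (144 * 4 ^ k * \<alpha> * k) * \<epsilon>" using D1 by simp
    also have "\<dots> \<le> C * \<epsilon>" using C eps by (intro mult_right_mono) auto
    finally show ?thesis .
  qed
  \<comment> \<open>If all overlaps are accurate then so is the output; for empty \<open>us\<close>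
    the premise is void and every outcome is good.\<close>
  have accI: "\<omega> \<in> good" if "\<And>u i. us \<noteq> [] \<Longrightarrow> u \<in> ?O \<Longrightarrow> i \<le> ?d \<Longrightarrow> \<bar>overlap_estimate ?des \<omega> u i - \<mu> u i\<bar> \<le> ?\<eta>" for \<omega>
    unfolding good_def mem_Collect_eq
  proof (rule postprocess_accurate[OF L chi lin E exact deg us, where e = e])
    fix u assume ne: "us \<noteq> []" and u: "u \<in> ?O"
    have "\<bar>ptm_estimate ?T ?des \<omega> (fst u, snd u) - Re (ptm n ?F (fst u, snd u))\<bar> \<le> e"
      unfolding e_def
    proof (rule ptm_estimate_error[OF L \<alpha>(2,1) n k])
      show "fst u \<in> pauli_strings {..<n}" "snd u \<in> pauli_strings {..<n}" "card (supp (fst u)) \<le> k"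
        using Omega_props[OF u] by auto
      show "1 \<le> ?d" using fit_deg_bounds(1)[OF eps(1,2)] .
      fix i assume "i \<le> ?d"
      from that[OF ne u this] show "\<bar>overlap_estimate ?des \<omega> (fst u, snd u) i -
          measure_pmf.expectation (sample_pmf n ?F (sample_time ?T ?des i)) (overlap_sample (fst u, snd u))\<bar> \<le> ?\<eta>"
        by (simp add: \<mu>_def)
    qed
    then show "\<bar>ptm_estimate ?T ?des \<omega> u - Re (ptm n ?F u)\<bar> \<le> e" by simp
  qed (use e0 e_le C0 eps in auto)
  have "1 - \<delta> \<le> measure_pmf.prob D good"
  proof (cases "us = []")
    case True
    then have "good = UNIV" using accI by blast
    then show ?thesis using eps by simp
  next
    case False
    then obtain u where u: "u \<in> ?O" "u \<noteq> (id_string, id_string)" using us(2) by (metis DiffE equals0I insertCI set_empty)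
    \<comment> \<open>The discarded pair still counts in \<open>N\<close>, so a nonempty
      \<open>us\<close> forces \<open>N\<close> to be at least 2 and the batch to be
      nonempty.\<close>
    have "(id_string, id_string) \<in> ?O"
      using u(1) by (auto simp: Omega_def local_pairs_def supp_def id_string_def pauli_strings_def)
    then have "card {u, (id_string, id_string)} \<le> N" unfolding N_def using u by (intro card_mono) auto
    then have N2: "2 \<le> N" using u by simp
    note B = cheb_batch_failure[OF eps N2, of k \<Delta>]
    define bad where "bad = (\<lambda>u i. {\<omega>. ?\<eta> \<le> \<bar>overlap_estimate ?des \<omega> u i - \<mu> u i\<bar>})"
    let ?I = "?O \<times> {..?d}"
    have t0: "0 \<le> sample_time ?T ?des i" for i
    proof -
      have "-1 \<le> cos (cheb_angle (Suc ?d) i)" by (rule cos_ge_minus_one)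
      then have "0 \<le> 1 + cos (cheb_angle (Suc ?d) i)" by linarith
      then show ?thesis using \<alpha>(1) by (simp add: sample_time_def cheb_design_def max_time_def)
    qed
    have bad_le: "measure_pmf.prob D (bad u i) \<le> 2 * exp (- (real ?B * ?\<eta>\<^sup>2 / (2 * 81 ^ k)))" if "u \<in> ?O" "i \<le> ?d" for u i
    proof -
      have fin: "finite (set_pmf (sample_pmf n ?F (sample_time ?T ?des i)))"
        unfolding generator_eq_lind using Omega_props(1)[OF that(1)]
        by (intro tot.expectation_overlap_sample(2)[OF t0, of "fst u" "snd u"]) auto
      show ?thesis
        using overlap_estimate_concentration[OF B(1) that(2) Omega_props(4,5)[OF that(1)] \<eta>0 fin]
        by (simp add: bad_def D_def \<mu>_def)
    qed
    have "- good \<subseteq> (\<Union>j\<in>?I. bad (fst j) (snd j))"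
    proof
      fix \<omega> assume "\<omega> \<in> - good"
      then obtain u i where "u \<in> ?O" "i \<le> ?d" "\<not> \<bar>overlap_estimate ?des \<omega> u i - \<mu> u i\<bar> \<le> ?\<eta>" using accI by blast
      then have "(u, i) \<in> ?I" "\<omega> \<in> bad (fst (u, i)) (snd (u, i))" by (auto simp: bad_def)
      then show "\<omega> \<in> (\<Union>j\<in>?I. bad (fst j) (snd j))" by (rule UN_I)
    qed
    then have "measure_pmf.prob D (- good) \<le> measure_pmf.prob D (\<Union>j\<in>?I. bad (fst j) (snd j))"
      by (intro measure_pmf.finite_measure_mono) auto
    also have "\<dots> \<le> (\<Sum>j\<in>?I. measure_pmf.prob D (bad (fst j) (snd j)))"
      by (intro measure_pmf.finite_measure_subadditive_finite) auto
    also have "\<dots> \<le> (\<Sum>j\<in>?I. 2 * exp (- (real ?B * ?\<eta>\<^sup>2 / (2 * 81 ^ k))))"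
      by (intro sum_mono bad_le) auto
    also have "\<dots> = real N * (real ?d + 1) * (2 * exp (- (real ?B * ?\<eta>\<^sup>2 / (2 * 81 ^ k))))"
      by (simp add: N_def card_cartesian_product algebra_simps)
    also have "\<dots> \<le> \<delta>" by (rule B(2))
    finally show ?thesis using measure_pmf.prob_compl[of good D] by (simp add: Compl_eq_Diff_UNIV)
  qed
  then show ?thesis
    unfolding D_def good_def learning_design_def supplied_support_run_def .
qed

text \<open>The order of the quantifiers carries the uniformity: constants and design are chosen
  from k and \<alpha> before any system, and the design sees a system only through \<Delta> and the
  number of supplied pairs. The time bound holds for all data; its maximum with 1 covers an empty
  \<open>Omega n k E\<close>.\<close>

theorem corollary3p9:
  fixes k :: nat and \<alpha> :: real
  assumes "1 \<le> k" and "0 < \<alpha>"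
  shows "\<exists>(C::real) (c::nat) (des :: nat \<Rightarrow> real \<Rightarrow> real \<Rightarrow> nat \<Rightarrow> design).
    (\<forall>\<Delta> \<epsilon> \<delta> N. 0 < \<epsilon> \<and> \<epsilon> < 1 \<and> 0 < \<delta> \<and> \<delta> < 1 \<longrightarrow>
       valid_design (des \<Delta> \<epsilon> \<delta> N) \<and>
       real (fit_degree (des \<Delta> \<epsilon> \<delta> N)) \<le> C * ln (2 + degree_factor k \<Delta> / \<epsilon>) \<and>
       real (n_times (des \<Delta> \<epsilon> \<delta> N))
         \<le> C * real (fit_degree (des \<Delta> \<epsilon> \<delta> N)) * ln (real (fit_degree (des \<Delta> \<epsilon> \<delta> N)) + 1) \<and>
       real (n_samples (des \<Delta> \<epsilon> \<delta> N))
         \<le> C * ((degree_factor k \<Delta>)\<^sup>2 / \<epsilon>\<^sup>2 * ln (real N / \<delta>))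
             * ln (2 + degree_factor k \<Delta> / \<epsilon> + real N) ^ c)
  \<and> (\<forall>\<Delta>max. \<exists>C'::real. \<forall>\<Delta> \<epsilon> \<delta> N.
       \<Delta> \<le> \<Delta>max \<and> 0 < \<epsilon> \<and> \<epsilon> < 1 \<and> 0 < \<delta> \<and> \<delta> < 1 \<longrightarrow>
       real (n_samples (des \<Delta> \<epsilon> \<delta> N))
         \<le> C' * (1 / \<epsilon>\<^sup>2 * ln (real N / \<delta>)) * ln (2 + 1 / \<epsilon> + real N) ^ c)
  \<and> (\<forall>(n::nat) h J chi G E \<Delta> \<epsilon> \<delta> us.
       0 < n \<and>
       local_data n k h J \<and>
       interaction_strength n k h J \<le> \<alpha> \<and>
       chi_expansion n (generator n k h J) chi \<and>
       lindblad_expansion n (generator n k h J) h G \<and>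
       E \<subseteq> edges n k \<and>
       (\<forall>P\<in>pauli_strings {..<n}. \<forall>Q\<in>pauli_strings {..<n}.
          (P, Q) \<notin> Omega n k E \<longrightarrow> chi (P, Q) = 0) \<and>
       (\<forall>e\<in>E. card {e' \<in> E. e' \<noteq> e \<and> e' \<inter> e \<noteq> {}} \<le> \<Delta>) \<and>
       0 < \<epsilon> \<and> \<epsilon> < 1 \<and> 0 < \<delta> \<and> \<delta> < 1 \<and>
       distinct us \<and> set us = Omega n k E - {(id_string, id_string)} \<longrightarrow>
       measure_pmf.prob
         (data_pmf n (generator n k h J) (max_time k \<alpha>) (des \<Delta> \<epsilon> \<delta> (card (Omega n k E))))
         {\<omega>. accurate n (C * \<epsilon>) G h
               (fst (supplied_support_run k \<alpha> (des \<Delta> \<epsilon> \<delta> (card (Omega n k E))) us \<omega>))}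
         \<ge> 1 - \<delta> \<and>
       (\<forall>\<omega>. real (snd (supplied_support_run k \<alpha> (des \<Delta> \<epsilon> \<delta> (card (Omega n k E))) us \<omega>))
              \<le> C * max 1 (real (card (Omega n k E)))))"
proof -
  \<comment> \<open>A sum of three nonnegative constants, so that \<open>C\<close> dominates the one
    for samples, the one for accuracy and the one for running time.\<close>
  define C where "C = 12 * 81 ^ k * 4 ^ 8 + 144 * 4 ^ k * \<alpha> * k + real (postprocess_cost k)"
  have "0 \<le> 144 * 4 ^ k * \<alpha> * k" "(0 :: real) \<le> 12 * 81 ^ k * 4 ^ 8" using assms by auto
  then have C: "12 * 81 ^ k * 4 ^ 8 \<le> C" "144 * 4 ^ k * \<alpha> * k \<le> C" "real (postprocess_cost k) \<le> C"
    by (auto simp: C_def)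
  have "(12 :: real) * 1 * 4 ^ 8 \<le> 12 * 81 ^ k * 4 ^ 8" by (intro mult_right_mono mult_left_mono) auto
  also note C(1)
  finally have C4: "4 \<le> C" by simp
  let ?des = "learning_design k"
  show ?thesis
  proof (rule exI[of _ C], rule exI[of _ 8], rule exI[of _ ?des], intro conjI allI impI; (elim conjE)?)
    fix \<Delta> N :: nat and \<epsilon> \<delta> :: real
    assume eps: "0 < \<epsilon>" "\<epsilon> < 1" "0 < \<delta>" "\<delta> < 1"
    note d = fit_deg_bounds[OF eps(1,2), of k \<Delta>]
    let ?d = "fit_deg k \<Delta> \<epsilon>"
    have sel: "fit_degree (?des \<Delta> \<epsilon> \<delta> N) = ?d" "n_times (?des \<Delta> \<epsilon> \<delta> N) = Suc ?d"
      by (simp_all add: learning_design_def cheb_design_def)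
    show "valid_design (?des \<Delta> \<epsilon> \<delta> N)" unfolding learning_design_def by (rule valid_cheb_design[OF d(1)])
    have "0 \<le> ln (2 + degree_factor k \<Delta> / \<epsilon>)" using d(4) by (intro ln_ge_zero) simp
    then have "3 * ln (2 + degree_factor k \<Delta> / \<epsilon>) \<le> C * ln (2 + degree_factor k \<Delta> / \<epsilon>)"
      using C4 by (intro mult_right_mono) auto
    with d(3) show "real (fit_degree (?des \<Delta> \<epsilon> \<delta> N)) \<le> C * ln (2 + degree_factor k \<Delta> / \<epsilon>)"
      unfolding sel by linarith
    \<comment> \<open>The \<open>d + 1\<close> times fit below the allowed order d log d, using d +
      1 \<le> 2 d and 1 \<le> 2 ln (d + 1); this asks for C \<ge> 4.\<close>
    have "ln 2 \<le> ln (real ?d + 1)" using d(1) by simp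
    then have "1 \<le> 2 * ln (real ?d + 1)" using ln2_ge_two_thirds by linarith
    then have "2 * real ?d * 1 \<le> 2 * real ?d * (2 * ln (real ?d + 1))" by (intro mult_left_mono) auto
    also have "\<dots> = 4 * (real ?d * ln (real ?d + 1))" by simp
    also have "\<dots> \<le> C * (real ?d * ln (real ?d + 1))" using C4 by (intro mult_right_mono) auto
    finally have le: "2 * real ?d * 1 \<le> C * (real ?d * ln (real ?d + 1))" .
    have "real (Suc ?d) \<le> 2 * real ?d * 1" using d(1) by simp
    then show "real (n_times (?des \<Delta> \<epsilon> \<delta> N)) \<le> C * real (fit_degree (?des \<Delta> \<epsilon> \<delta> N)) * ln (real (fit_degree (?des \<Delta> \<epsilon> \<delta> N)) + 1)"
      unfolding sel mult.assoc[of C] using le by (rule order_trans)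
    let ?X = "(degree_factor k \<Delta>)\<^sup>2 / \<epsilon>\<^sup>2 * ln (real N / \<delta>)" and ?l = "ln (2 + degree_factor k \<Delta> / \<epsilon> + real N)"
    have "0 \<le> ln (real N / \<delta>)"
    proof (cases "N = 0")
      case False
      then show ?thesis using eps by (simp add: pos_le_divide_eq)
    qed simp
    moreover have "0 \<le> ?l" using d(4) by (intro ln_ge_zero) simp
    ultimately have "12 * 81 ^ k * 4 ^ 8 * ?X * ?l ^ 8 \<le> C * ?X * ?l ^ 8"
      by (intro mult_right_mono C) auto
    then show "real (n_samples (?des \<Delta> \<epsilon> \<delta> N)) \<le> C * ?X * ?l ^ 8"
      using n_samples_learning_design[OF eps, of k \<Delta> N] by linarith
  next
    fix \<Delta>max :: nat
    show "\<exists>C'. \<forall>\<Delta> \<epsilon> \<delta> N. \<Delta> \<le> \<Delta>max \<and> 0 < \<epsilon> \<and> \<epsilon> < 1 \<and> 0 < \<delta> \<and> \<delta> < 1 \<longrightarrow>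
      real (n_samples (?des \<Delta> \<epsilon> \<delta> N)) \<le> C' * (1 / \<epsilon>\<^sup>2 * ln (real N / \<delta>)) * ln (2 + 1 / \<epsilon> + real N) ^ 8"
      by (rule exI[of _ "12 * 81 ^ k * 4 ^ 8 * (degree_factor k \<Delta>max)\<^sup>2 * (ln (degree_factor k \<Delta>max) + 1) ^ 8"],
          intro allI impI, elim conjE) (rule n_samples_bounded_degree)
  next
    fix n \<Delta> :: nat and h J chi G E and \<epsilon> \<delta> :: real and us
    assume a: "0 < n" "local_data n k h J" "interaction_strength n k h J \<le> \<alpha>"
      "chi_expansion n (generator n k h J) chi" "lindblad_expansion n (generator n k h J) h G" "E \<subseteq> edges n k"
      "\<forall>P\<in>pauli_strings {..<n}. \<forall>Q\<in>pauli_strings {..<n}. (P, Q) \<notin> Omega n k E \<longrightarrow> chi (P, Q) = 0"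
      "\<forall>e\<in>E. card {e' \<in> E. e' \<noteq> e \<and> e' \<inter> e \<noteq> {}} \<le> \<Delta>"
      "0 < \<epsilon>" "\<epsilon> < 1" "0 < \<delta>" "\<delta> < 1" "distinct us" "set us = Omega n k E - {(id_string, id_string)}"
    show "1 - \<delta> \<le> measure_pmf.prob
         (data_pmf n (generator n k h J) (max_time k \<alpha>) (?des \<Delta> \<epsilon> \<delta> (card (Omega n k E))))
         {\<omega>. accurate n (C * \<epsilon>) G h
               (fst (supplied_support_run k \<alpha> (?des \<Delta> \<epsilon> \<delta> (card (Omega n k E))) us \<omega>))}"
      by (rule learning_design_succeeds[OF assms a(3,1,2,4-14) C(2)])
  next
    fix n \<Delta> :: nat and h J chi G E and \<epsilon> \<delta> :: real and us \<omega>
    assume us: "distinct us" "set us = Omega n k E - {(id_string, id_string)}"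
    let ?N = "card (Omega n k E)"
    have "length us = card (set us)" using us(1) by (simp add: distinct_card)
    also have "\<dots> \<le> ?N" unfolding us(2) by (intro card_mono) auto
    finally have len: "max 1 (length us) \<le> max 1 ?N" by auto
    have "finite (union_supp u) \<and> card (union_supp u) \<le> k" if "u \<in> set us" for u
      using that Omega_props(2,3)[of u n k E] unfolding us(2) by blast
    then have "snd (supplied_support_run k \<alpha> (?des \<Delta> \<epsilon> \<delta> ?N) us \<omega>) \<le> postprocess_cost k * max 1 (length us)"
      unfolding supplied_support_run_def by (rule snd_postprocess_le)
    also have "\<dots> \<le> postprocess_cost k * max 1 ?N" using len by (rule mult_le_mono2)
    finally have "real (snd (supplied_support_run k \<alpha> (?des \<Delta> \<epsilon> \<delta> ?N) us \<omega>)) \<le> real (postprocess_cost k * max 1 ?N)"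
      by (rule of_nat_mono)
    also have "\<dots> = real (postprocess_cost k) * max 1 (real ?N)" by (simp add: of_nat_max)
    also have "\<dots> \<le> C * max 1 (real ?N)" using C(3) by (intro mult_right_mono) auto
    finally show "real (snd (supplied_support_run k \<alpha> (?des \<Delta> \<epsilon> \<delta> ?N) us \<omega>)) \<le> C * max 1 (real ?N)" .
  qed
qed

end
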